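(* Under the low-rank setting, Assumption 4 and Assumption 5 (see context), suppose $\tilde d:=\max_id_i>\nu$. Then there is a constant $\widetilde C'>0$ such that for all $\epsilon,\tau,\eta\in(0,1)$, with probability greater than $1-\epsilon-\tau-\eta$, simultaneously for all $f\in\mathcal{M}$, $$R(f)\le\frac1n\sum_{i=1}^n\mathcal{L}(f(\mathbf{x}_i),y_i)+\frac{6\widetilde C'\xi_0^{\nu/\tilde d}}{n^{(\nu/\tilde d+1)/2}(\tilde d/\nu-1)^{\nu/\tilde d}}+\frac{2\sqrt{\log(2/\epsilon)}}{n^{(s-1)/(2s)}}+\frac{32\log(2/\epsilon)}{3n^{(2s-1)/(2s)}}+\frac{2C'}{\eta n^{(s-1)/(2s)}},$$ where $\xi_0=\sum_{i=1}^Ld_ir_i\big\{(nC''/\tau)^{2/s'}\tilde b\prod_{j=i+1}^L\rho_j\big\}^{(d_{i-1}/\nu)\vee1}$, $\tilde b=\sum_{i=1}^Lb_i$, $b_i=\widetilde CR_i\sqrt{r_in}$.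
   Context: Data: $(\mathbf{x}_i,y_i)$, $i=1,\dots,n$, i.i.d. from $P$ on $\mathcal{X}\times\mathcal{Y}$, $\mathcal{X}\subseteq\mathbb{R}^{d_0}$, $\mathcal{Y}\subseteq\mathbb{R}^{d_L}$; $\mathbf{X}=[\mathbf{x}_1,\dots,\mathbf{x}_n]^\top$; $\boldsymbol{\Psi}(\mathbf{X})$ the matrix with rows $\boldsymbol{\Psi}(\mathbf{x}_k)^\top$; $\|\cdot\|_2$ Euclidean/Frobenius norm. Fix $\nu>\max_id_i/2$. For $d\ge1$, $\mathcal{N}_{\mathcal{K}}(\mathbb{R}^d)$ is the RKHS of the isotropic Matérn kernel $\mathcal{K}(\mathbf{x},\mathbf{x}')=k(\mathbf{x}-\mathbf{x}')$, $k(\mathbf{z})=\frac{1}{\Gamma(\nu-d/2)2^{\nu-d/2-1}}\|\mathbf{z}\|_2^{\nu-d/2}K_{\nu-d/2}(\|\mathbf{z}\|_2)$. $\mathcal{A}_r(R)$ is the set of $\boldsymbol{\Psi}=(\psi_1,\dots,\psi_m)$ with all $\psi_i\in\mathcal{N}_\mathcal{K}(\mathbb{R}^d)$, $\dim\mathrm{span}(\psi_1,\dots,\psi_m)\le r$ and $(\sum_i\|\psi_i\|^2_{\mathcal{N}_\mathcal{K}})^{1/2}\le R$. Assumption 5: for each layer $l$, $\mathcal{F}_l=\{\boldsymbol{\Psi}\in\mathcal{A}_{r_l}(R_l)\ (d=d_{l-1},m=d_l):\|\boldsymbol{\Psi}(\mathbf{x})-\boldsymbol{\Psi}(\mathbf{x}')\|_2\le\rho_l\|\mathbf{x}-\mathbf{x}'\|_2\}$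 with positive constants $\rho_l,r_l,R_l$. Standing metric-entropy hypothesis: $\widetilde C>0$ is a constant such that for every $l$, every $\mathbf{Z}\in\mathbb{R}^{n\times d_{l-1}}$ and every $\epsilon>0$, $\log\mathcal{N}(\{\boldsymbol{\Psi}(\mathbf{Z}):\boldsymbol{\Psi}\in\mathcal{A}_{r_l}(R_l)\},\epsilon,\|\cdot\|_2)\le d_lr_l\log(1+\widetilde CR_l\sqrt{r_ln}/\epsilon)+r_l(\widetilde CR_l\sqrt{r_ln}/\epsilon)^{d_{l-1}/\nu}$ (proper covering numbers). $\mathcal{M}=\{\boldsymbol{\Psi}_L\circ\cdots\circ\boldsymbol{\Psi}_1:\boldsymbol{\Psi}_l\in\mathcal{F}_l\}$. Loss $\mathcal{L}:\mathbb{R}^{d_L}\times\mathcal{Y}\to\mathbb{R}$, $R(f)=\mathbb{E}[\mathcal{L}(f(\mathbf{x}),y)]$. Assumption 4: there is $B:\mathcal{Y}\to(0,\infty)$ with $|\mathcal{L}(u,v)-\mathcal{L}(u',v)|\le B(v)\|u-u'\|_2$ for all $u,u'$, $v\in\mathcal{Y}$; there is $G$ with $\sup_{f\in\mathcal{M}}|\mathcal{L}(f(\mathbf{x}),y)|\le G(\mathbf{x},y)$ and $\mathbb{E}[G^s(\mathbf{x},y)]<C'<\infty$ for some $s>1$; and $\mathbb{E}[B^{s'}(y)]<C''<\infty$ for some $s'>0$. $a\vee b=\max(a,b)$. *)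

theory Defs
  imports "HOL-Probability.Probability"
begin

type_synonym vec = "nat \<Rightarrow> real"

text \<open>Euclidean space R^d encoded as real sequences vanishing from index d on.\<close>
definition Vsp :: "nat \<Rightarrow> vec set" where
  "Vsp d = {v. \<forall>i\<ge>d. v i = 0}"

definition vnorm :: "nat \<Rightarrow> vec \<Rightarrow> real" where
  "vnorm d v = sqrt (\<Sum>i<d. (v i)^2)"

definition vdist :: "nat \<Rightarrow> vec \<Rightarrow> vec \<Rightarrow> real" where
  "vdist d u v = sqrt (\<Sum>i<d. (u i - v i)^2)"

text \<open>Modified Bessel function of the second kind (integral representation, z > 0).\<close>
definition besselK :: "real \<Rightarrow> real \<Rightarrow> real" where
  "besselK a z = integral {0..} (\<lambda>t. exp (- z * cosh t) * cosh (a * t))"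

text \<open>Isotropic Matern kernel k on R^d with smoothness nu (value at 0 by continuity).\<close>
definition matern_k :: "real \<Rightarrow> nat \<Rightarrow> vec \<Rightarrow> real" where
  "matern_k \<nu> d z = (let a = \<nu> - real d / 2; t = vnorm d z in
     if t = 0 then 1 else t powr a * besselK a t / (Gamma a * 2 powr (a - 1)))"

definition matern_kernel :: "real \<Rightarrow> nat \<Rightarrow> vec \<Rightarrow> vec \<Rightarrow> real" where
  "matern_kernel \<nu> d x x' = matern_k \<nu> d (\<lambda>i. x i - x' i)"

text \<open>RKHS (native space) of a kernel K on a set S, via the Riesz / dual-norm description:
  f is in the RKHS with squared norm at most C iff the evaluation functional
  sum c_i K(x_i,.) |-> sum c_i f(x_i) is bounded by sqrt C on the span of kernel sections.\<close>
definition kquad :: "('a \<Rightarrow> 'a \<Rightarrow> real) \<Rightarrow> 'a list \<Rightarrow> real list \<Rightarrow> real" where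
  "kquad K xs cs = (\<Sum>i<length xs. \<Sum>j<length xs. cs!i * cs!j * K (xs!i) (xs!j))"

definition keval :: "('a \<Rightarrow> real) \<Rightarrow> 'a list \<Rightarrow> real list \<Rightarrow> real" where
  "keval f xs cs = (\<Sum>i<length xs. cs!i * f (xs!i))"

definition rkhs_bound :: "('a \<Rightarrow> 'a \<Rightarrow> real) \<Rightarrow> 'a set \<Rightarrow> ('a \<Rightarrow> real) \<Rightarrow> real \<Rightarrow> bool" where
  "rkhs_bound K S f C \<longleftrightarrow> (\<forall>xs cs. set xs \<subseteq> S \<longrightarrow> length cs = length xs \<longrightarrow>
       (keval f xs cs)^2 \<le> C * kquad K xs cs)"

definition in_rkhs :: "('a \<Rightarrow> 'a \<Rightarrow> real) \<Rightarrow> 'a set \<Rightarrow> ('a \<Rightarrow> real) \<Rightarrow> bool" where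
  "in_rkhs K S f \<longleftrightarrow> (\<exists>C. rkhs_bound K S f C)"

definition rkhs_norm :: "('a \<Rightarrow> 'a \<Rightarrow> real) \<Rightarrow> 'a set \<Rightarrow> ('a \<Rightarrow> real) \<Rightarrow> real" where
  "rkhs_norm K S f = sqrt (Inf {C. 0 \<le> C \<and> rkhs_bound K S f C})"

text \<open>A_r(R) with input dimension d and output dimension m; component i of Psi is
  (\<lambda>x. Psi x i), components i >= m vanish. dim span <= r is written out as:
  the components (restricted to R^d) lie in the span of k <= r functions.\<close>
definition low_rank_class :: "real \<Rightarrow> nat \<Rightarrow> nat \<Rightarrow> real \<Rightarrow> real \<Rightarrow> (vec \<Rightarrow> vec) set" where
  "low_rank_class \<nu> d m r R = {\<Psi>.
     (\<forall>x i. m \<le> i \<longrightarrow> \<Psi> x i = 0) \<and>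
     (\<forall>i<m. in_rkhs (matern_kernel \<nu> d) (Vsp d) (\<lambda>x. \<Psi> x i)) \<and>
     (\<exists>k::nat. real k \<le> r \<and> (\<exists>(g::nat \<Rightarrow> vec \<Rightarrow> real) (a::nat \<Rightarrow> nat \<Rightarrow> real).
         \<forall>i<m. \<forall>x\<in>Vsp d. \<Psi> x i = (\<Sum>j<k. a i j * g j x))) \<and>
     sqrt (\<Sum>i<m. (rkhs_norm (matern_kernel \<nu> d) (Vsp d) (\<lambda>x. \<Psi> x i))^2) \<le> R}"

definition rows_image :: "nat \<Rightarrow> (vec \<Rightarrow> vec) \<Rightarrow> (nat \<Rightarrow> vec) \<Rightarrow> (nat \<Rightarrow> vec)" where
  "rows_image n \<Psi> Z = (\<lambda>k. if k < n then \<Psi> (Z k) else (\<lambda>_. 0))"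

definition frob_dist :: "nat \<Rightarrow> nat \<Rightarrow> (nat \<Rightarrow> vec) \<Rightarrow> (nat \<Rightarrow> vec) \<Rightarrow> real" where
  "frob_dist n m A B = sqrt (\<Sum>k<n. \<Sum>i<m. (A k i - B k i)^2)"

text \<open>Proper covering number (centers inside T); infinity if no finite cover.\<close>
definition covering_number :: "'a set \<Rightarrow> ('a \<Rightarrow> 'a \<Rightarrow> real) \<Rightarrow> real \<Rightarrow> enat" where
  "covering_number T dst e =
     (INF C \<in> {C. finite C \<and> C \<subseteq> T \<and> (\<forall>t\<in>T. \<exists>c\<in>C. dst t c \<le> e)}. enat (card C))"

definition layer_class :: "real \<Rightarrow> (nat \<Rightarrow> nat) \<Rightarrow> (nat \<Rightarrow> real) \<Rightarrow> (nat \<Rightarrow> real) \<Rightarrow> (nat \<Rightarrow> real)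
    \<Rightarrow> nat \<Rightarrow> (vec \<Rightarrow> vec) set" where
  "layer_class \<nu> d r R \<rho> l = {\<Psi> \<in> low_rank_class \<nu> (d (l - 1)) (d l) (r l) (R l).
     \<forall>x\<in>Vsp (d (l - 1)). \<forall>x'\<in>Vsp (d (l - 1)).
        vdist (d l) (\<Psi> x) (\<Psi> x') \<le> \<rho> l * vdist (d (l - 1)) x x'}"

fun compose_layers :: "(nat \<Rightarrow> vec \<Rightarrow> vec) \<Rightarrow> nat \<Rightarrow> vec \<Rightarrow> vec" where
  "compose_layers \<Psi> 0 = id"
| "compose_layers \<Psi> (Suc l) = \<Psi> (Suc l) \<circ> compose_layers \<Psi> l"

definition model_class :: "real \<Rightarrow> (nat \<Rightarrow> nat) \<Rightarrow> (nat \<Rightarrow> real) \<Rightarrow> (nat \<Rightarrow> real) \<Rightarrow> (nat \<Rightarrow> real)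
    \<Rightarrow> nat \<Rightarrow> (vec \<Rightarrow> vec) set" where
  "model_class \<nu> d r R \<rho> L =
     {compose_layers \<Psi> L | \<Psi>. \<forall>l\<in>{1..L}. \<Psi> l \<in> layer_class \<nu> d r R \<rho> l}"

definition dmax :: "(nat \<Rightarrow> nat) \<Rightarrow> nat \<Rightarrow> real" where
  "dmax d L = real (Max (d ` {..L}))"

definition xi0 :: "real \<Rightarrow> (nat \<Rightarrow> nat) \<Rightarrow> (nat \<Rightarrow> real) \<Rightarrow> (nat \<Rightarrow> real) \<Rightarrow> (nat \<Rightarrow> real)
    \<Rightarrow> real \<Rightarrow> nat \<Rightarrow> nat \<Rightarrow> real \<Rightarrow> real \<Rightarrow> real \<Rightarrow> real" where
  "xi0 \<nu> d r R \<rho> Ct L n C2 s' \<tau> =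
     (let bt = (\<Sum>i\<in>{1..L}. Ct * R i * sqrt (r i * real n)) in
      \<Sum>i\<in>{1..L}. real (d i) * r i *
        (((real n * C2 / \<tau>) powr (2 / s') * bt * (\<Prod>j\<in>{i+1..L}. \<rho> j))
           powr (max (real (d (i - 1)) / \<nu>) 1)))"

end

theory Submission
  imports Defs
begin

text \<open>
  Truncate the losses to the event that the envelope \<open>G\<close> is at most \<open>n powr (1 / (2 * s))\<close> and the
  Lipschitz weight \<open>B\<close> is at most \<open>b = (n * C2 / \<tau>) powr (1 / s')\<close>. The tails are controlled by
  Markov's inequality; the truncated losses are bounded, so McDiarmid's inequality concentrates the
  largest deviation around its mean, and the mean is bounded by symmetrization and chaining, using the
  covers of the composed layers that the entropy hypothesis provides on the sample.

  Since \<open>d i < 2 * \<nu>\<close> for all \<open>i\<close>, the entropy exponent is less than 2, Dudley's integral converges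
  at 0, and the mean deviation is at most \<open>K * b / sqrt n\<close> with \<open>K\<close> depending on the layers only. The
  claimed term in \<open>xi0\<close> dominates this up to \<open>1 / sqrt n\<close>, which is absorbed by the slack between
  \<open>sqrt (2 * ln (1 / \<epsilon>))\<close> and \<open>2 * sqrt (ln (2 / \<epsilon>))\<close>; this matters for small \<open>b\<close>, because
  \<open>xi0\<close> scales with \<open>b\<^sup>2\<close> rather than \<open>b\<close>.

  No measurability of the supremum over the model class is assumed, so a countable pointwise dense
  subclass is used, and its supremum is reached through finite subfamilies.
\<close>

subsection \<open>McDiarmid's inequality\<close>

context prob_space
begin

text \<open>\<open>Cp\<close> is fixed before the sample size, the distribution and the moment data,
  so the chaining bound must be uniform in all of them. Radii proportional to \<open>sqrt n\<close>
  achieve this: the \<open>sqrt n\<close> in the entropy hypothesis cancels, and what remains is a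
  function of the layers alone. Truncating a loss by an indicator keeps it Lipschitz in the network
  output, because the truncation event depends on the data point only. The two truncations are paid
  for differently. \<open>B > b\<close> has probability below \<open>\<tau> / n\<close> at each
  point, so a union bound removes it from the whole sample at total cost \<open>\<tau>\<close>. A
  large envelope is not excluded: its tail stays as an additive error, bounded in the population by
  the moment of order \<open>s\<close> and on the sample, outside probability \<open>\<eta>\<close>,
  by Markov's inequality. McDiarmid's inequality alone spends \<open>\<epsilon>\<close>.\<close>

lemma prob_space_PiM_const: "prob_space (PiM I (\<lambda>_::'i. M))"
  by (rule prob_space_PiM) (rule prob_space_axioms)

lemma PiM_fun_upd_space:
  assumes "w \<in> space (PiM J (\<lambda>_. M))" "z \<in> space M"
  shows "w(i := z) \<in> space (PiM (insert i J) (\<lambda>_. M))"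
  using assms by (auto simp: space_PiM intro!: PiE_fun_upd)

lemma integrable_PiM_bounded:
  fixes g :: "('i \<Rightarrow> 'a) \<Rightarrow> real"
  assumes "g \<in> borel_measurable (PiM I (\<lambda>_. M))"
    and "\<And>w. w \<in> space (PiM I (\<lambda>_. M)) \<Longrightarrow> \<bar>g w\<bar> \<le> K"
  shows "integrable (PiM I (\<lambda>_. M)) g"
proof -
  interpret J: prob_space "PiM I (\<lambda>_::'i. M)" by (rule prob_space_PiM_const)
  show ?thesis
    by (rule J.integrable_const_bound[where B=K]) (use assms in auto)
qed

text \<open>Symmetrization needs both orders: the new coordinate outermost for the induction
  hypothesis, the old ones outermost for the one-variable step.\<close>

lemma integral_PiM_insert_swap:
  fixes g :: "('i \<Rightarrow> 'a) \<Rightarrow> real"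
  assumes J: "finite J" "i \<notin> J"
    and g[measurable]: "g \<in> borel_measurable (PiM (insert i J) (\<lambda>_. M))"
    and b: "\<And>w. w \<in> space (PiM (insert i J) (\<lambda>_. M)) \<Longrightarrow> \<bar>g w\<bar> \<le> K"
  shows "integral\<^sup>L (PiM (insert i J) (\<lambda>_. M)) g
       = (\<integral>y. (\<integral>z. g (y(i := z)) \<partial>M) \<partial>PiM J (\<lambda>_. M))" (is "?L = ?R")
    and "integral\<^sup>L (PiM (insert i J) (\<lambda>_. M)) g
       = (\<integral>z. (\<integral>y. g (y(i := z)) \<partial>PiM J (\<lambda>_. M)) \<partial>M)"
proof -
  interpret J: prob_space "PiM J (\<lambda>_::'i. M)" by (rule prob_space_PiM_const)
  interpret PP: product_prob_space "\<lambda>_::'i. M" by standard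
  interpret P: pair_prob_space "PiM J (\<lambda>_::'i. M)" M ..
  show 1: "?L = ?R"
    by (rule PP.product_integral_insert[OF J integrable_PiM_bounded[OF g b]])
  have m: "(\<lambda>(y, z). g (y(i := z))) \<in> borel_measurable (PiM J (\<lambda>_::'i. M) \<Otimes>\<^sub>M M)"
    by measurable
  have "integrable (PiM J (\<lambda>_::'i. M) \<Otimes>\<^sub>M M) (\<lambda>(y, z). g (y(i := z)))"
    by (rule P.integrable_const_bound[where B=K])
       (use m in \<open>auto simp: space_pair_measure intro!: b PiM_fun_upd_space\<close>)
  from P.Fubini_integral[OF this] show "?L = (\<integral>z. (\<integral>y. g (y(i := z)) \<partial>PiM J (\<lambda>_. M)) \<partial>M)"
    unfolding 1 by simp
qed

lemma abs_integral_le_bound: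
  assumes "f \<in> borel_measurable M" "\<And>z. z \<in> space M \<Longrightarrow> \<bar>f z\<bar> \<le> (K::real)"
  shows "\<bar>integral\<^sup>L M f\<bar> \<le> K"
proof -
  have i: "integrable M f" by (rule integrable_const_bound[where B=K]) (use assms in auto)
  have "\<bar>integral\<^sup>L M f\<bar> \<le> (\<integral>z. \<bar>f z\<bar> \<partial>M)" by (rule integral_abs_bound)
  also have "\<dots> \<le> (\<integral>z. K \<partial>M)" by (rule integral_mono) (use i assms in auto)
  finally show ?thesis by (simp add: prob_space)
qed

text \<open>A function of oscillation \<open>c\<close> takes its values in an interval of length
  \<open>c\<close> that starts at its infimum, which is what Hoeffding's lemma asks for.\<close>

lemma Hoeffding_oscillation:
  fixes f :: "'a \<Rightarrow> real"
  assumes [measurable]: "f \<in> borel_measurable M"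
    and c: "\<And>x y. x \<in> space M \<Longrightarrow> y \<in> space M \<Longrightarrow> \<bar>f x - f y\<bar> \<le> c" and l: "l > 0"
  shows "(\<integral>\<^sup>+x. ennreal (exp (l * (f x - expectation f))) \<partial>M) \<le> ennreal (exp (l\<^sup>2 * c\<^sup>2 / 8))"
proof -
  define a where "a = (INF x\<in>space M. f x)"
  obtain x0 where x0: "x0 \<in> space M" using not_empty by blast
  have bdd: "bdd_below (f ` space M)"
    by (rule bdd_belowI2[where m="f x0 - c"]) (use c[OF x0] in fastforce)
  have lo: "a \<le> f x" if "x \<in> space M" for x
    unfolding a_def by (rule cINF_lower[OF bdd that])
  have hi: "f x \<le> a + c" if "x \<in> space M" for x
  proof -
    have "f x - c \<le> a"
      unfolding a_def using c[OF that] not_empty by (intro cINF_greatest) fastforce+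
    then show ?thesis by simp
  qed
  interpret interval_bounded_random_variable M f a "a + c"
    by standard (use lo hi in auto)
  show ?thesis using Hoeffdings_lemma_nn_integral[OF l] by simp
qed

text \<open>Integrating out the new coordinate leaves \<open>h\<close>, which inherits the bound and
  the bounded differences. With the other coordinates fixed, \<open>g - h\<close> is centred with
  oscillation at most \<open>c\<close> and contributes one factor of Hoeffding's lemma. The
  induction replaces the martingale differences of the usual proof.\<close>

lemma McDiarmid_mgf:
  fixes g :: "('i \<Rightarrow> 'a) \<Rightarrow> real"
  assumes "finite I" and "g \<in> borel_measurable (PiM I (\<lambda>_. M))"
    and "\<And>w. w \<in> space (PiM I (\<lambda>_. M)) \<Longrightarrow> \<bar>g w\<bar> \<le> K"
    and "\<And>w i z. w \<in> space (PiM I (\<lambda>_. M)) \<Longrightarrow> i \<in> I \<Longrightarrow> z \<in> space M \<Longrightarrow> \<bar>g (w(i := z)) - g w\<bar> \<le> c"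
    and l: "l > 0"
  shows "(\<integral>\<^sup>+w. ennreal (exp (l * (g w - integral\<^sup>L (PiM I (\<lambda>_. M)) g))) \<partial>PiM I (\<lambda>_. M))
         \<le> ennreal (exp (l\<^sup>2 * (real (card I) * c\<^sup>2) / 8))"
  using assms(1-4)
proof (induction I arbitrary: g rule: finite_induct)
  case empty
  then show ?case
    by (simp add: PiM_empty nn_integral_count_space_finite lebesgue_integral_count_space_finite)
next
  case (insert i J)
  note [measurable] = insert.prems(1)
  interpret J: prob_space "PiM J (\<lambda>_::'i. M)" by (rule prob_space_PiM_const)
  interpret PP: product_prob_space "\<lambda>_::'i. M" by standard
  let ?J = "PiM J (\<lambda>_::'i. M)" and ?I = "PiM (insert i J) (\<lambda>_::'i. M)"
  define h where "h y = (\<integral>z. g (y(i := z)) \<partial>M)" for y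
  have gm: "(\<lambda>z. g (y(i := z))) \<in> borel_measurable M" if "y \<in> space ?J" for y
    using that by measurable
  have hm[measurable]: "h \<in> borel_measurable ?J"
    unfolding h_def by measurable
  have gi: "integrable M (\<lambda>z. g (y(i := z)))" if "y \<in> space ?J" for y
    by (rule integrable_const_bound[where B=K])
       (use that gm insert.prems(2) in \<open>auto intro!: PiM_fun_upd_space\<close>)
  have hb: "\<bar>h y\<bar> \<le> K" if "y \<in> space ?J" for y
    unfolding h_def
    by (rule abs_integral_le_bound) (use that gm insert.prems(2) in \<open>auto intro!: PiM_fun_upd_space\<close>)
  have hd: "\<bar>h (y(j := z)) - h y\<bar> \<le> c" if y: "y \<in> space ?J" and j: "j \<in> J" and z: "z \<in> space M" for y j z
  proof -
    have y': "y(j := z) \<in> space ?J"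
      using PiM_fun_upd_space[OF y z, of j] j by (simp add: insert_absorb)
    \<comment> \<open>Distinct coordinates let the two updates be exchanged, so the difference can
      be taken under the integral over the new coordinate.\<close>
    have ij: "i \<noteq> j" using j insert by auto
    have "h (y(j := z)) - h y = (\<integral>x. g ((y(j := z))(i := x)) - g (y(i := x)) \<partial>M)"
      unfolding h_def using gi[OF y] gi[OF y'] by simp
    also have "\<bar>\<dots>\<bar> \<le> c"
    proof (rule abs_integral_le_bound)
      show "(\<lambda>x. g ((y(j := z))(i := x)) - g (y(i := x))) \<in> borel_measurable M"
        using gm[OF y] gm[OF y'] by measurable
      fix x assume x: "x \<in> space M"
      show "\<bar>g ((y(j := z))(i := x)) - g (y(i := x))\<bar> \<le> c"
        using insert.prems(3)[OF PiM_fun_upd_space[OF y x, of i], of j z] j z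
        unfolding fun_upd_twist[OF ij] by blast
    qed
    finally show ?thesis .
  qed
  have Eg: "integral\<^sup>L ?I g = integral\<^sup>L ?J h"
    unfolding h_def by (rule integral_PiM_insert_swap(1)[OF insert(1,2) insert.prems(1,2)])
  let ?m = "integral\<^sup>L ?J h"
  have "(\<integral>\<^sup>+w. ennreal (exp (l * (g w - integral\<^sup>L ?I g))) \<partial>?I)
      = (\<integral>\<^sup>+y. (\<integral>\<^sup>+z. ennreal (exp (l * (g (y(i := z)) - ?m))) \<partial>M) \<partial>?J)"
    unfolding Eg by (rule PP.product_nn_integral_insert[OF insert(1,2)]) measurable
  \<comment> \<open>The exponent is split at \<open>h y\<close>: one factor is constant in the new
    coordinate, the other is the centred variable of Hoeffding's lemma.\<close>
  also have "\<dots> \<le> (\<integral>\<^sup>+y. ennreal (exp (l * (h y - ?m))) * ennreal (exp (l\<^sup>2 * c\<^sup>2 / 8)) \<partial>?J)"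
  proof (rule nn_integral_mono)
    fix y assume y: "y \<in> space ?J"
    note gm[OF y, measurable]
    have "(\<integral>\<^sup>+z. ennreal (exp (l * (g (y(i := z)) - ?m))) \<partial>M)
        = (\<integral>\<^sup>+z. ennreal (exp (l * (h y - ?m))) * ennreal (exp (l * (g (y(i := z)) - h y))) \<partial>M)"
      by (intro nn_integral_cong) (simp flip: ennreal_mult exp_add add: algebra_simps)
    also have "\<dots> = ennreal (exp (l * (h y - ?m))) * (\<integral>\<^sup>+z. ennreal (exp (l * (g (y(i := z)) - h y))) \<partial>M)"
      by (rule nn_integral_cmult) measurable
    also have "(\<integral>\<^sup>+z. ennreal (exp (l * (g (y(i := z)) - h y))) \<partial>M) \<le> ennreal (exp (l\<^sup>2 * c\<^sup>2 / 8))"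
      unfolding h_def
    proof (rule Hoeffding_oscillation[OF gm[OF y] _ l])
      fix x z assume xz: "x \<in> space M" "z \<in> space M"
      show "\<bar>g (y(i := x)) - g (y(i := z))\<bar> \<le> c"
        using insert.prems(3)[OF PiM_fun_upd_space[OF y xz(2), of i], of i x] xz
        unfolding fun_upd_upd by blast
    qed
    finally show "(\<integral>\<^sup>+z. ennreal (exp (l * (g (y(i := z)) - ?m))) \<partial>M)
        \<le> ennreal (exp (l * (h y - ?m))) * ennreal (exp (l\<^sup>2 * c\<^sup>2 / 8))"
      by (simp add: mult_left_mono)
  qed
  also have "\<dots> = (\<integral>\<^sup>+y. ennreal (exp (l * (h y - ?m))) \<partial>?J) * ennreal (exp (l\<^sup>2 * c\<^sup>2 / 8))"
    by (rule nn_integral_multc) measurable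
  also have "\<dots> \<le> ennreal (exp (l\<^sup>2 * (real (card J) * c\<^sup>2) / 8)) * ennreal (exp (l\<^sup>2 * c\<^sup>2 / 8))"
    by (intro mult_right_mono insert.IH hm hb hd) auto
  also have "\<dots> = ennreal (exp (l\<^sup>2 * (real (card (insert i J)) * c\<^sup>2) / 8))"
    using insert(1,2) by (simp flip: ennreal_mult exp_add add: algebra_simps add_divide_distrib)
  finally show ?case .
qed

lemma McDiarmid:
  fixes g :: "('i \<Rightarrow> 'a) \<Rightarrow> real"
  assumes "finite I" "I \<noteq> {}" and gm[measurable]: "g \<in> borel_measurable (PiM I (\<lambda>_. M))"
    and "\<And>w. w \<in> space (PiM I (\<lambda>_. M)) \<Longrightarrow> \<bar>g w\<bar> \<le> K"
    and "\<And>w i z. w \<in> space (PiM I (\<lambda>_. M)) \<Longrightarrow> i \<in> I \<Longrightarrow> z \<in> space M \<Longrightarrow> \<bar>g (w(i := z)) - g w\<bar> \<le> c"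
    and t: "t > 0" and c: "c > 0"
  shows "measure (PiM I (\<lambda>_. M)) {w \<in> space (PiM I (\<lambda>_. M)). integral\<^sup>L (PiM I (\<lambda>_. M)) g + t \<le> g w}
         \<le> exp (- 2 * t\<^sup>2 / (real (card I) * c\<^sup>2))"
proof -
  interpret J: prob_space "PiM I (\<lambda>_::'i. M)" by (rule prob_space_PiM_const)
  let ?I = "PiM I (\<lambda>_::'i. M)"
  let ?m = "integral\<^sup>L ?I g"
  define N where "N = real (card I) * c\<^sup>2"
  have N: "N > 0" using assms(1,2) c by (simp add: N_def card_gt_0_iff)
  \<comment> \<open>Minimizes the Chernoff exponent \<open>l\<^sup>2 * N / 8 - l * t\<close>; the
    minimum is \<open>- 2 * t\<^sup>2 / N\<close>.\<close>
  define l where "l = 4 * t / N"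
  have l: "l > 0" using t N by (simp add: l_def)
  have "ennreal (measure ?I {w \<in> space ?I. ?m + t \<le> g w})
      = emeasure ?I {w \<in> space ?I. ?m + t \<le> g w}"
    by (simp add: J.emeasure_eq_measure)
  also have "\<dots> = (\<integral>\<^sup>+w. indicator {w \<in> space ?I. ?m + t \<le> g w} w \<partial>?I)"
    by (rule nn_integral_indicator[symmetric]) measurable
  also have "\<dots> \<le> (\<integral>\<^sup>+w. ennreal (exp (- l * t)) * ennreal (exp (l * (g w - ?m))) \<partial>?I)"
  proof (rule nn_integral_mono)
    fix w assume "w \<in> space ?I"
    have "1 \<le> exp (- l * t) * exp (l * (g w - ?m))" if "?m + t \<le> g w"
    proof -
      have "0 \<le> l * (g w - ?m - t)" using l that by simp
      then show ?thesis by (simp flip: exp_add add: algebra_simps)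
    qed
    then show "indicator {w \<in> space ?I. ?m + t \<le> g w} w
        \<le> ennreal (exp (- l * t)) * ennreal (exp (l * (g w - ?m)))"
      by (auto simp flip: ennreal_mult split: split_indicator)
  qed
  also have "\<dots> = ennreal (exp (- l * t)) * (\<integral>\<^sup>+w. ennreal (exp (l * (g w - ?m))) \<partial>?I)"
    by (rule nn_integral_cmult) measurable
  also have "\<dots> \<le> ennreal (exp (- l * t)) * ennreal (exp (l\<^sup>2 * N / 8))"
    unfolding N_def
    by (intro mult_left_mono McDiarmid_mgf[where K=K, OF assms(1) gm assms(4,5) l]) auto
  also have "\<dots> = ennreal (exp (l\<^sup>2 * N / 8 - l * t))"
    by (simp flip: ennreal_mult exp_add)
  also have "l\<^sup>2 * N / 8 - l * t = - 2 * t\<^sup>2 / N"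
    using N by (simp add: l_def field_simps power2_eq_square)
  finally show ?thesis by (simp add: N_def)
qed

end

subsection \<open>Symmetrization\<close>

lemma Max_image_add_le:
  fixes u v :: "'b \<Rightarrow> real"
  assumes "finite F" "F \<noteq> {}"
  shows "Max ((\<lambda>f. u f + v f) ` F) \<le> Max (u ` F) + Max (v ` F)"
proof (rule Max.boundedI)
  fix x assume "x \<in> (\<lambda>f. u f + v f) ` F"
  then obtain f where f: "f \<in> F" "x = u f + v f" by blast
  have "u f \<le> Max (u ` F)" "v f \<le> Max (v ` F)" by (rule Max_ge; use assms f in auto)+
  then show "x \<le> Max (u ` F) + Max (v ` F)" using f by simp
qed (use assms in auto)

lemma Max_image_abs_le:
  fixes u :: "'b \<Rightarrow> real"
  assumes "finite F" "F \<noteq> {}" "\<And>f. f \<in> F \<Longrightarrow> \<bar>u f\<bar> \<le> K"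
  shows "\<bar>Max (u ` F)\<bar> \<le> K"
proof -
  have "Max (u ` F) \<in> u ` F" using assms by (intro Max_in) auto
  then show ?thesis using assms(3) by auto
qed

lemma Max_image_diff_le:
  fixes u v :: "'b \<Rightarrow> real"
  assumes F: "finite F" "F \<noteq> {}" and d: "\<And>f. f \<in> F \<Longrightarrow> \<bar>u f - v f\<bar> \<le> c"
  shows "\<bar>Max (u ` F) - Max (v ` F)\<bar> \<le> c"
proof -
  have *: "Max (u ` F) \<le> Max (v ` F) + c" if d: "\<And>f. f \<in> F \<Longrightarrow> \<bar>u f - v f\<bar> \<le> c" for u v :: "'b \<Rightarrow> real"
  proof (rule Max.boundedI)
    fix x assume "x \<in> u ` F"
    then obtain f where f: "f \<in> F" "x = u f" by blast
    have "v f \<le> Max (v ` F)" by (rule Max_ge) (use F f in auto)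
    then show "x \<le> Max (v ` F) + c" using d[OF f(1)] f(2) by simp
  qed (use F in auto)
  show ?thesis using *[of u v] *[of v u] d by (fastforce simp: abs_minus_commute)
qed

lemma abs_mean_le: "\<bar>u\<bar> \<le> D \<Longrightarrow> \<bar>v\<bar> \<le> D \<Longrightarrow> \<bar>(u + v) / 2\<bar> \<le> (D::real)"
  by (simp add: abs_le_iff)

text \<open>A Rademacher vector is encoded by the set \<open>S\<close> of its positive indices. The
  expectation over signs becomes the finite average \<open>sign_mean\<close> over
  \<open>Pow I\<close>, and no second probability space is needed.\<close>

definition rsign :: "'i set \<Rightarrow> 'i \<Rightarrow> real" where
  "rsign S i = (if i \<in> S then 1 else - 1)"

definition sign_mean :: "'i set \<Rightarrow> ('i set \<Rightarrow> real) \<Rightarrow> real" where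
  "sign_mean I \<phi> = (\<Sum>S\<in>Pow I. \<phi> S) / 2 ^ card I"

lemma sum_Pow_insert:
  fixes \<phi> :: "'i set \<Rightarrow> real"
  assumes "finite I" "i \<notin> I"
  shows "(\<Sum>S\<in>Pow (insert i I). \<phi> S) = (\<Sum>S\<in>Pow I. \<phi> S + \<phi> (insert i S))"
proof -
  have inj: "inj_on (insert i) (Pow I)"
    using assms(2) by (auto simp: inj_on_def)
  have "Pow I \<inter> insert i ` Pow I = {}" using assms(2) by auto
  then have "(\<Sum>S\<in>Pow (insert i I). \<phi> S) = (\<Sum>S\<in>Pow I. \<phi> S) + (\<Sum>S\<in>insert i ` Pow I. \<phi> S)"
    unfolding Pow_insert using assms(1) by (intro sum.union_disjoint) auto
  also have "(\<Sum>S\<in>insert i ` Pow I. \<phi> S) = (\<Sum>S\<in>Pow I. \<phi> (insert i S))"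
    by (simp add: sum.reindex[OF inj])
  finally show ?thesis by (simp add: sum.distrib)
qed

text \<open>Averages over the sign of \<open>i\<close> first, pairing \<open>S\<close> with
  \<open>insert i S\<close>. The inductions over sign vectors below rest on this recursion.\<close>

lemma sign_mean_insert:
  assumes "finite I" "i \<notin> I"
  shows "sign_mean (insert i I) \<phi> = sign_mean I (\<lambda>S. (\<phi> S + \<phi> (insert i S)) / 2)"
  using assms by (simp add: sign_mean_def sum_Pow_insert flip: sum_divide_distrib)

lemma sign_mean_mono:
  "(\<And>S. S \<subseteq> I \<Longrightarrow> \<phi> S \<le> \<psi> S) \<Longrightarrow> sign_mean I \<phi> \<le> sign_mean I \<psi>"
  unfolding sign_mean_def by (intro divide_right_mono sum_mono) auto

lemma sign_mean_const: "finite I \<Longrightarrow> sign_mean I (\<lambda>_. c) = c"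
  by (simp add: sign_mean_def card_Pow)

lemma sign_mean_add: "sign_mean I (\<lambda>S. \<phi> S + \<psi> S) = sign_mean I \<phi> + sign_mean I \<psi>"
  by (simp add: sign_mean_def sum.distrib add_divide_distrib)

lemma sign_mean_sum: "sign_mean I (\<lambda>S. \<Sum>a\<in>A. \<phi> a S) = (\<Sum>a\<in>A. sign_mean I (\<phi> a))"
  by (simp add: sign_mean_def sum.swap[of _ _ A] sum_divide_distrib)

lemma sign_mean_cmult: "sign_mean I (\<lambda>S. c * \<phi> S) = c * sign_mean I \<phi>"
  by (simp add: sign_mean_def sum_distrib_left)

lemma sign_mean_abs_le:
  assumes "finite I" "\<And>S. S \<subseteq> I \<Longrightarrow> \<bar>\<phi> S\<bar> \<le> K"
  shows "\<bar>sign_mean I \<phi>\<bar> \<le> K"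
proof -
  have "\<phi> S \<le> K" "- K \<le> \<phi> S" if "S \<subseteq> I" for S using assms(2)[OF that] by linarith+
  then have "sign_mean I \<phi> \<le> sign_mean I (\<lambda>_. K)" "sign_mean I (\<lambda>_. -K) \<le> sign_mean I \<phi>"
    by (intro sign_mean_mono; blast)+
  then show ?thesis using assms(1) by (simp add: sign_mean_const)
qed

lemma borel_measurable_sign_mean[measurable (raw)]:
  "(\<And>S. \<phi> S \<in> borel_measurable N) \<Longrightarrow> (\<lambda>x. sign_mean I (\<lambda>S. \<phi> S x)) \<in> borel_measurable N"
  unfolding sign_mean_def
  by (intro borel_measurable_divide borel_measurable_sum borel_measurable_const)

context prob_space
begin

text \<open>Uses $a + x' - x = \frac12 (a + 2 x') + \frac12 (a - 2 x)$ instead of the usual exchange of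
  the sample with a ghost sample.\<close>

lemma symmetrization_step:
  fixes a :: "'b \<Rightarrow> real" and h :: "'b \<Rightarrow> 'a \<Rightarrow> real"
  assumes F: "finite F" "F \<noteq> {}" and hm: "\<And>f. f \<in> F \<Longrightarrow> h f \<in> borel_measurable M"
    and hb: "\<And>f z. f \<in> F \<Longrightarrow> z \<in> space M \<Longrightarrow> \<bar>h f z\<bar> \<le> K"
  shows "(\<integral>z. Max ((\<lambda>f. a f + (expectation (h f) - h f z)) ` F) \<partial>M)
       \<le> (\<integral>z. (Max ((\<lambda>f. a f - 2 * h f z) ` F) + Max ((\<lambda>f. a f + 2 * h f z) ` F)) / 2 \<partial>M)"
proof -
  define A where "A = Max ((\<lambda>f. \<bar>a f\<bar>) ` F)"
  have aA: "\<bar>a f\<bar> \<le> A" if "f \<in> F" for f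
    unfolding A_def by (rule Max_ge) (use F that in auto)
  have K: "0 \<le> K" using hb F not_empty by fastforce
  note hm[measurable]
  have hi: "integrable M (h f)" if "f \<in> F" for f
    by (rule integrable_const_bound[where B=K]) (use that hm hb in auto)
  have Eb: "\<bar>expectation (h f)\<bar> \<le> K" if "f \<in> F" for f
    by (rule abs_integral_le_bound) (use that hm hb in auto)
  have Mi: "integrable M (\<lambda>z. Max ((\<lambda>f. a f + c * h f z) ` F))" for c
  proof (rule integrable_const_bound[where B="A + \<bar>c\<bar> * K"])
    show "(\<lambda>z. Max ((\<lambda>f. a f + c * h f z) ` F)) \<in> borel_measurable M"
      using F by measurable
    show "AE z in M. norm (Max ((\<lambda>f. a f + c * h f z) ` F)) \<le> A + \<bar>c\<bar> * K"
    proof (rule AE_I2)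
      fix z assume z: "z \<in> space M"
      have "\<bar>a f + c * h f z\<bar> \<le> A + \<bar>c\<bar> * K" if "f \<in> F" for f
        using aA[OF that] mult_left_mono[OF hb[OF that z], of "\<bar>c\<bar>"] abs_triangle_ineq[of "a f" "c * h f z"]
        by (simp add: abs_mult)
      then show "norm (Max ((\<lambda>f. a f + c * h f z) ` F)) \<le> A + \<bar>c\<bar> * K"
        using Max_image_abs_le[OF F, of "\<lambda>f. a f + c * h f z"] by simp
    qed
  qed
  let ?P = "\<lambda>z. Max ((\<lambda>f. a f + 2 * h f z) ` F)" and ?N = "\<lambda>z. Max ((\<lambda>f. a f - 2 * h f z) ` F)"
  have Pi: "integrable M ?P" and Ni: "integrable M ?N" using Mi[of 2] Mi[of "-2"] by simp_all
  have pt: "Max ((\<lambda>f. a f + (expectation (h f) - h f z)) ` F) \<le> expectation ?P / 2 + ?N z / 2"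
    if z: "z \<in> space M" for z
  proof (rule Max.boundedI)
    fix x assume "x \<in> (\<lambda>f. a f + (expectation (h f) - h f z)) ` F"
    then obtain f where f: "f \<in> F" and x: "x = a f + (expectation (h f) - h f z)" by blast
    \<comment> \<open>Jensen's inequality for the maximum handles the half that contains the
      expectation of \<open>h f\<close>; the half that contains \<open>h f z\<close> is bounded
      pointwise.\<close>
    have "a f + 2 * expectation (h f) = expectation (\<lambda>z. a f + 2 * h f z)"
      using hi[OF f] by (simp add: prob_space)
    also have "\<dots> \<le> expectation ?P"
      using Pi hi[OF f] F f by (intro integral_mono) auto
    finally have 1: "a f + 2 * expectation (h f) \<le> expectation ?P" .
    have "a f - 2 * h f z \<le> ?N z" using F f by (intro Max_ge) auto
    with 1 show "x \<le> expectation ?P / 2 + ?N z / 2" by (simp add: x)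
  qed (use F in auto)
  have Li: "integrable M (\<lambda>z. Max ((\<lambda>f. a f + (expectation (h f) - h f z)) ` F))"
  proof (rule integrable_const_bound[where B="A + 2 * K"])
    show "AE z in M. norm (Max ((\<lambda>f. a f + (expectation (h f) - h f z)) ` F)) \<le> A + 2 * K"
    proof (rule AE_I2)
      fix z assume z: "z \<in> space M"
      have "\<bar>a f + (expectation (h f) - h f z)\<bar> \<le> A + 2 * K" if "f \<in> F" for f
        using aA[OF that] hb[OF that z] Eb[OF that] by linarith
      then show "norm (Max ((\<lambda>f. a f + (expectation (h f) - h f z)) ` F)) \<le> A + 2 * K"
        using Max_image_abs_le[OF F] by simp
    qed
  qed (use F in measurable)
  have "(\<integral>z. Max ((\<lambda>f. a f + (expectation (h f) - h f z)) ` F) \<partial>M)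
      \<le> (\<integral>z. expectation ?P / 2 + ?N z / 2 \<partial>M)"
    by (rule integral_mono) (use Li Ni pt in auto)
  also have "\<dots> = (\<integral>z. (?N z + ?P z) / 2 \<partial>M)"
    using Ni Pi by (simp add: prob_space add_divide_distrib)
  finally show ?thesis .
qed

text \<open>The offset \<open>a\<close> is arbitrary so that coordinates can be symmetrized one at a
  time. The induction hypothesis absorbs the centred term of the new coordinate into
  \<open>a\<close>; \<open>symmetrization_step\<close> then absorbs the signed sum over the old
  coordinates.\<close>

lemma symmetrization:
  fixes a :: "'b \<Rightarrow> real" and h :: "'b \<Rightarrow> 'a \<Rightarrow> real"
  assumes F: "finite F" "F \<noteq> {}" and hm: "\<And>f. f \<in> F \<Longrightarrow> h f \<in> borel_measurable M"
    and hb: "\<And>f z. f \<in> F \<Longrightarrow> z \<in> space M \<Longrightarrow> \<bar>h f z\<bar> \<le> K"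
    and I: "finite (I::'i set)"
  shows "(\<integral>w. Max ((\<lambda>f. a f + (\<Sum>i\<in>I. expectation (h f) - h f (w i))) ` F) \<partial>PiM I (\<lambda>_. M))
       \<le> (\<integral>w. sign_mean I (\<lambda>S. Max ((\<lambda>f. a f + 2 * (\<Sum>i\<in>I. rsign S i * h f (w i))) ` F)) \<partial>PiM I (\<lambda>_. M))"
  using I
proof (induction I arbitrary: a rule: finite_induct)
  case empty
  then show ?case
    by (simp add: PiM_empty lebesgue_integral_count_space_finite sign_mean_def)
next
  case (insert i J)
  note [measurable] = hm
  let ?J = "PiM J (\<lambda>_::'i. M)" and ?I = "PiM (insert i J) (\<lambda>_::'i. M)"
  interpret J: prob_space ?J by (rule prob_space_PiM_const)
  define A where "A = Max ((\<lambda>f. \<bar>a f\<bar>) ` F)"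
  have aA: "\<bar>a f\<bar> \<le> A" if "f \<in> F" for f
    unfolding A_def by (rule Max_ge) (use F that in auto)
  have K: "0 \<le> K" using hb F not_empty by fastforce
  have Eb: "\<bar>expectation (h f)\<bar> \<le> K" if "f \<in> F" for f
    by (rule abs_integral_le_bound) (use that hm hb in auto)
  \<comment> \<open>A crude common bound for the maxima before, halfway through and after the step;
    it serves integrability only.\<close>
  define D where "D = A + 2 * K + 2 * (real (card J) * K)"
  have sumb: "\<bar>\<Sum>i\<in>J. rsign S i * h f (y i)\<bar> \<le> real (card J) * K"
    if "f \<in> F" "y \<in> space ?J" for f y S
  proof -
    have "\<bar>\<Sum>i\<in>J. rsign S i * h f (y i)\<bar> \<le> (\<Sum>i\<in>J. \<bar>rsign S i * h f (y i)\<bar>)" by (rule sum_abs)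
    also have "\<dots> \<le> (\<Sum>i\<in>J. K)"
      using that by (intro sum_mono) (auto simp: rsign_def space_PiM PiE_iff hb)
    finally show ?thesis by simp
  qed
  have sumE: "\<bar>\<Sum>i\<in>J. expectation (h f) - h f (y i)\<bar> \<le> 2 * (real (card J) * K)"
    if "f \<in> F" "y \<in> space ?J" for f y
  proof -
    have "\<bar>\<Sum>i\<in>J. expectation (h f) - h f (y i)\<bar> \<le> (\<Sum>i\<in>J. \<bar>expectation (h f) - h f (y i)\<bar>)" by (rule sum_abs)
    also have "\<dots> \<le> (\<Sum>i\<in>J. 2 * K)"
    proof (rule sum_mono)
      fix i assume "i \<in> J"
      then have "\<bar>h f (y i)\<bar> \<le> K" using that by (auto simp: space_PiM PiE_iff hb)
      then show "\<bar>expectation (h f) - h f (y i)\<bar> \<le> 2 * K" using Eb[OF that(1)] by linarith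
    qed
    finally show ?thesis by simp
  qed
  have neq: "j \<noteq> i" if "j \<in> J" for j using insert that by auto
  have upd: "(\<Sum>j\<in>J. \<psi> j ((y(i := z)) j)) = (\<Sum>j\<in>J. \<psi> j (y j))" for \<psi> :: "'i \<Rightarrow> 'a \<Rightarrow> real" and y z
    using neq by (intro sum.cong) auto
  \<comment> \<open>The hybrid of both sides: coordinates in \<open>J\<close> already carry signs,
    while the new coordinate \<open>z\<close> is still centred.\<close>
  let ?\<Phi> = "\<lambda>y z. sign_mean J (\<lambda>S. Max ((\<lambda>f. a f + (expectation (h f) - h f z)
              + 2 * (\<Sum>j\<in>J. rsign S j * h f (y j))) ` F))"
  let ?g = "\<lambda>w. Max ((\<lambda>f. a f + (\<Sum>j\<in>insert i J. expectation (h f) - h f (w j))) ` F)"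
  have gy: "?g (y(i := z)) = Max ((\<lambda>f. (a f + (expectation (h f) - h f z)) + (\<Sum>j\<in>J. expectation (h f) - h f (y j))) ` F)" for y z
    using insert(1,2) neq
    by (intro arg_cong[where f=Max] image_cong) (auto intro!: sum.cong)
  have gm: "?g \<in> borel_measurable ?I" using F insert(1) by measurable
  have restr: "\<exists>y\<in>space ?J. \<exists>z\<in>space M. w = y(i := z)" if "w \<in> space ?I" for w
    using that insert(2)
    by (intro bexI[of _ "w(i := undefined)"] bexI[of _ "w i"]) (auto simp: space_PiM PiE_iff extensional_def)
  have gb: "\<bar>?g w\<bar> \<le> D" if w: "w \<in> space ?I" for w
  proof -
    obtain y z where yz: "y \<in> space ?J" "z \<in> space M" "w = y(i := z)" using restr[OF w] by blast
    show ?thesis unfolding yz(3) gy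
    proof (rule Max_image_abs_le[OF F])
      fix f assume f: "f \<in> F"
      show "\<bar>a f + (expectation (h f) - h f z) + (\<Sum>j\<in>J. expectation (h f) - h f (y j))\<bar> \<le> D"
        using aA[OF f] hb[OF f yz(2)] Eb[OF f] sumE[OF f yz(1)] unfolding D_def by linarith
    qed
  qed
  let ?G = "\<lambda>w. ?\<Phi> w (w i)"
  have Gy: "?G (y(i := z)) = ?\<Phi> y z" for y z
  proof -
    have "(\<Sum>j\<in>J. rsign S j * h f ((y(i := z)) j)) = (\<Sum>j\<in>J. rsign S j * h f (y j))" for S f
      by (rule upd)
    then show ?thesis by (simp only: fun_upd_same)
  qed
  have Gm: "?G \<in> borel_measurable ?I" using F insert(1) by measurable
  have \<Phi>b: "\<bar>?\<Phi> y z\<bar> \<le> D" if yz: "y \<in> space ?J" "z \<in> space M" for y z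
  proof (rule sign_mean_abs_le[OF insert(1)], rule Max_image_abs_le[OF F])
    fix S f assume f: "f \<in> F"
    show "\<bar>a f + (expectation (h f) - h f z) + 2 * (\<Sum>j\<in>J. rsign S j * h f (y j))\<bar> \<le> D"
      using aA[OF f] hb[OF f yz(2)] Eb[OF f] sumb[OF f yz(1), of S] unfolding D_def by linarith
  qed
  have Gb: "\<bar>?G w\<bar> \<le> D" if w: "w \<in> space ?I" for w
  proof -
    obtain y z where yz: "y \<in> space ?J" "z \<in> space M" "w = y(i := z)" using restr[OF w] by blast
    show ?thesis unfolding yz(3) Gy by (rule \<Phi>b[OF yz(1,2)])
  qed
  let ?H = "\<lambda>w. sign_mean (insert i J) (\<lambda>S. Max ((\<lambda>f. a f + 2 * (\<Sum>j\<in>insert i J. rsign S j * h f (w j))) ` F))"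
  let ?b = "\<lambda>y S f. a f + 2 * (\<Sum>j\<in>J. rsign S j * h f (y j))"
  \<comment> \<open>For \<open>S \<subseteq> J\<close>, the set \<open>S\<close> gives
    \<open>z\<close> the sign -1 and \<open>insert i S\<close> gives it +1; this produces the two
    maxima of \<open>symmetrization_step\<close>.\<close>
  have Hy: "?H (y(i := z)) = sign_mean J (\<lambda>S. (Max ((\<lambda>f. ?b y S f - 2 * h f z) ` F) + Max ((\<lambda>f. ?b y S f + 2 * h f z) ` F)) / 2)" for y z
  proof -
    have 1: "(\<Sum>j\<in>insert i J. rsign S j * h f ((y(i := z)) j)) = (\<Sum>j\<in>J. rsign S j * h f (y j)) - h f z"
      if "S \<subseteq> J" for S f
    proof -
      have "i \<notin> S" using that insert(2) by auto
      then show ?thesis using insert(1,2) upd[of "\<lambda>j. (*) (rsign S j) \<circ> h f"] by (simp add: rsign_def comp_def)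
    qed
    have 2: "(\<Sum>j\<in>insert i J. rsign (insert i S) j * h f ((y(i := z)) j)) = (\<Sum>j\<in>J. rsign S j * h f (y j)) + h f z"
      if "S \<subseteq> J" for S f
    proof -
      have "(\<Sum>j\<in>J. rsign (insert i S) j * h f ((y(i := z)) j)) = (\<Sum>j\<in>J. rsign S j * h f (y j))"
        using neq by (intro sum.cong) (auto simp: rsign_def)
      then show ?thesis using insert(1,2) by (simp add: rsign_def)
    qed
    show ?thesis
      unfolding sign_mean_insert[OF insert(1,2)] unfolding sign_mean_def
      by (intro arg_cong2[where f="(/)"] sum.cong refl) (simp add: 1 2 algebra_simps del: fun_upd_apply sum.insert)
  qed
  have Hm: "?H \<in> borel_measurable ?I" using F insert(1) by measurable
  have Hb: "\<bar>?H w\<bar> \<le> D" if w: "w \<in> space ?I" for w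
  proof -
    obtain y z where yz: "y \<in> space ?J" "z \<in> space M" "w = y(i := z)" using restr[OF w] by blast
    show ?thesis unfolding yz(3) Hy
    proof (rule sign_mean_abs_le[OF insert(1)])
      fix S
      have "\<bar>?b y S f + 2 * h f z\<bar> \<le> D" "\<bar>?b y S f - 2 * h f z\<bar> \<le> D" if f: "f \<in> F" for f
        using aA[OF f] hb[OF f yz(2)] sumb[OF f yz(1), of S] unfolding D_def by linarith+
      then have "\<bar>Max ((\<lambda>f. ?b y S f - 2 * h f z) ` F)\<bar> \<le> D" "\<bar>Max ((\<lambda>f. ?b y S f + 2 * h f z) ` F)\<bar> \<le> D"
        by (intro Max_image_abs_le[OF F]; blast)+
      then show "\<bar>(Max ((\<lambda>f. ?b y S f - 2 * h f z) ` F) + Max ((\<lambda>f. ?b y S f + 2 * h f z) ` F)) / 2\<bar> \<le> D"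
        by (rule abs_mean_le)
    qed
  qed
  have "integral\<^sup>L ?I ?g = (\<integral>z. (\<integral>y. ?g (y(i := z)) \<partial>?J) \<partial>M)"
    by (rule integral_PiM_insert_swap(2)[OF insert(1,2) gm gb])
  also have "\<dots> \<le> (\<integral>z. (\<integral>y. ?G (y(i := z)) \<partial>?J) \<partial>M)"
  proof (rule integral_mono)
    show "integrable M (\<lambda>z. \<integral>y. ?g (y(i := z)) \<partial>?J)"
    proof (rule integrable_const_bound[where B=D])
      show "(\<lambda>z. \<integral>y. ?g (y(i := z)) \<partial>?J) \<in> borel_measurable M" 
        unfolding gy using F by measurable
      show "AE z in M. norm (\<integral>y. ?g (y(i := z)) \<partial>?J) \<le> D"
      proof (rule AE_I2)
        fix z assume z: "z \<in> space M"
        show "norm (\<integral>y. ?g (y(i := z)) \<partial>?J) \<le> D" unfolding real_norm_def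
        proof (rule J.abs_integral_le_bound)
          show "(\<lambda>y. ?g (y(i := z))) \<in> borel_measurable ?J"
            unfolding gy using F by measurable
        qed (rule gb[OF PiM_fun_upd_space[OF _ z]])
      qed
    qed
    show "integrable M (\<lambda>z. \<integral>y. ?G (y(i := z)) \<partial>?J)"
    proof (rule integrable_const_bound[where B=D])
      show "(\<lambda>z. \<integral>y. ?G (y(i := z)) \<partial>?J) \<in> borel_measurable M"
        unfolding Gy using F by measurable
      show "AE z in M. norm (\<integral>y. ?G (y(i := z)) \<partial>?J) \<le> D"
      proof (rule AE_I2)
        fix z assume z: "z \<in> space M"
        show "norm (\<integral>y. ?G (y(i := z)) \<partial>?J) \<le> D" unfolding real_norm_def
        proof (rule J.abs_integral_le_bound)
          show "(\<lambda>y. ?G (y(i := z))) \<in> borel_measurable ?J"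
            unfolding Gy using F by measurable
        qed (rule Gb[OF PiM_fun_upd_space[OF _ z]])
      qed
    qed
    fix z assume z: "z \<in> space M"
    \<comment> \<open>With \<open>z\<close> fixed, its centred term is part of the offset to which
      the induction hypothesis applies.\<close>
    show "(\<integral>y. ?g (y(i := z)) \<partial>?J) \<le> (\<integral>y. ?G (y(i := z)) \<partial>?J)"
      unfolding gy Gy by (rule insert.IH)
  qed
  also have "\<dots> = integral\<^sup>L ?I ?G"
    by (rule integral_PiM_insert_swap(2)[OF insert(1,2) Gm Gb, symmetric])
  \<comment> \<open>The order is exchanged so that the old coordinates and their signs are fixed
    while \<open>z\<close> is averaged.\<close>
  also have "\<dots> = (\<integral>y. (\<integral>z. ?G (y(i := z)) \<partial>M) \<partial>?J)"
    by (rule integral_PiM_insert_swap(1)[OF insert(1,2) Gm Gb])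
  also have "\<dots> \<le> (\<integral>y. (\<integral>z. ?H (y(i := z)) \<partial>M) \<partial>?J)"
  proof (rule integral_mono)
    show "integrable ?J (\<lambda>y. \<integral>z. ?G (y(i := z)) \<partial>M)"
    proof (rule integrable_PiM_bounded[where K=D])
      show "(\<lambda>y. \<integral>z. ?G (y(i := z)) \<partial>M) \<in> borel_measurable ?J"
        unfolding Gy using F by measurable
      fix y assume y: "y \<in> space ?J"
      show "\<bar>\<integral>z. ?G (y(i := z)) \<partial>M\<bar> \<le> D"
      proof (rule abs_integral_le_bound)
        show "(\<lambda>z. ?G (y(i := z))) \<in> borel_measurable M"
          unfolding Gy using F by measurable
      qed (rule Gb[OF PiM_fun_upd_space[OF y]])
    qed
    show "integrable ?J (\<lambda>y. \<integral>z. ?H (y(i := z)) \<partial>M)"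
    proof (rule integrable_PiM_bounded[where K=D])
      show "(\<lambda>y. \<integral>z. ?H (y(i := z)) \<partial>M) \<in> borel_measurable ?J"
        unfolding Hy using F by measurable
      fix y assume y: "y \<in> space ?J"
      show "\<bar>\<integral>z. ?H (y(i := z)) \<partial>M\<bar> \<le> D"
      proof (rule abs_integral_le_bound)
        show "(\<lambda>z. ?H (y(i := z))) \<in> borel_measurable M"
          unfolding Hy using F by measurable
      qed (rule Hb[OF PiM_fun_upd_space[OF y]])
    qed
    fix y assume y: "y \<in> space ?J"
    show "(\<integral>z. ?G (y(i := z)) \<partial>M) \<le> (\<integral>z. ?H (y(i := z)) \<partial>M)"
    proof -
      have i1: "integrable M (\<lambda>z. Max ((\<lambda>f. a f + (expectation (h f) - h f z) + 2 * (\<Sum>j\<in>J. rsign S j * h f (y j))) ` F))" for S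
      proof (rule integrable_const_bound[where B=D])
        show "(\<lambda>z. Max ((\<lambda>f. a f + (expectation (h f) - h f z) + 2 * (\<Sum>j\<in>J. rsign S j * h f (y j))) ` F)) \<in> borel_measurable M"
          using F by measurable
        show "AE z in M. norm (Max ((\<lambda>f. a f + (expectation (h f) - h f z) + 2 * (\<Sum>j\<in>J. rsign S j * h f (y j))) ` F)) \<le> D"
          unfolding real_norm_def
        proof (rule AE_I2, rule Max_image_abs_le[OF F])
          fix z f assume z: "z \<in> space M" and f: "f \<in> F"
          show "\<bar>a f + (expectation (h f) - h f z) + 2 * (\<Sum>j\<in>J. rsign S j * h f (y j))\<bar> \<le> D"
            using aA[OF f] hb[OF f z] Eb[OF f] sumb[OF f y, of S] unfolding D_def by linarith
        qed
      qed
      have i2: "integrable M (\<lambda>z. (Max ((\<lambda>f. ?b y S f - 2 * h f z) ` F) + Max ((\<lambda>f. ?b y S f + 2 * h f z) ` F)) / 2)" for S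
      proof (rule integrable_const_bound[where B=D])
        show "(\<lambda>z. (Max ((\<lambda>f. ?b y S f - 2 * h f z) ` F) + Max ((\<lambda>f. ?b y S f + 2 * h f z) ` F)) / 2) \<in> borel_measurable M"
          using F by measurable
        show "AE z in M. norm ((Max ((\<lambda>f. ?b y S f - 2 * h f z) ` F) + Max ((\<lambda>f. ?b y S f + 2 * h f z) ` F)) / 2) \<le> D"
        proof (rule AE_I2)
          fix z assume z: "z \<in> space M"
          have "\<bar>?b y S f + 2 * h f z\<bar> \<le> D" "\<bar>?b y S f - 2 * h f z\<bar> \<le> D" if f: "f \<in> F" for f
            using aA[OF f] hb[OF f z] sumb[OF f y, of S] unfolding D_def by linarith+
          then have "\<bar>Max ((\<lambda>f. ?b y S f - 2 * h f z) ` F)\<bar> \<le> D" "\<bar>Max ((\<lambda>f. ?b y S f + 2 * h f z) ` F)\<bar> \<le> D"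
            by (intro Max_image_abs_le[OF F]; blast)+
          then show "norm ((Max ((\<lambda>f. ?b y S f - 2 * h f z) ` F) + Max ((\<lambda>f. ?b y S f + 2 * h f z) ` F)) / 2) \<le> D"
            unfolding real_norm_def by (rule abs_mean_le)
        qed
      qed
      have "(\<integral>z. ?G (y(i := z)) \<partial>M)
          = sign_mean J (\<lambda>S. \<integral>z. Max ((\<lambda>f. ?b y S f + (expectation (h f) - h f z)) ` F) \<partial>M)"
        unfolding Gy unfolding sign_mean_def using i1 by (simp add: algebra_simps)
      also have "\<dots> \<le> sign_mean J (\<lambda>S. \<integral>z. (Max ((\<lambda>f. ?b y S f - 2 * h f z) ` F) + Max ((\<lambda>f. ?b y S f + 2 * h f z) ` F)) / 2 \<partial>M)"
        by (intro sign_mean_mono symmetrization_step[where K=K] F hm hb)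
      also have "\<dots> = (\<integral>z. ?H (y(i := z)) \<partial>M)"
        unfolding Hy unfolding sign_mean_def using i2 by simp
      finally show ?thesis .
    qed
  qed
  also have "\<dots> = integral\<^sup>L ?I ?H"
    by (rule integral_PiM_insert_swap(1)[OF insert(1,2) Hm Hb, symmetric])
  finally show ?case .
qed

end

subsection \<open>Chaining\<close>

lemma signed_sum_insert:
  fixes b :: "'i \<Rightarrow> real"
  assumes "finite J" "i \<notin> J" "S \<subseteq> J"
  shows "(\<Sum>j\<in>insert i J. rsign S j * b j) = (\<Sum>j\<in>J. rsign S j * b j) - b i"
    and "(\<Sum>j\<in>insert i J. rsign (insert i S) j * b j) = (\<Sum>j\<in>J. rsign S j * b j) + b i"
proof -
  have "i \<notin> S" using assms by auto
  then show "(\<Sum>j\<in>insert i J. rsign S j * b j) = (\<Sum>j\<in>J. rsign S j * b j) - b i"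
    using assms by (simp add: rsign_def)
  have "(\<Sum>j\<in>J. rsign (insert i S) j * b j) = (\<Sum>j\<in>J. rsign S j * b j)"
    using assms by (intro sum.cong) (auto simp: rsign_def)
  then show "(\<Sum>j\<in>insert i J. rsign (insert i S) j * b j) = (\<Sum>j\<in>J. rsign S j * b j) + b i"
    using assms by (simp add: rsign_def)
qed

lemma sign_mean_cong: "(\<And>S. S \<subseteq> I \<Longrightarrow> \<phi> S = \<psi> S) \<Longrightarrow> sign_mean I \<phi> = sign_mean I \<psi>"
  unfolding sign_mean_def by (intro arg_cong2[where f="(/)"] sum.cong) auto

text \<open>The two signs of a new index cancel. Chaining starts at a net with at most one point,
  whose contribution vanishes by this.\<close>

lemma sign_mean_signed_sum:
  assumes "finite I"
  shows "sign_mean I (\<lambda>S. \<Sum>i\<in>I. rsign S i * c i) = 0"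
  using assms
proof (induction I rule: finite_induct)
  case empty
  then show ?case by (simp add: sign_mean_def)
next
  case (insert i J)
  have "sign_mean (insert i J) (\<lambda>S. \<Sum>j\<in>insert i J. rsign S j * c j)
      = sign_mean J (\<lambda>S. \<Sum>j\<in>J. rsign S j * c j)"
    unfolding sign_mean_insert[OF insert(1,2)]
    by (rule sign_mean_cong) (simp only: signed_sum_insert[OF insert(1,2)], simp)
  then show ?case using insert by simp
qed

text \<open>The left side is the moment generating function of a fair sign. The bound is the
  logarithmic form of Hoeffding's lemma for a two-point variable with gap \<open>2 * x\<close> and
  weight 1/2, and evenness covers negative \<open>x\<close>.\<close>

lemma cosh_le_exp_half_square: "(exp x + exp (- x)) / 2 \<le> exp (x\<^sup>2 / 2)" for x :: real
proof -
  have *: "(exp x + exp (- x)) / 2 \<le> exp (x\<^sup>2 / 2)" if "x > 0" for x :: real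
  proof -
    have "- (2 * x) * (1/2) + ln (1 + 1/2 * (exp (2 * x) - 1)) \<le> (2 * x)\<^sup>2 / 8"
      by (rule Hoeffdings_lemma_aux) (use that in auto)
    then have le: "- x + ln ((1 + exp (2 * x)) / 2) \<le> x\<^sup>2 / 2"
      by (simp add: algebra_simps add_divide_distrib)
    have p: "(1 + exp (2 * x)) / 2 > 0" by (simp add: add_pos_pos)
    have "(exp x + exp (- x)) / 2 = exp (- x) * ((1 + exp (2 * x)) / 2)"
      by (simp add: algebra_simps flip: exp_add)
    also have "\<dots> = exp (- x + ln ((1 + exp (2 * x)) / 2))"
      using p by (simp only: exp_add exp_ln)
    also have "\<dots> \<le> exp (x\<^sup>2 / 2)" using le by simp
    finally show ?thesis .
  qed
  consider "x > 0" | "x = 0" | "- x > 0" by linarith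
  then show ?thesis
  proof cases
    case 3
    then show ?thesis using *[of "-x"] by (simp add: add.commute)
  qed (use * in auto)
qed

text \<open>Independence of signs in finite form: averaging over the sign of \<open>i\<close> splits
  off the factor \<open>cosh (b i)\<close>.\<close>

lemma sign_mean_exp_le:
  assumes "finite I"
  shows "sign_mean I (\<lambda>S. exp (\<Sum>i\<in>I. rsign S i * b i)) \<le> exp ((\<Sum>i\<in>I. (b i)\<^sup>2) / 2)"
  using assms
proof (induction I rule: finite_induct)
  case empty
  then show ?case by (simp add: sign_mean_def)
next
  case (insert i J)
  let ?s = "\<lambda>S. \<Sum>j\<in>J. rsign S j * b j"
  have "sign_mean (insert i J) (\<lambda>S. exp (\<Sum>j\<in>insert i J. rsign S j * b j))
      = sign_mean J (\<lambda>S. (exp (?s S - b i) + exp (?s S + b i)) / 2)"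
    unfolding sign_mean_insert[OF insert(1,2)]
    by (rule sign_mean_cong) (simp only: signed_sum_insert[OF insert(1,2)])
  also have "\<dots> = sign_mean J (\<lambda>S. ((exp (b i) + exp (- b i)) / 2) * exp (?s S))"
    by (rule sign_mean_cong) (simp add: exp_add exp_diff exp_minus field_simps)
  also have "\<dots> = ((exp (b i) + exp (- b i)) / 2) * sign_mean J (\<lambda>S. exp (?s S))"
    by (rule sign_mean_cmult)
  also have "\<dots> \<le> exp ((b i)\<^sup>2 / 2) * exp ((\<Sum>i\<in>J. (b i)\<^sup>2) / 2)"
    by (intro mult_mono cosh_le_exp_half_square insert.IH)
       (auto simp: sign_mean_def intro!: sum_nonneg divide_nonneg_nonneg)
  also have "\<dots> = exp ((\<Sum>i\<in>insert i J. (b i)\<^sup>2) / 2)"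
    using insert by (simp add: add_divide_distrib flip: exp_add)
  finally show ?case .
qed

text \<open>The sum of exponentials over \<open>A\<close> dominates the largest one. The tangent
  inequality \<open>1 + x \<le> exp x\<close> takes the place of Jensen's inequality for the
  logarithm.\<close>

lemma Massart_finite_class:
  fixes A :: "('i \<Rightarrow> real) set"
  assumes I: "finite I" and A: "finite A" "A \<noteq> {}" and r: "r > 0" and L: "L > 0"
    and card: "real (card A) \<le> exp L" and norm: "\<And>a. a \<in> A \<Longrightarrow> L2_set a I \<le> r"
  shows "sign_mean I (\<lambda>S. Max ((\<lambda>a. \<Sum>i\<in>I. rsign S i * a i) ` A)) \<le> r * sqrt (2 * L)"
proof -
  \<comment> \<open>Minimizes \<open>(l\<^sup>2 * r\<^sup>2 / 2 + L) / l\<close>; both summands of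
    \<open>c\<close> then equal \<open>L\<close>.\<close>
  define l where "l = sqrt (2 * L) / r"
  have l: "l > 0" using r L by (simp add: l_def)
  \<comment> \<open>With this shift the exponentials \<open>exp (l * ?s S a - c)\<close>, summed
    over \<open>A\<close>, average to at most 1, which cancels the 1 from the tangent
    inequality.\<close>
  define c where "c = l\<^sup>2 * r\<^sup>2 / 2 + L"
  let ?s = "\<lambda>S a. \<Sum>i\<in>I. rsign S i * a i"
  have mgf: "sign_mean I (\<lambda>S. exp (l * ?s S a)) \<le> exp (l\<^sup>2 * r\<^sup>2 / 2)" if a: "a \<in> A" for a
  proof -
    have "sign_mean I (\<lambda>S. exp (l * ?s S a)) = sign_mean I (\<lambda>S. exp (?s S (\<lambda>i. l * a i)))"
      by (simp add: sum_distrib_left mult_ac)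
    also have "\<dots> \<le> exp ((\<Sum>i\<in>I. (l * a i)\<^sup>2) / 2)" by (rule sign_mean_exp_le[OF I])
    also have "(\<Sum>i\<in>I. (l * a i)\<^sup>2) = l\<^sup>2 * (L2_set a I)\<^sup>2"
      by (simp add: L2_set_def sum_nonneg power_mult_distrib sum_distrib_left)
    also have "exp (l\<^sup>2 * (L2_set a I)\<^sup>2 / 2) \<le> exp (l\<^sup>2 * r\<^sup>2 / 2)"
      using norm[OF a] by (simp add: mult_left_mono power_mono L2_set_nonneg)
    finally show ?thesis .
  qed
  have pt: "Max (?s S ` A) \<le> (1 / l) * ((\<Sum>a\<in>A. exp (- c) * exp (l * ?s S a)) + (c - 1))" for S
  proof -
    have "Max (?s S ` A) \<in> ?s S ` A" by (rule Max_in) (use A in auto)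
    then obtain a where a: "a \<in> A" "Max (?s S ` A) = ?s S a" by auto
    have "1 + (l * ?s S a - c) \<le> exp (l * ?s S a - c)" by (rule exp_ge_add_one_self)
    also have "\<dots> = exp (- c) * exp (l * ?s S a)" by (simp flip: exp_add)
    also have "\<dots> \<le> (\<Sum>a\<in>A. exp (- c) * exp (l * ?s S a))"
      by (rule member_le_sum) (use A a in auto)
    finally have "l * ?s S a \<le> (\<Sum>a\<in>A. exp (- c) * exp (l * ?s S a)) + (c - 1)" by simp
    then have "l * Max (?s S ` A) \<le> (\<Sum>a\<in>A. exp (- c) * exp (l * ?s S a)) + (c - 1)" by (simp only: a(2))
    then show ?thesis using l by (simp only: divide_inverse) (simp add: field_simps)
  qed
  have "sign_mean I (\<lambda>S. Max (?s S ` A))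
      \<le> sign_mean I (\<lambda>S. (1 / l) * ((\<Sum>a\<in>A. exp (- c) * exp (l * ?s S a)) + (c - 1)))"
    by (rule sign_mean_mono) (rule pt)
  also have "\<dots> = (1 / l) * ((\<Sum>a\<in>A. exp (- c) * sign_mean I (\<lambda>S. exp (l * ?s S a))) + (c - 1))"
    by (simp only: sign_mean_cmult sign_mean_add sign_mean_sum sign_mean_const[OF I])
  also have "\<dots> \<le> (1 / l) * ((\<Sum>a\<in>A. exp (- c) * exp (l\<^sup>2 * r\<^sup>2 / 2)) + (c - 1))"
    using l by (intro mult_left_mono add_right_mono sum_mono mgf) auto
  also have "(\<Sum>a\<in>A. exp (- c) * exp (l\<^sup>2 * r\<^sup>2 / 2)) = real (card A) * exp (- L)"
    by (simp add: c_def flip: exp_add)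
  also have "\<dots> \<le> exp L * exp (- L)" by (rule mult_right_mono[OF card]) simp
  also have "\<dots> = 1" by (simp flip: exp_add)
  finally have "sign_mean I (\<lambda>S. Max (?s S ` A)) \<le> c / l" using l by (simp add: divide_right_mono)
  also have "l\<^sup>2 * r\<^sup>2 = 2 * L" using r L by (simp add: l_def power_divide)
  then have "c = 2 * L" by (simp add: c_def)
  then have "c / l = r * (2 * L / sqrt (2 * L))" by (simp add: l_def)
  also have "2 * L / sqrt (2 * L) = sqrt (2 * L)" using L by (simp add: real_div_sqrt)
  finally show ?thesis .
qed

text \<open>Cauchy-Schwarz; it bounds the remainder of a chain below the finest net.\<close>

lemma signed_sum_le_L2:
  assumes "finite I"
  shows "(\<Sum>i\<in>I. rsign S i * a i) \<le> sqrt (real (card I)) * L2_set a I"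
proof -
  have "(\<Sum>i\<in>I. rsign S i * a i) \<le> (\<Sum>i\<in>I. \<bar>1\<bar> * \<bar>a i\<bar>)"
    by (intro sum_mono) (auto simp: rsign_def)
  also have "\<dots> \<le> L2_set (\<lambda>_. 1) I * L2_set a I" by (rule L2_set_mult_ineq)
  also have "L2_set (\<lambda>_. 1::real) I = sqrt (real (card I))" by (simp add: L2_set_def)
  finally show ?thesis .
qed

lemma signed_sum_split:
  "(\<Sum>i\<in>I. rsign S i * a i) = (\<Sum>i\<in>I. rsign S i * b i) + (\<Sum>i\<in>I. rsign S i * (a i - b i))"
  by (simp add: right_diff_distrib sum_subtractf)

text \<open>Each vector is its net point at scale 0, plus increments between consecutive nets, plus
  a remainder. Massart's bound applies to the increments with log-cardinality
  \<open>H k + H (Suc k)\<close> and radius \<open>e k + e (Suc k)\<close>. Net points may lie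
  outside the class.\<close>

lemma Dudley_chaining:
  fixes v :: "'b \<Rightarrow> 'i \<Rightarrow> real" and C :: "nat \<Rightarrow> ('i \<Rightarrow> real) set"
  assumes I: "finite I" and F: "finite F" "F \<noteq> {}"
    and C: "\<And>k. finite (C k)" "\<And>k. real (card (C k)) \<le> exp (H k)" "card (C 0) \<le> 1"
    and net: "\<And>k f. f \<in> F \<Longrightarrow> \<exists>c\<in>C k. L2_set (\<lambda>i. v f i - c i) I \<le> e k"
    and e: "\<And>k. e k > 0" and H: "\<And>k. H k > 0"
  shows "sign_mean I (\<lambda>S. Max ((\<lambda>f. \<Sum>i\<in>I. rsign S i * v f i) ` F))
     \<le> (\<Sum>k<m. (e k + e (Suc k)) * sqrt (2 * (H k + H (Suc k)))) + sqrt (real (card I)) * e m"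
proof -
  let ?s = "\<lambda>S a. \<Sum>i\<in>I. rsign S i * a i"
  define p where "p k f = (SOME c. c \<in> C k \<and> L2_set (\<lambda>i. v f i - c i) I \<le> e k)" for k f
  have "p k f \<in> C k \<and> L2_set (\<lambda>i. v f i - p k f i) I \<le> e k" if "f \<in> F" for k f
    unfolding p_def by (rule someI_ex[OF net[OF that, unfolded Bex_def]])
  then have p: "\<And>k f. f \<in> F \<Longrightarrow> p k f \<in> C k"
      "\<And>k f. f \<in> F \<Longrightarrow> L2_set (\<lambda>i. v f i - p k f i) I \<le> e k"
    by (simp_all only:)
  have chain: "sign_mean I (\<lambda>S. Max ((\<lambda>f. ?s S (p m f)) ` F))
      \<le> (\<Sum>k<m. (e k + e (Suc k)) * sqrt (2 * (H k + H (Suc k))))" for m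
  proof (induction m)
    case 0
    obtain f0 where f0: "f0 \<in> F" using F by blast
    define c0 where "c0 = p 0 f0"
    \<comment> \<open>At most one point in \<open>C 0\<close> means that all chains start at the
      same vector, so the maximum is a single signed sum of mean zero.\<close>
    have "p 0 f = c0" if "f \<in> F" for f
      using C(1)[of 0] C(3) p(1)[OF that, of 0] p(1)[OF f0, of 0]
      unfolding c0_def
      unfolding One_nat_def by (simp add: card_le_Suc0_iff_eq)
    then have "(\<lambda>f. ?s S (p 0 f)) ` F = {?s S c0}" for S using f0 by auto
    then show ?case using sign_mean_signed_sum[OF I] by simp
  next
    case (Suc m)
    define D where "D = (\<lambda>f i. p (Suc m) f i - p m f i) ` F"
    \<comment> \<open>Increments are differences of pairs of net points, so their number is bounded
      by the net sizes, whatever the size of \<open>F\<close>.\<close>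
    have "D \<subseteq> (\<lambda>(a, b) i. a i - b i) ` (C (Suc m) \<times> C m)"
      unfolding D_def using p(1) by force
    then have "card D \<le> card (C (Suc m) \<times> C m)"
      by (meson C(1) finite_SigmaI surj_card_le)
    then have "real (card D) \<le> real (card (C (Suc m))) * real (card (C m))"
      by (simp add: card_cartesian_product flip: of_nat_mult)
    also have "\<dots> \<le> exp (H (Suc m)) * exp (H m)"
      by (intro mult_mono C) auto
    finally have cD: "real (card D) \<le> exp (H m + H (Suc m))" by (simp flip: exp_add add: add.commute)
    have nD: "L2_set a I \<le> e m + e (Suc m)" if aD: "a \<in> D" for a
    proof -
      obtain f where f: "f \<in> F" "a = (\<lambda>i. p (Suc m) f i - p m f i)"
        using aD by (auto simp: D_def)
      have "L2_set a I = L2_set (\<lambda>i. (v f i - p m f i) + - (v f i - p (Suc m) f i)) I"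
        by (simp add: f(2))
      also have "\<dots> \<le> L2_set (\<lambda>i. v f i - p m f i) I + L2_set (\<lambda>i. - (v f i - p (Suc m) f i)) I"
        by (rule L2_set_triangle_ineq)
      also have "L2_set (\<lambda>i. - (v f i - p (Suc m) f i)) I = L2_set (\<lambda>i. v f i - p (Suc m) f i) I"
        by (simp add: L2_set_def power2_commute)
      finally show ?thesis using p(2)[OF f(1), of m] p(2)[OF f(1), of "Suc m"] by linarith
    qed
    have "sign_mean I (\<lambda>S. Max ((\<lambda>f. ?s S (p (Suc m) f)) ` F))
        \<le> sign_mean I (\<lambda>S. Max ((\<lambda>f. ?s S (p m f)) ` F) + Max (?s S ` D))"
    proof (rule sign_mean_mono)
      fix S
      have "(\<lambda>f. ?s S (p (Suc m) f)) = (\<lambda>f. ?s S (p m f) + ?s S (\<lambda>i. p (Suc m) f i - p m f i))"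
        by (rule ext) (rule signed_sum_split)
      then have "Max ((\<lambda>f. ?s S (p (Suc m) f)) ` F)
          \<le> Max ((\<lambda>f. ?s S (p m f)) ` F) + Max ((\<lambda>f. ?s S (\<lambda>i. p (Suc m) f i - p m f i)) ` F)"
        by (simp only: Max_image_add_le[OF F])
      also have "(\<lambda>f. ?s S (\<lambda>i. p (Suc m) f i - p m f i)) ` F = ?s S ` D"
        by (simp add: D_def image_image)
      finally show "Max ((\<lambda>f. ?s S (p (Suc m) f)) ` F) \<le> Max ((\<lambda>f. ?s S (p m f)) ` F) + Max (?s S ` D)" .
    qed
    also have "\<dots> = sign_mean I (\<lambda>S. Max ((\<lambda>f. ?s S (p m f)) ` F)) + sign_mean I (\<lambda>S. Max (?s S ` D))"
      by (rule sign_mean_add)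
    also have "\<dots> \<le> (\<Sum>k<m. (e k + e (Suc k)) * sqrt (2 * (H k + H (Suc k))))
        + (e m + e (Suc m)) * sqrt (2 * (H m + H (Suc m)))"
      using F e H cD nD
      by (intro add_mono Suc.IH Massart_finite_class[OF I]) (auto simp: D_def add_pos_pos)
    finally show ?case by simp
  qed
  have "sign_mean I (\<lambda>S. Max ((\<lambda>f. ?s S (v f)) ` F))
      \<le> sign_mean I (\<lambda>S. Max ((\<lambda>f. ?s S (p m f)) ` F) + sqrt (real (card I)) * e m)"
  proof (rule sign_mean_mono, rule Max.boundedI)
    fix S x assume "x \<in> (\<lambda>f. ?s S (v f)) ` F"
    then obtain f where f: "f \<in> F" "x = ?s S (v f)" by blast
    have "x = ?s S (p m f) + ?s S (\<lambda>i. v f i - p m f i)"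
      unfolding f(2) by (rule signed_sum_split)
    also have "?s S (p m f) \<le> Max ((\<lambda>f. ?s S (p m f)) ` F)"
      by (rule Max_ge) (use F f in auto)
    also have "?s S (\<lambda>i. v f i - p m f i) \<le> sqrt (real (card I)) * L2_set (\<lambda>i. v f i - p m f i) I"
      by (rule signed_sum_le_L2[OF I])
    also have "\<dots> \<le> sqrt (real (card I)) * e m"
      by (intro mult_left_mono p f) auto
    finally show "x \<le> Max ((\<lambda>f. ?s S (p m f)) ` F) + sqrt (real (card I)) * e m" by simp
  qed (use F in auto)
  also have "\<dots> = sign_mean I (\<lambda>S. Max ((\<lambda>f. ?s S (p m f)) ` F)) + sqrt (real (card I)) * e m"
    by (simp only: sign_mean_add sign_mean_const[OF I])
  finally show ?thesis using chain[of m] by linarith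
qed

text \<open>Log-cardinality \<open>a * 2 powr (k * p)\<close> at radius \<open>E / 2 ^ k\<close>
  gives links of order \<open>2 powr (k * (p / 2 - 1))\<close>, a convergent geometric series
  because \<open>p < 2\<close>. This is the discrete form of Dudley's integral near 0.\<close>

lemma Dudley_dyadic:
  fixes v :: "'b \<Rightarrow> 'i \<Rightarrow> real" and C :: "nat \<Rightarrow> ('i \<Rightarrow> real) set"
  assumes I: "finite I" and F: "finite F" "F \<noteq> {}" and E: "E > 0" and a: "a > 0" and p: "0 \<le> p" "p < 2"
    and C: "\<And>k. finite (C k)" "\<And>k. real (card (C k)) \<le> exp (a * 2 powr (real k * p))" "card (C 0) \<le> 1"
    and net: "\<And>k f. f \<in> F \<Longrightarrow> \<exists>c\<in>C k. L2_set (\<lambda>i. v f i - c i) I \<le> E / 2 ^ k"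
  shows "sign_mean I (\<lambda>S. Max ((\<lambda>f. \<Sum>i\<in>I. rsign S i * v f i) ` F))
     \<le> E * (6 * sqrt a / (1 - 2 powr (p / 2 - 1)) + 1)"
proof -
  define t :: real where "t = 2 powr (p / 2 - 1)"
  have t: "0 < t" "t < 1" unfolding t_def using p by (auto intro: powr_less_one)
  define e where "e k = E / 2 ^ k" for k :: nat
  define H where "H k = a * 2 powr (real k * p)" for k :: nat
  \<comment> \<open>At depth \<open>card I\<close> the remainder
    \<open>sqrt (card I) * E / 2 ^ card I\<close> is at most \<open>E\<close>; this is the final
    \<open>+ 1\<close>.\<close>
  let ?m = "card I"
  have "sign_mean I (\<lambda>S. Max ((\<lambda>f. \<Sum>i\<in>I. rsign S i * v f i) ` F))
     \<le> (\<Sum>k<?m. (e k + e (Suc k)) * sqrt (2 * (H k + H (Suc k)))) + sqrt (real (card I)) * e ?m"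
    by (rule Dudley_chaining[where C=C and e=e and H=H, OF I F C(1) _ C(3)])
       (use C(2) net E a in \<open>auto simp: e_def H_def\<close>)
  also have "(\<Sum>k<?m. (e k + e (Suc k)) * sqrt (2 * (H k + H (Suc k)))) \<le> (\<Sum>k<?m. 6 * E * sqrt a * t ^ k)"
  proof (rule sum_mono)
    fix k
    have "H k \<le> H (Suc k)"
      unfolding H_def using a p by (intro mult_left_mono powr_mono) (auto intro: mult_right_mono)
    then have "2 * (H k + H (Suc k)) \<le> 4 * H (Suc k)" by simp
    also have "\<dots> = 4 * a * 2 powr ((real k + 1) * p)" by (simp add: H_def add.commute)
    \<comment> \<open>As \<open>p \<le> 2\<close>, one finer level multiplies the entropy by at most
      4. The square root then yields the factor 4, the two radii yield 3/2, and the product is the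
      constant 6.\<close>
    also have "\<dots> \<le> 4 * a * 2 powr (real k * p + 2)"
      using a p by (intro mult_left_mono powr_mono) (auto simp: algebra_simps)
    also have "\<dots> = 16 * a * 2 powr (real k * p)" by (simp add: powr_add)
    finally have "sqrt (2 * (H k + H (Suc k))) \<le> sqrt (16 * a * 2 powr (real k * p))" by simp
    also have "\<dots> = 4 * sqrt a * sqrt (2 powr (real k * p))"
      using real_sqrt_mult[of "16 * a"] real_sqrt_mult[of 16 a] by (simp add: real_sqrt_four)
    also have "sqrt (2 powr (real k * p)) = 2 powr (real k * p / 2)" by (simp add: powr_half_sqrt[symmetric] powr_powr)
    finally have 1: "sqrt (2 * (H k + H (Suc k))) \<le> 4 * sqrt a * 2 powr (real k * p / 2)" .
    have 2: "e k + e (Suc k) = 3 / 2 * E * 2 powr (- real k)"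
      by (simp add: e_def powr_minus powr_realpow field_simps)
    have "(e k + e (Suc k)) * sqrt (2 * (H k + H (Suc k)))
        \<le> (3 / 2 * E * 2 powr (- real k)) * (4 * sqrt a * 2 powr (real k * p / 2))"
      unfolding 2 using E 1 by (intro mult_left_mono) auto
    also have "\<dots> = 6 * E * sqrt a * (2 powr (- real k) * 2 powr (real k * p / 2))" by simp
    also have "2 powr (- real k) * 2 powr (real k * p / 2) = 2 powr (real k * (p / 2 - 1))"
      unfolding powr_add[symmetric] by (simp add: algebra_simps)
    also have "2 powr (real k * (p / 2 - 1)) = t ^ k"
      using t by (simp add: t_def powr_powr mult.commute flip: powr_realpow)
    finally show "(e k + e (Suc k)) * sqrt (2 * (H k + H (Suc k))) \<le> 6 * E * sqrt a * t ^ k" .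
  qed
  also have "\<dots> = 6 * E * sqrt a * (\<Sum>k<?m. t ^ k)" by (simp add: sum_distrib_left)
  also have "\<dots> \<le> 6 * E * sqrt a * (1 / (1 - t))"
  proof (rule mult_left_mono)
    show "(\<Sum>k<?m. t ^ k) \<le> 1 / (1 - t)"
      using t by (simp add: sum_gp_strict divide_right_mono)
  qed (use E a in auto)
  also have "sqrt (real (card I)) * e ?m \<le> E"
  proof -
    have "sqrt (real ?m) \<le> real ?m" if "?m \<ge> 1"
      using that by (intro real_le_lsqrt) (auto simp: power2_eq_square)
    then have "sqrt (real ?m) \<le> real ?m" by (cases "?m = 0") auto
    also have "real ?m \<le> 2 ^ ?m" using less_exp[of ?m] by (metis less_imp_le of_nat_le_iff of_nat_numeral of_nat_power)
    finally have "sqrt (real ?m) / 2 ^ ?m \<le> 1" by simp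
    then have "E * (sqrt (real ?m) / 2 ^ ?m) \<le> E * 1" using E by (intro mult_left_mono) auto
    then show ?thesis by (simp add: e_def mult.commute)
  qed
  finally show ?thesis by (simp add: t_def algebra_simps)
qed

subsection \<open>Covers of the model class\<close>

text \<open>Cardinalities are well ordered, so the infimum is attained once a finite cover exists;
  without one it is the infimum of the empty set, which is \<open>\<infinity>\<close>.\<close>

lemma covering_number_attained:
  assumes "covering_number T dst e \<noteq> \<infinity>"
    and "ln (real (the_enat (covering_number T dst e))) \<le> h"
  shows "\<exists>C. finite C \<and> C \<subseteq> T \<and> (\<forall>t\<in>T. \<exists>c\<in>C. dst t c \<le> e) \<and> real (card C) \<le> exp h"
proof -
  let ?S = "{C. finite C \<and> C \<subseteq> T \<and> (\<forall>t\<in>T. \<exists>c\<in>C. dst t c \<le> e)}"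
  have "?S \<noteq> {}"
  proof
    assume S: "?S = {}"
    have "covering_number T dst e = \<infinity>"
      unfolding covering_number_def S by (simp add: top_enat_def)
    with assms(1) show False by contradiction
  qed
  then obtain C0 where "C0 \<in> ?S" by blast
  then have "enat (card C0) \<in> (\<lambda>C. enat (card C)) ` ?S" by (rule imageI)
  from wellorder_InfI[OF this]
  have "covering_number T dst e \<in> (\<lambda>C. enat (card C)) ` ?S"
    unfolding covering_number_def .
  then obtain C where C: "C \<in> ?S" "covering_number T dst e = enat (card C)" by auto
  have "real (card C) \<le> exp h"
  \<comment> \<open>The empty cover is separate because \<open>exp (ln x) = x\<close> fails at
    0.\<close>
  proof (cases "card C = 0")
    case False
    then have "real (card C) = exp (ln (real (card C)))" by simp
    also have "\<dots> \<le> exp h" using assms(2) C(2) by simp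
    finally show ?thesis .
  qed simp
  then show ?thesis using C(1) by blast
qed

section \<open>Distances between vectors and between sample matrices\<close>

lemma vdist_eq_L2_set: "vdist m u v = L2_set (\<lambda>i. u i - v i) {..<m}"
  by (simp add: vdist_def L2_set_def)

lemma vdist_triangle: "vdist m u w \<le> vdist m u v + vdist m v w"
  unfolding vdist_eq_L2_set
  using L2_set_triangle_ineq[of "\<lambda>i. u i - v i" "\<lambda>i. v i - w i" "{..<m}"] by simp

lemma vdist_commute: "vdist m u v = vdist m v u"
  by (simp add: vdist_def power2_commute)

lemma vdist_nonneg [simp]: "0 \<le> vdist m u v"
  by (simp add: vdist_eq_L2_set)

lemma frob_dist_eq_L2_set: "frob_dist n m U V = L2_set (\<lambda>k. vdist m (U k) (V k)) {..<n}"
  by (simp add: frob_dist_def vdist_def L2_set_def sum_nonneg)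

lemma frob_dist_triangle: "frob_dist n m U W \<le> frob_dist n m U V + frob_dist n m V W"
proof -
  have "frob_dist n m U W \<le> L2_set (\<lambda>k. vdist m (U k) (V k) + vdist m (V k) (W k)) {..<n}"
    unfolding frob_dist_eq_L2_set by (intro L2_set_mono vdist_triangle vdist_nonneg)
  also have "\<dots> \<le> frob_dist n m U V + frob_dist n m V W"
    unfolding frob_dist_eq_L2_set by (rule L2_set_triangle_ineq)
  finally show ?thesis .
qed

text \<open>Used twice: for a layer applied row by row to a matrix, and for the losses, where it
  turns a cover of network outputs into one of loss vectors.\<close>

lemma L2_set_le_Lipschitz:
  assumes "0 \<le> c" "\<And>k. k < n \<Longrightarrow> \<bar>x k\<bar> \<le> c * vdist m (U k) (V k)"
  shows "L2_set x {..<n} \<le> c * frob_dist n m U V"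
proof -
  have "L2_set x {..<n} = L2_set (\<lambda>k. \<bar>x k\<bar>) {..<n}" by (simp add: L2_set_def)
  also have "\<dots> \<le> L2_set (\<lambda>k. c * vdist m (U k) (V k)) {..<n}"
    by (intro L2_set_mono) (use assms in auto)
  also have "\<dots> = c * frob_dist n m U V"
    unfolding frob_dist_eq_L2_set by (rule L2_set_right_distrib[OF assms(1), symmetric])
  finally show ?thesis .
qed

section \<open>Layers, their compositions and the propagation of errors\<close>

lemma low_rank_class_Vsp: "\<Psi> \<in> low_rank_class \<nu> d m r R \<Longrightarrow> \<Psi> x \<in> Vsp m"
  by (simp add: low_rank_class_def Vsp_def)

lemma layer_class_low_rank:
  "\<Psi> \<in> layer_class \<nu> d r R \<rho> l \<Longrightarrow> \<Psi> \<in> low_rank_class \<nu> (d (l - 1)) (d l) (r l) (R l)"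
  by (simp add: layer_class_def)

lemma layer_class_Lipschitz:
  "\<Psi> \<in> layer_class \<nu> d r R \<rho> l \<Longrightarrow> x \<in> Vsp (d (l - 1)) \<Longrightarrow> y \<in> Vsp (d (l - 1)) \<Longrightarrow>
    vdist (d l) (\<Psi> x) (\<Psi> y) \<le> \<rho> l * vdist (d (l - 1)) x y"
  by (simp add: layer_class_def)

lemma compose_layers_Vsp:
  assumes "\<forall>i\<in>{1..l}. \<Psi> i \<in> layer_class \<nu> d r R \<rho> i" "x \<in> Vsp (d 0)"
  shows "compose_layers \<Psi> l x \<in> Vsp (d l)"
proof (cases l)
  case 0
  then show ?thesis using assms by simp
next
  case (Suc k)
  then have "\<Psi> (Suc k) \<in> layer_class \<nu> d r R \<rho> (Suc k)" using assms by simp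
  from low_rank_class_Vsp[OF layer_class_low_rank[OF this]] show ?thesis by (simp add: Suc)
qed

lemma compose_layers_Lipschitz:
  assumes "\<forall>i\<in>{1..l}. \<Psi> i \<in> layer_class \<nu> d r R \<rho> i" "\<forall>i\<in>{1..l}. 0 < \<rho> i"
    and x: "x \<in> Vsp (d 0)" and y: "y \<in> Vsp (d 0)"
  shows "vdist (d l) (compose_layers \<Psi> l x) (compose_layers \<Psi> l y) \<le> (\<Prod>i\<in>{1..l}. \<rho> i) * vdist (d 0) x y"
  using assms(1,2)
proof (induction l)
  case (Suc l)
  have P: "\<Psi> (Suc l) \<in> layer_class \<nu> d r R \<rho> (Suc l)" and rho: "0 < \<rho> (Suc l)" using Suc.prems by auto
  have V: "compose_layers \<Psi> l x \<in> Vsp (d l)" "compose_layers \<Psi> l y \<in> Vsp (d l)"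
    by (rule compose_layers_Vsp; use Suc.prems x y in auto)+
  have "vdist (d (Suc l)) (compose_layers \<Psi> (Suc l) x) (compose_layers \<Psi> (Suc l) y)
      \<le> \<rho> (Suc l) * vdist (d l) (compose_layers \<Psi> l x) (compose_layers \<Psi> l y)"
    using layer_class_Lipschitz[OF P] V by simp
  also have "\<dots> \<le> \<rho> (Suc l) * ((\<Prod>i\<in>{1..l}. \<rho> i) * vdist (d 0) x y)"
    using Suc.prems by (intro mult_left_mono Suc.IH less_imp_le[OF rho]) auto
  finally show ?case by (simp add: atLeastAtMostSuc_conv mult.assoc)
qed simp

text \<open>In closed form, the sum over \<open>i \<le> l\<close> of the products of
  \<open>\<rho> j\<close> over \<open>i < j \<le> l\<close>: a unit error made at each layer is
  amplified by all later layers.\<close>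

fun error_gain :: "(nat \<Rightarrow> real) \<Rightarrow> nat \<Rightarrow> real" where
  "error_gain \<rho> 0 = 0"
| "error_gain \<rho> (Suc l) = \<rho> (Suc l) * error_gain \<rho> l + 1"

lemma error_gain_nonneg: "\<forall>i\<in>{1..l}. 0 < \<rho> i \<Longrightarrow> 0 \<le> error_gain \<rho> l"
proof (induction l)
  case (Suc l)
  then have "0 \<le> error_gain \<rho> l" "0 < \<rho> (Suc l)" by auto
  then show ?case by simp
qed simp

lemma error_gain_pos: "1 \<le> l \<Longrightarrow> \<forall>i\<in>{1..l}. 0 < \<rho> i \<Longrightarrow> 0 < error_gain \<rho> l"
proof (cases l)
  case (Suc k)
  assume "\<forall>i\<in>{1..l}. 0 < \<rho> i"
  then have "0 \<le> error_gain \<rho> k" "0 < \<rho> (Suc k)"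
    using error_gain_nonneg[of k \<rho>] Suc by auto
  then show ?thesis unfolding Suc by (simp add: add_nonneg_pos)
qed simp

text \<open>For each centre \<open>c\<close> of the first \<open>l\<close> layers, the next layer is
  covered on the matrix \<open>c\<close> in place of the actual hidden output. Replacing that output
  by \<open>c\<close> multiplies the old error by \<open>\<rho> (Suc l)\<close>, and the new cover
  adds \<open>e\<close>; this is the recursion of \<open>error_gain\<close>.\<close>

lemma composed_cover:
  assumes rho: "\<forall>i\<in>{1..l}. 0 < \<rho> i"
    and cov: "\<And>i Z. i \<in> {1..l} \<Longrightarrow> \<forall>k<n. Z k \<in> Vsp (d (i - 1)) \<Longrightarrow>
      \<exists>C. finite C \<and> C \<subseteq> (\<lambda>\<Psi>. rows_image n \<Psi> Z) ` low_rank_class \<nu> (d (i - 1)) (d i) (r i) (R i)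
        \<and> (\<forall>t\<in>(\<lambda>\<Psi>. rows_image n \<Psi> Z) ` low_rank_class \<nu> (d (i - 1)) (d i) (r i) (R i).
             \<exists>c\<in>C. frob_dist n (d i) t c \<le> e) \<and> real (card C) \<le> exp (h i)"
    and X: "\<forall>k<n. X k \<in> Vsp (d 0)"
  shows "\<exists>C. finite C \<and> real (card C) \<le> exp (\<Sum>i\<in>{1..l}. h i) \<and> (\<forall>c\<in>C. \<forall>k<n. c k \<in> Vsp (d l)) \<and>
    (\<forall>\<Psi>. (\<forall>i\<in>{1..l}. \<Psi> i \<in> layer_class \<nu> d r R \<rho> i) \<longrightarrow>
       (\<exists>c\<in>C. frob_dist n (d l) (\<lambda>k. compose_layers \<Psi> l (X k)) c \<le> error_gain \<rho> l * e))"
  using rho cov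
proof (induction l)
  case 0
  show ?case
    by (rule exI[of _ "{X}"]) (use X in \<open>auto simp: frob_dist_def\<close>)
next
  case (Suc l)
  let ?A = "low_rank_class \<nu> (d l) (d (Suc l)) (r (Suc l)) (R (Suc l))"
  have "\<exists>C. finite C \<and> real (card C) \<le> exp (\<Sum>i\<in>{1..l}. h i) \<and> (\<forall>c\<in>C. \<forall>k<n. c k \<in> Vsp (d l)) \<and>
    (\<forall>\<Psi>. (\<forall>i\<in>{1..l}. \<Psi> i \<in> layer_class \<nu> d r R \<rho> i) \<longrightarrow>
       (\<exists>c\<in>C. frob_dist n (d l) (\<lambda>k. compose_layers \<Psi> l (X k)) c \<le> error_gain \<rho> l * e))"
    using Suc.prems by (intro Suc.IH) auto
  then obtain C where C: "finite C" "real (card C) \<le> exp (\<Sum>i\<in>{1..l}. h i)"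
      "\<And>c k. c \<in> C \<Longrightarrow> k < n \<Longrightarrow> c k \<in> Vsp (d l)"
      "\<And>\<Psi>. (\<forall>i\<in>{1..l}. \<Psi> i \<in> layer_class \<nu> d r R \<rho> i) \<Longrightarrow>
       \<exists>c\<in>C. frob_dist n (d l) (\<lambda>k. compose_layers \<Psi> l (X k)) c \<le> error_gain \<rho> l * e"
    by blast
  have "\<exists>N. finite N \<and> N \<subseteq> (\<lambda>\<Psi>. rows_image n \<Psi> c) ` ?A
        \<and> (\<forall>t\<in>(\<lambda>\<Psi>. rows_image n \<Psi> c) ` ?A. \<exists>b\<in>N. frob_dist n (d (Suc l)) t b \<le> e)
        \<and> real (card N) \<le> exp (h (Suc l))" if "c \<in> C" for c
    using Suc.prems(2)[of "Suc l" c] C(3)[OF that] by simp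
  then obtain N where N: "\<And>c. c \<in> C \<Longrightarrow> finite (N c)" "\<And>c. c \<in> C \<Longrightarrow> N c \<subseteq> (\<lambda>\<Psi>. rows_image n \<Psi> c) ` ?A"
      "\<And>c \<Psi>. c \<in> C \<Longrightarrow> \<Psi> \<in> ?A \<Longrightarrow> \<exists>b\<in>N c. frob_dist n (d (Suc l)) (rows_image n \<Psi> c) b \<le> e"
      "\<And>c. c \<in> C \<Longrightarrow> real (card (N c)) \<le> exp (h (Suc l))"
    by (metis imageI)
  \<comment> \<open>Numbers of centres multiply, so exponents add. The same bound serves all
    \<open>N c\<close> because the entropy hypothesis is uniform over input matrices.\<close>
  have "real (card (\<Union>c\<in>C. N c)) \<le> (\<Sum>c\<in>C. real (card (N c)))"
    using card_UN_le[OF C(1), of N] by (simp flip: of_nat_sum)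
  also have "\<dots> \<le> (\<Sum>c\<in>C. exp (h (Suc l)))" by (rule sum_mono) (rule N(4))
  also have "\<dots> \<le> exp (\<Sum>i\<in>{1..l}. h i) * exp (h (Suc l))"
    using C(2) by (simp add: mult_right_mono)
  also have "\<dots> = exp (\<Sum>i\<in>{1..Suc l}. h i)"
    by (simp add: atLeastAtMostSuc_conv add.commute flip: exp_add)
  finally have card: "real (card (\<Union>c\<in>C. N c)) \<le> exp (\<Sum>i\<in>{1..Suc l}. h i)" .
  \<comment> \<open>Properness of the covers matters here: a centre is the image under some member
    of the class, so its rows are valid inputs for the following layer.\<close>
  have rows: "b k \<in> Vsp (d (Suc l))" if "c \<in> C" "b \<in> N c" for b c k
    using N(2)[OF that(1)] that(2) low_rank_class_Vsp
    by (fastforce simp: rows_image_def Vsp_def low_rank_class_def)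
  have app: "\<exists>b\<in>(\<Union>c\<in>C. N c). frob_dist n (d (Suc l)) (\<lambda>k. compose_layers \<Psi> (Suc l) (X k)) b
      \<le> error_gain \<rho> (Suc l) * e" if \<Psi>: "\<forall>i\<in>{1..Suc l}. \<Psi> i \<in> layer_class \<nu> d r R \<rho> i" for \<Psi>
  proof -
    have \<Psi>l: "\<forall>i\<in>{1..l}. \<Psi> i \<in> layer_class \<nu> d r R \<rho> i" using \<Psi> by auto
    obtain c where c: "c \<in> C" "frob_dist n (d l) (\<lambda>k. compose_layers \<Psi> l (X k)) c \<le> error_gain \<rho> l * e"
      using C(4)[OF \<Psi>l] by blast
    have P: "\<Psi> (Suc l) \<in> layer_class \<nu> d r R \<rho> (Suc l)" using \<Psi> by auto
    have "\<Psi> (Suc l) \<in> ?A" using layer_class_low_rank[OF P] by simp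
    from N(3)[OF c(1) this] obtain b where b: "b \<in> N c"
      "frob_dist n (d (Suc l)) (rows_image n (\<Psi> (Suc l)) c) b \<le> e" by blast
    have rho: "0 \<le> \<rho> (Suc l)" using Suc.prems(1) by (simp add: less_imp_le)
    have "frob_dist n (d (Suc l)) (\<lambda>k. compose_layers \<Psi> (Suc l) (X k)) (rows_image n (\<Psi> (Suc l)) c)
        \<le> \<rho> (Suc l) * frob_dist n (d l) (\<lambda>k. compose_layers \<Psi> l (X k)) c"
    proof (subst frob_dist_eq_L2_set, rule L2_set_le_Lipschitz[OF rho])
      fix k assume k: "k < n"
      have "compose_layers \<Psi> l (X k) \<in> Vsp (d l)"
        using \<Psi>l X k by (intro compose_layers_Vsp) auto
      then show "\<bar>vdist (d (Suc l)) (compose_layers \<Psi> (Suc l) (X k)) (rows_image n (\<Psi> (Suc l)) c k)\<bar>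
          \<le> \<rho> (Suc l) * vdist (d l) (compose_layers \<Psi> l (X k)) (c k)"
        using layer_class_Lipschitz[OF P] C(3)[OF c(1) k] k by (simp add: rows_image_def)
    qed
    also have "\<dots> \<le> \<rho> (Suc l) * (error_gain \<rho> l * e)"
      by (rule mult_left_mono[OF c(2) rho])
    finally have "frob_dist n (d (Suc l)) (\<lambda>k. compose_layers \<Psi> (Suc l) (X k)) b
        \<le> \<rho> (Suc l) * (error_gain \<rho> l * e) + e"
      using b(2) frob_dist_triangle[of n "d (Suc l)" "\<lambda>k. compose_layers \<Psi> (Suc l) (X k)" b
          "rows_image n (\<Psi> (Suc l)) c"] by linarith
    then show ?thesis using b(1) c(1) by (intro bexI[of _ b]) (auto simp: algebra_simps)
  qed
  show ?case
    using C(1) N(1) card rows app by (intro exI[of _ "\<Union>c\<in>C. N c"]) blast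
qed

text \<open>Beyond the scale \<open>D\<close> a cover has fewer than two elements, so chaining can start there
  without any bound on the diameter of the class.\<close>

lemma entropy_power_bound:
  fixes a b \<beta> q :: "'l \<Rightarrow> real"
  assumes fin: "finite J" and pos: "\<And>l. l \<in> J \<Longrightarrow> 0 \<le> a l \<and> 0 \<le> b l \<and> 0 < \<beta> l \<and> 0 < q l \<and> q l \<le> p"
    and p: "1 \<le> p"
  defines "h \<equiv> \<lambda>e. \<Sum>l\<in>J. a l * ln (1 + \<beta> l / e) + b l * (\<beta> l / e) powr (q l)"
  shows "\<exists>D A. 0 < D \<and> 0 < A \<and> h D < ln 2 \<and> (\<forall>e. 0 < e \<longrightarrow> e \<le> D \<longrightarrow> h e \<le> A * e powr (- p))"
proof -
  have "(h \<longlongrightarrow> (\<Sum>l\<in>J. a l * ln (1 + 0) + b l * 0)) at_top"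
    unfolding h_def
  proof (intro tendsto_sum tendsto_add tendsto_mult tendsto_const tendsto_ln)
    fix l assume l: "l \<in> J"
    have lim: "((\<lambda>e. \<beta> l / e) \<longlongrightarrow> 0) at_top"
      by (intro tendsto_divide_0[OF tendsto_const] filterlim_at_top_imp_at_infinity filterlim_ident)
    then show "((\<lambda>e. \<beta> l / e) \<longlongrightarrow> 0) at_top" .
    show "((\<lambda>e. (\<beta> l / e) powr q l) \<longlongrightarrow> 0) at_top"
      by (rule tendsto_zero_powrI[OF lim tendsto_const])
         (use pos[OF l] in \<open>auto intro!: eventually_mono[OF eventually_gt_at_top[of 0]]\<close>)
  qed auto
  then have "eventually (\<lambda>e. h e < ln 2) at_top" by (intro order_tendstoD) auto
  then obtain D0 where D0: "\<And>e. e \<ge> D0 \<Longrightarrow> h e < ln 2" by (auto simp: eventually_at_top_linorder)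
  define D where "D = max D0 1"
  have D: "D \<ge> 1" "h D < ln 2" using D0[of D] by (auto simp: D_def)
  \<comment> \<open>Every term is at most a multiple of \<open>e powr (- c)\<close> with
    \<open>c \<le> p\<close>: \<open>c = 1\<close> for the logarithm, by
    \<open>ln (1 + x) \<le> x\<close>, and \<open>c = q l\<close> for the power. On
    \<open>e \<le> D\<close> the factor \<open>D powr (p - c)\<close> raises the exponent to
    \<open>p\<close>. The summand 1 ensures that \<open>A\<close> is positive.\<close>
  define A where "A = 1 + (\<Sum>l\<in>J. a l * \<beta> l * D powr (p - 1) + b l * \<beta> l powr q l * D powr (p - q l))"
  have "0 \<le> (\<Sum>l\<in>J. a l * \<beta> l * D powr (p - 1) + b l * \<beta> l powr q l * D powr (p - q l))"
    using pos by (intro sum_nonneg add_nonneg_nonneg mult_nonneg_nonneg) (auto intro: less_imp_le)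
  then have A: "A > 0" by (simp add: A_def)
  have "h e \<le> A * e powr (- p)" if e: "0 < e" "e \<le> D" for e
  proof -
    have key: "e powr (- c) \<le> D powr (p - c) * e powr (- p)" if "c \<le> p" for c
    proof -
      have "e powr (- c) = e powr (p - c) * e powr (- p)" by (simp flip: powr_add)
      also have "\<dots> \<le> D powr (p - c) * e powr (- p)"
        using e that by (intro mult_right_mono powr_mono2) auto
      finally show ?thesis .
    qed
    have "h e \<le> (\<Sum>l\<in>J. (a l * \<beta> l * D powr (p - 1) + b l * \<beta> l powr q l * D powr (p - q l)) * e powr (- p))"
      unfolding h_def
    proof (rule sum_mono)
      fix l assume l: "l \<in> J"
      note pl = pos[OF l]
      have "ln (1 + \<beta> l / e) \<le> \<beta> l / e" using pl e by (intro ln_add_one_self_le_self) auto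
      also have "\<dots> = \<beta> l * e powr (- 1)" using e by (simp add: powr_minus divide_inverse)
      also have "\<dots> \<le> \<beta> l * (D powr (p - 1) * e powr (- p))"
        using key[OF p] pl by (intro mult_left_mono) auto
      finally have 1: "a l * ln (1 + \<beta> l / e) \<le> a l * (\<beta> l * (D powr (p - 1) * e powr (- p)))"
        using pl by (intro mult_left_mono) auto
      have "(\<beta> l / e) powr q l = \<beta> l powr q l * e powr (- q l)"
        using pl e by (simp add: powr_divide powr_minus_divide)
      also have "\<dots> \<le> \<beta> l powr q l * (D powr (p - q l) * e powr (- p))"
        using key[of "q l"] pl by (intro mult_left_mono) auto
      finally have 2: "b l * (\<beta> l / e) powr q l \<le> b l * (\<beta> l powr q l * (D powr (p - q l) * e powr (- p)))"
        using pl by (intro mult_left_mono) auto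
      from 1 2 show "a l * ln (1 + \<beta> l / e) + b l * (\<beta> l / e) powr q l
          \<le> (a l * \<beta> l * D powr (p - 1) + b l * \<beta> l powr q l * D powr (p - q l)) * e powr (- p)"
        by (simp add: algebra_simps)
    qed
    also have "\<dots> = (A - 1) * e powr (- p)" by (simp add: A_def sum_distrib_right)
    also have "\<dots> \<le> A * e powr (- p)" by (intro mult_right_mono) auto
    finally show ?thesis .
  qed
  then show ?thesis using D A by (intro exI[of _ D] exI[of _ A]) auto
qed

text \<open>Literally the entropy hypothesis of the theorem, so that the final proof can fold
  it.\<close>

definition entropy_bound :: "real \<Rightarrow> (nat \<Rightarrow> nat) \<Rightarrow> (nat \<Rightarrow> real) \<Rightarrow> (nat \<Rightarrow> real) \<Rightarrow> real \<Rightarrow> nat \<Rightarrow> nat \<Rightarrow> bool" where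
  "entropy_bound \<nu> d r R Ct L n \<longleftrightarrow>
    (\<forall>l\<in>{1..L}. \<forall>Z. (\<forall>k<n. Z k \<in> Vsp (d (l - 1))) \<longrightarrow> (\<forall>e>0.
            covering_number ((\<lambda>\<Psi>. rows_image n \<Psi> Z) ` low_rank_class \<nu> (d (l - 1)) (d l) (r l) (R l))
               (frob_dist n (d l)) e \<noteq> \<infinity>
          \<and> ln (real (the_enat (covering_number
               ((\<lambda>\<Psi>. rows_image n \<Psi> Z) ` low_rank_class \<nu> (d (l - 1)) (d l) (r l) (R l))
               (frob_dist n (d l)) e)))
            \<le> real (d l) * r l * ln (1 + Ct * R l * sqrt (r l * real n) / e)
              + r l * (Ct * R l * sqrt (r l * real n) / e) powr (real (d (l - 1)) / \<nu>)))"

lemma dmax_ge: "l \<le> L \<Longrightarrow> real (d l) \<le> dmax d L"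
  unfolding dmax_def by simp

lemma model_class_cases:
  assumes "f \<in> model_class \<nu> d r R \<rho> L"
  obtains \<Psi> where "f = compose_layers \<Psi> L" "\<forall>l\<in>{1..L}. \<Psi> l \<in> layer_class \<nu> d r R \<rho> l"
  using assms unfolding model_class_def by blast

text \<open>\<open>K\<close> is a product of three layer constants: the amplification
  \<open>W\<close> of cover errors, the normalized radius \<open>D\<close> at which the cover is
  trivial, and the chaining constant \<open>c\<close>.\<close>

lemma empirical_Rademacher_bound:
  assumes L: "1 \<le> L" and d: "\<forall>i\<le>L. 1 \<le> d i"
    and pos: "\<forall>l\<in>{1..L}. 0 < r l \<and> 0 < R l \<and> 0 < \<rho> l" and Ct: "0 < Ct"
    and nu: "0 < \<nu>" "\<nu> \<le> dmax d L" "dmax d L < 2 * \<nu>"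
  shows "\<exists>K>0. \<forall>n X B q F. 1 \<le> n \<longrightarrow> entropy_bound \<nu> d r R Ct L n \<longrightarrow>
    (\<forall>k<n. X k \<in> Vsp (d 0)) \<longrightarrow> 0 < B \<longrightarrow>
    (\<forall>k<n. \<forall>u\<in>Vsp (d L). \<forall>u'\<in>Vsp (d L). \<bar>q k u - q k u'\<bar> \<le> B * vdist (d L) u u') \<longrightarrow>
    finite F \<longrightarrow> F \<noteq> {} \<longrightarrow> F \<subseteq> model_class \<nu> d r R \<rho> L \<longrightarrow>
    sign_mean {..<n} (\<lambda>S. Max ((\<lambda>f. \<Sum>k<n. rsign S k * q k (f (X k))) ` F)) \<le> K * B * sqrt (real n)"
proof -
  define p where "p = dmax d L / \<nu>"
  have p: "1 \<le> p" "p < 2" using nu by (auto simp: p_def field_simps)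
  \<comment> \<open>The \<open>sqrt n\<close> of the entropy hypothesis is absent because radii are
    measured in units of \<open>sqrt n\<close>; this removes \<open>n\<close> from
    \<open>h\<close>.\<close>
  define \<beta> where "\<beta> l = Ct * R l * sqrt (r l)" for l
  define h where "h e = (\<Sum>l\<in>{1..L}. real (d l) * r l * ln (1 + \<beta> l / e)
      + r l * (\<beta> l / e) powr (real (d (l - 1)) / \<nu>))" for e
  have "\<exists>D A. 0 < D \<and> 0 < A \<and> h D < ln 2 \<and> (\<forall>e. 0 < e \<longrightarrow> e \<le> D \<longrightarrow> h e \<le> A * e powr (- p))"
    unfolding h_def
  proof (rule entropy_power_bound)
    fix l assume l: "l \<in> {1..L}"
    have "real (d (l - 1)) \<le> dmax d L" "1 \<le> d (l - 1)" using l d by (auto intro: dmax_ge)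
    then show "0 \<le> real (d l) * r l \<and> 0 \<le> r l \<and> 0 < \<beta> l \<and> 0 < real (d (l - 1)) / \<nu> \<and> real (d (l - 1)) / \<nu> \<le> p"
      using l pos Ct nu by (auto simp: \<beta>_def p_def divide_right_mono less_imp_le)
  qed (use p in auto)
  then obtain D A where D: "0 < D" and A: "0 < A" and hD: "h D < ln 2"
    and hA: "\<And>e. 0 < e \<Longrightarrow> e \<le> D \<Longrightarrow> h e \<le> A * e powr (- p)" by blast
  define W where "W = error_gain \<rho> L"
  have W: "W > 0" unfolding W_def using L pos by (intro error_gain_pos) auto
  define a where "a = A * D powr (- p)"
  have a: "a > 0" using A D by (simp add: a_def)
  define c where "c = 6 * sqrt a / (1 - 2 powr (p / 2 - 1)) + 1"
  have "2 powr (p / 2 - 1) < (1::real)" using p by (intro powr_less_one) auto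
  then have c: "c > 0" unfolding c_def using a by (intro add_nonneg_pos divide_nonneg_pos) auto
  show ?thesis
  proof (intro exI[of _ "W * D * c"] conjI allI impI)
    fix n :: nat and X B q F
    assume n: "1 \<le> n" and ent: "entropy_bound \<nu> d r R Ct L n"
      and X: "\<forall>k<n. X k \<in> Vsp (d 0)" and B: "0 < B"
      and q: "\<forall>k<n. \<forall>u\<in>Vsp (d L). \<forall>u'\<in>Vsp (d L). \<bar>q k u - q k u'\<bar> \<le> B * vdist (d L) u u'"
      and F: "finite F" "F \<noteq> {}" "F \<subseteq> model_class \<nu> d r R \<rho> L"
    \<comment> \<open>The coarsest chaining radius: per-layer radius \<open>sqrt n * D\<close>,
      amplified by \<open>W\<close> through the layers and by \<open>B\<close> through the
      loss.\<close>
    define E where "E = B * W * sqrt (real n) * D"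
    have E: "E > 0" using B W D n by (simp add: E_def)
    have "\<exists>C. finite C \<and> real (card C) \<le> exp (h (D / 2 ^ k)) \<and>
        (\<forall>f\<in>F. \<exists>c\<in>C. L2_set (\<lambda>i. q i (f (X i)) - c i) {..<n} \<le> E / 2 ^ k)" for k :: nat
    proof -
      define e where "e = sqrt (real n) * (D / 2 ^ k)"
      have e: "e > 0" using n D by (simp add: e_def)
      let ?H = "\<lambda>l. real (d l) * r l * ln (1 + \<beta> l / (D / 2 ^ k))
          + r l * (\<beta> l / (D / 2 ^ k)) powr (real (d (l - 1)) / \<nu>)"
      have be: "Ct * R l * sqrt (r l * real n) / e = \<beta> l / (D / 2 ^ k)" for l
        using n by (simp add: e_def \<beta>_def real_sqrt_mult)
      have "\<exists>C. finite C \<and> real (card C) \<le> exp (\<Sum>l\<in>{1..L}. ?H l) \<and> (\<forall>c\<in>C. \<forall>k<n. c k \<in> Vsp (d L)) \<and>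
        (\<forall>\<Psi>. (\<forall>i\<in>{1..L}. \<Psi> i \<in> layer_class \<nu> d r R \<rho> i) \<longrightarrow>
          (\<exists>c\<in>C. frob_dist n (d L) (\<lambda>k. compose_layers \<Psi> L (X k)) c \<le> error_gain \<rho> L * e))"
      proof (rule composed_cover)
        fix l and Z :: "nat \<Rightarrow> vec" assume l: "l \<in> {1..L}" and Z: "\<forall>k<n. Z k \<in> Vsp (d (l - 1))"
        show "\<exists>C. finite C \<and> C \<subseteq> (\<lambda>\<Psi>. rows_image n \<Psi> Z) ` low_rank_class \<nu> (d (l - 1)) (d l) (r l) (R l)
          \<and> (\<forall>t\<in>(\<lambda>\<Psi>. rows_image n \<Psi> Z) ` low_rank_class \<nu> (d (l - 1)) (d l) (r l) (R l).
             \<exists>c\<in>C. frob_dist n (d l) t c \<le> e) \<and> real (card C) \<le> exp (?H l)"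
        proof -
          let ?N = "covering_number ((\<lambda>\<Psi>. rows_image n \<Psi> Z) ` low_rank_class \<nu> (d (l - 1)) (d l) (r l) (R l))
            (frob_dist n (d l)) e"
          have "?N \<noteq> \<infinity> \<and> ln (real (the_enat ?N)) \<le> ?H l"
            using ent l Z e unfolding entropy_bound_def be[symmetric] by blast
          then show ?thesis by (intro covering_number_attained) auto
        qed
      qed (use pos X in auto)
      then obtain C where C: "finite C" "real (card C) \<le> exp (h (D / 2 ^ k))"
        "\<And>c k. c \<in> C \<Longrightarrow> k < n \<Longrightarrow> c k \<in> Vsp (d L)"
        "\<And>\<Psi>. (\<forall>i\<in>{1..L}. \<Psi> i \<in> layer_class \<nu> d r R \<rho> i) \<Longrightarrow>
          \<exists>c\<in>C. frob_dist n (d L) (\<lambda>k. compose_layers \<Psi> L (X k)) c \<le> error_gain \<rho> L * e"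
        unfolding h_def by blast
      let ?C = "(\<lambda>c i. q i (c i)) ` C"
      have "\<exists>c\<in>?C. L2_set (\<lambda>i. q i (f (X i)) - c i) {..<n} \<le> E / 2 ^ k" if f: "f \<in> F" for f
      proof -
        have "f \<in> model_class \<nu> d r R \<rho> L" using F(3) f by blast
        then obtain \<Psi> where \<Psi>: "f = compose_layers \<Psi> L" "\<forall>l\<in>{1..L}. \<Psi> l \<in> layer_class \<nu> d r R \<rho> l"
          by (rule model_class_cases)
        obtain c where c: "c \<in> C" "frob_dist n (d L) (\<lambda>k. f (X k)) c \<le> W * e"
          using C(4)[OF \<Psi>(2)] unfolding W_def \<Psi>(1) by blast
        have "L2_set (\<lambda>i. q i (f (X i)) - q i (c i)) {..<n} \<le> B * frob_dist n (d L) (\<lambda>k. f (X k)) c"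
        proof (rule L2_set_le_Lipschitz)
          fix k assume k: "k < n"
          have "f (X k) \<in> Vsp (d L)" unfolding \<Psi>(1) using \<Psi>(2) X k by (intro compose_layers_Vsp) auto
          then show "\<bar>q k (f (X k)) - q k (c k)\<bar> \<le> B * vdist (d L) (f (X k)) (c k)"
            using q k C(3)[OF c(1) k] by blast
        qed (use B in auto)
        also have "\<dots> \<le> B * (W * e)" using c(2) B by (intro mult_left_mono) auto
        also have "\<dots> = E / 2 ^ k" by (simp add: E_def e_def)
        finally have "L2_set (\<lambda>i. q i (f (X i)) - q i (c i)) {..<n} \<le> E / 2 ^ k" .
        then show ?thesis
          by (rule bexI[where x="\<lambda>i. q i (c i)" and A="?C"]) (rule imageI[OF c(1)])
      qed
      moreover have "real (card ?C) \<le> exp (h (D / 2 ^ k))"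
        using card_image_le[OF C(1), of "\<lambda>c i. q i (c i)"] C(2) by linarith
      ultimately show ?thesis using C(1) by (intro exI[of _ ?C]) auto
    qed
    then obtain C where C: "\<And>k. finite (C k)" "\<And>k. real (card (C k)) \<le> exp (h (D / 2 ^ k))"
      "\<And>k f. f \<in> F \<Longrightarrow> \<exists>c\<in>C k. L2_set (\<lambda>i. q i (f (X i)) - c i) {..<n} \<le> E / 2 ^ k"
      by metis
    have "sign_mean {..<n} (\<lambda>S. Max ((\<lambda>f. \<Sum>k<n. rsign S k * q k (f (X k))) ` F)) \<le> E * c"
      unfolding c_def
    proof (rule Dudley_dyadic[where C=C and p=p and v="\<lambda>f k. q k (f (X k))"])
      fix k :: nat
      have "h (D / 2 ^ k) \<le> A * (D / 2 ^ k) powr (- p)"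
        using D by (intro hA) (auto simp: field_simps)
      also have "(D / 2 ^ k) powr (- p) = D powr (- p) * 2 powr (real k * p)"
        using D by (simp add: powr_divide powr_minus powr_powr flip: powr_realpow)
           (simp add: divide_inverse flip: powr_minus)
      finally have "h (D / 2 ^ k) \<le> a * 2 powr (real k * p)" by (simp add: a_def mult.assoc)
      then show "real (card (C k)) \<le> exp (a * 2 powr (real k * p))"
        using C(2)[of k] by (meson exp_le_cancel_iff order_trans)
    next
      have "real (card (C 0)) \<le> exp (h D)" using C(2)[of 0] by simp
      \<comment> \<open>A cardinality below 2 is at most 1, as the start of the chain
        requires.\<close>
      also have "\<dots> < exp (ln 2)" using hD by (simp only: exp_less_cancel_iff)
      finally show "card (C 0) \<le> 1" by simp
    qed (use F E a p C in auto)
    then show "sign_mean {..<n} (\<lambda>S. Max ((\<lambda>f. \<Sum>k<n. rsign S k * q k (f (X k))) ` F))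
        \<le> W * D * c * B * sqrt (real n)" by (simp add: E_def mult_ac)
  qed (use W D c in auto)
qed

subsection \<open>Uniform deviations\<close>

context prob_space
begin

text \<open>Symmetrization bounds the mean by \<open>2 * b\<close>. Changing one sample point moves
  the maximum by at most \<open>2 * K\<close>, whence the denominator
  \<open>2 * n * K\<^sup>2\<close> from McDiarmid's inequality.\<close>

lemma uniform_deviation_finite:
  fixes h :: "'b \<Rightarrow> 'a \<Rightarrow> real" and n :: nat
  assumes n: "1 \<le> n" and F: "finite F" "F \<noteq> {}" and hm: "\<And>f. f \<in> F \<Longrightarrow> h f \<in> borel_measurable M"
    and K: "K > 0" and hb: "\<And>f z. f \<in> F \<Longrightarrow> z \<in> space M \<Longrightarrow> \<bar>h f z\<bar> \<le> K"
    and rad: "\<And>w. w \<in> space (PiM {..<n} (\<lambda>_. M)) \<Longrightarrow>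
      sign_mean {..<n} (\<lambda>S. Max ((\<lambda>f. \<Sum>i<n. rsign S i * h f (w i)) ` F)) \<le> b"
    and t: "t > 0"
  shows "measure (PiM {..<n} (\<lambda>_. M))
     {w \<in> space (PiM {..<n} (\<lambda>_. M)). 2 * b + t \<le> Max ((\<lambda>f. \<Sum>i<n. expectation (h f) - h f (w i)) ` F)}
     \<le> exp (- t\<^sup>2 / (2 * real n * K\<^sup>2))"
proof -
  let ?I = "PiM {..<n} (\<lambda>_. M)"
  interpret I: prob_space ?I by (rule prob_space_PiM_const)
  note [measurable] = hm
  let ?g = "\<lambda>w. Max ((\<lambda>f. \<Sum>i<n. expectation (h f) - h f (w i)) ` F)"
  let ?r = "\<lambda>w. sign_mean {..<n} (\<lambda>S. Max ((\<lambda>f. 0 + 2 * (\<Sum>i<n. rsign S i * h f (w i))) ` F))"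
  have gm: "?g \<in> borel_measurable ?I" using F by measurable
  have comp: "w i \<in> space M" if "w \<in> space ?I" "i < n" for w i
    using that by (auto simp: space_PiM PiE_iff)
  have Eb: "\<bar>expectation (h f)\<bar> \<le> K" if "f \<in> F" for f
    by (rule abs_integral_le_bound) (use that hm hb in auto)
  have gb: "\<bar>?g w\<bar> \<le> real n * (2 * K)" if w: "w \<in> space ?I" for w
  proof (rule Max_image_abs_le[OF F])
    fix f assume f: "f \<in> F"
    have "\<bar>\<Sum>i<n. expectation (h f) - h f (w i)\<bar> \<le> (\<Sum>i<n. \<bar>expectation (h f) - h f (w i)\<bar>)"
      by (rule sum_abs)
    also have "\<dots> \<le> (\<Sum>i<n. 2 * K)"
    proof (rule sum_mono)
      fix i assume "i \<in> {..<n}"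
      then have "\<bar>h f (w i)\<bar> \<le> K" using hb[OF f] comp[OF w] by simp
      then show "\<bar>expectation (h f) - h f (w i)\<bar> \<le> 2 * K" using Eb[OF f] by linarith
    qed
    finally show "\<bar>\<Sum>i<n. expectation (h f) - h f (w i)\<bar> \<le> real n * (2 * K)" by simp
  qed
  have gd: "\<bar>?g (w(i := z)) - ?g w\<bar> \<le> 2 * K" if w: "w \<in> space ?I" and i: "i \<in> {..<n}" and z: "z \<in> space M" for w i z
  proof (rule Max_image_diff_le[OF F])
    fix f assume f: "f \<in> F"
    have "(\<Sum>j<n. expectation (h f) - h f ((w(i := z)) j)) - (\<Sum>j<n. expectation (h f) - h f (w j))
        = (\<Sum>j<n. if j = i then h f (w i) - h f z else 0)"
      unfolding sum_subtractf[symmetric] by (intro sum.cong) auto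
    also have "\<dots> = h f (w i) - h f z" using i by simp
    finally show "\<bar>(\<Sum>j<n. expectation (h f) - h f ((w(i := z)) j)) - (\<Sum>j<n. expectation (h f) - h f (w j))\<bar> \<le> 2 * K"
      using hb[OF f z] hb[OF f comp[OF w, of i]] i by simp
  qed
  have le: "?r w \<le> 2 * b" if w: "w \<in> space ?I" for w
  proof -
    have M: "Max ((\<lambda>f. 0 + 2 * u f) ` F) = 2 * Max (u ` F)" for u :: "'b \<Rightarrow> real"
    proof -
      have "mono ((*) (2::real))" by (auto intro: monoI)
      from mono_Max_commute[OF this, of "u ` F"] F show ?thesis by (simp add: image_image)
    qed
    show ?thesis unfolding M sign_mean_cmult using rad[OF w] by simp
  qed
  have rb: "\<bar>?r w\<bar> \<le> 2 * (real n * K)" if w: "w \<in> space ?I" for w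
  proof (rule sign_mean_abs_le, simp, rule Max_image_abs_le[OF F])
    fix S f assume f: "f \<in> F"
    have "\<bar>\<Sum>i<n. rsign S i * h f (w i)\<bar> \<le> (\<Sum>i<n. \<bar>rsign S i * h f (w i)\<bar>)" by (rule sum_abs)
    also have "\<dots> \<le> (\<Sum>i<n. K)"
      using hb[OF f] comp[OF w] by (intro sum_mono) (auto simp: rsign_def abs_mult)
    finally show "\<bar>0 + 2 * (\<Sum>i<n. rsign S i * h f (w i))\<bar> \<le> 2 * (real n * K)" by simp
  qed
  have "integral\<^sup>L ?I ?g \<le> integral\<^sup>L ?I ?r"
    using symmetrization[OF F hm hb, where I="{..<n}" and a="\<lambda>_. 0"] by simp
  also have "\<dots> \<le> integral\<^sup>L ?I (\<lambda>_. 2 * b)"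
  proof (rule integral_mono)
    have "?r \<in> borel_measurable ?I" using F by measurable
    then show "integrable ?I ?r" by (rule integrable_PiM_bounded) (rule rb)
  qed (use le in auto)
  finally have mean: "integral\<^sup>L ?I ?g \<le> 2 * b" by (simp add: I.prob_space)
  have "measure ?I {w \<in> space ?I. 2 * b + t \<le> ?g w} \<le> measure ?I {w \<in> space ?I. integral\<^sup>L ?I ?g + t \<le> ?g w}"
    using mean gm by (intro I.finite_measure_mono) auto
  also have "\<dots> \<le> exp (- 2 * t\<^sup>2 / (real (card {..<n}) * (2 * K)\<^sup>2))"
    by (rule McDiarmid[OF _ _ gm gb gd t]) (use n K in \<open>auto simp: lessThan_empty_iff\<close>)
  also have "- 2 * t\<^sup>2 / (real (card {..<n}) * (2 * K)\<^sup>2) = - t\<^sup>2 / (2 * real n * K\<^sup>2)"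
    by (simp add: power2_eq_square field_simps)
  finally show ?thesis .
qed

text \<open>The bound for finite families does not depend on their size. The bad events of the
  initial segments increase, so continuity from below passes the bound to their union, and no
  supremum over the class has to be formed.\<close>

lemma uniform_deviation_countable:
  fixes h :: "nat \<Rightarrow> 'a \<Rightarrow> real" and n :: nat
  assumes n: "1 \<le> n" and hm: "\<And>j. h j \<in> borel_measurable M"
    and K: "K > 0" and hb: "\<And>j z. z \<in> space M \<Longrightarrow> \<bar>h j z\<bar> \<le> K"
    and rad: "\<And>w J. w \<in> space (PiM {..<n} (\<lambda>_. M)) \<Longrightarrow> finite J \<Longrightarrow> J \<noteq> {} \<Longrightarrow>
      sign_mean {..<n} (\<lambda>S. Max ((\<lambda>j. \<Sum>i<n. rsign S i * h j (w i)) ` J)) \<le> b"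
    and t: "t > 0"
  shows "\<exists>E\<in>sets (PiM {..<n} (\<lambda>_. M)). 1 - exp (- t\<^sup>2 / (2 * real n * K\<^sup>2)) \<le> measure (PiM {..<n} (\<lambda>_. M)) E \<and>
     (\<forall>w\<in>E. \<forall>j. (\<Sum>i<n. expectation (h j) - h j (w i)) \<le> 2 * b + t)"
proof -
  let ?I = "PiM {..<n} (\<lambda>_. M)"
  interpret I: prob_space ?I by (rule prob_space_PiM_const)
  note [measurable] = hm
  let ?d = "\<lambda>w j. \<Sum>i<n. expectation (h j) - h j (w i)"
  let ?\<delta> = "exp (- t\<^sup>2 / (2 * real n * K\<^sup>2))"
  define A where "A k = {w \<in> space ?I. 2 * b + t \<le> Max (?d w ` {..k})}" for k :: nat
  have Am: "A k \<in> sets ?I" for k unfolding A_def by measurable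
  have A_iff: "w \<in> A k \<longleftrightarrow> w \<in> space ?I \<and> (\<exists>j\<le>k. 2 * b + t \<le> ?d w j)" for w k
    by (auto simp: A_def Max_ge_iff)
  have "incseq A"
    by (rule incseq_SucI, rule subsetI) (unfold A_iff, use le_SucI in blast)
  then have "(\<lambda>k. measure ?I (A k)) \<longlonglongrightarrow> measure ?I (\<Union>k. A k)"
    using Am by (intro I.finite_Lim_measure_incseq) auto
  moreover have "measure ?I (A k) \<le> ?\<delta>" for k
    unfolding A_def by (rule uniform_deviation_finite) (use n hm K hb rad t in auto)
  ultimately have le: "measure ?I (\<Union>k. A k) \<le> ?\<delta>" by (intro LIMSEQ_le_const2) auto
  show ?thesis
  proof (intro bexI[of _ "space ?I - (\<Union>k. A k)"] conjI ballI allI)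
    show "1 - ?\<delta> \<le> measure ?I (space ?I - (\<Union>k. A k))"
      using le Am by (subst I.prob_compl) auto
    fix w j assume "w \<in> space ?I - (\<Union>k. A k)"
    then have "w \<in> space ?I" "w \<notin> A j" by auto
    then have "\<not> 2 * b + t \<le> ?d w j" using A_iff[of w j] by blast
    then show "?d w j \<le> 2 * b + t" by linarith
  qed (use Am in auto)
qed

end

subsection \<open>Separability of the model class\<close>

lemma tendsto_vdist_coordinatewise:
  assumes "\<And>i. (\<lambda>k. s k i) \<longlonglongrightarrow> x i"
  shows "(\<lambda>k. vdist m (s k) x) \<longlonglongrightarrow> 0"
proof -
  have "(\<lambda>k. sqrt (\<Sum>i<m. (s k i - x i)\<^sup>2)) \<longlonglongrightarrow> sqrt (\<Sum>i<m. (x i - x i)\<^sup>2)"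
    by (intro tendsto_intros assms)
  then show ?thesis by (simp add: vdist_def)
qed

lemma tendsto_fun_apply:
  fixes s :: "nat \<Rightarrow> 'i::countable \<Rightarrow> real"
  assumes "s \<longlonglongrightarrow> x"
  shows "(\<lambda>k. s k i) \<longlonglongrightarrow> x i"
proof -
  have "continuous_on UNIV (\<lambda>x. (x::'i \<Rightarrow> real) i)" by (rule continuous_on_product_coordinates)
  then have "isCont (\<lambda>x. (x::'i \<Rightarrow> real) i) x" 
    using continuous_on_eq_continuous_at[OF open_UNIV] by blast
  then show ?thesis using assms by (rule isCont_tendsto_compose)
qed

text \<open>On the input space a member is determined by its values on a dense sequence of inputs,
  and such value tables lie in a countable product of lines, which is separable. The Lipschitz
  constant common to the class spreads convergence from the dense inputs to all inputs.\<close>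

lemma model_class_separable:
  assumes rho: "\<forall>l\<in>{1..L}. 0 < \<rho> l" and ne: "model_class \<nu> d r R \<rho> L \<noteq> {}"
  shows "\<exists>g::nat \<Rightarrow> vec \<Rightarrow> vec. range g \<subseteq> model_class \<nu> d r R \<rho> L \<and>
    (\<forall>f\<in>model_class \<nu> d r R \<rho> L. \<exists>\<sigma>::nat \<Rightarrow> nat. \<forall>x\<in>Vsp (d 0).
       (\<lambda>k. vdist (d L) (g (\<sigma> k) x) (f x)) \<longlonglongrightarrow> 0)"
proof -
  let ?M = "model_class \<nu> d r R \<rho> L"
  define P where "P = (\<Prod>i\<in>{1..L}. \<rho> i)"
  have P: "P > 0" unfolding P_def using rho by (intro prod_pos) auto
  have lip: "vdist (d L) (f x) (f y) \<le> P * vdist (d 0) x y"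
    if fxy: "f \<in> ?M" "x \<in> Vsp (d 0)" "y \<in> Vsp (d 0)" for f x y
  proof -
    obtain \<Psi> where "f = compose_layers \<Psi> L" "\<forall>l\<in>{1..L}. \<Psi> l \<in> layer_class \<nu> d r R \<rho> l"
      using fxy(1) by (rule model_class_cases)
    then show ?thesis
      unfolding P_def using compose_layers_Lipschitz[of L \<Psi> \<nu> d r R \<rho> x y] rho fxy(2,3) by simp
  qed
  obtain T0 :: "vec set" where T0: "countable T0" "T0 \<subseteq> Vsp (d 0)" "Vsp (d 0) \<subseteq> closure T0"
    by (rule separable)
  have "(\<lambda>_. 0) \<in> Vsp (d 0)" by (simp add: Vsp_def)
  then have T0ne: "T0 \<noteq> {}" using T0(3) by auto
  define t where "t = from_nat_into T0"
  have t: "t k \<in> Vsp (d 0)" for k using from_nat_into[OF T0ne] T0(2) unfolding t_def by blast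
  have dense: "\<exists>j. vdist (d 0) (t j) x < e" if x: "x \<in> Vsp (d 0)" and e: "e > 0" for x e
  proof -
    obtain s where s: "\<And>k. s k \<in> T0" "s \<longlonglongrightarrow> x"
      using T0(3) x closure_sequential by blast
    have "(\<lambda>k. vdist (d 0) (s k) x) \<longlonglongrightarrow> 0"
      by (intro tendsto_vdist_coordinatewise tendsto_fun_apply s(2))
    then have "eventually (\<lambda>k. vdist (d 0) (s k) x < e) sequentially"
      using e by (rule order_tendstoD)
    then obtain k where k: "vdist (d 0) (s k) x < e" by (auto simp: eventually_sequentially)
    obtain j where "t j = s k"
      unfolding t_def using from_nat_into_surj[OF T0(1) s(1)] by blast
    then show ?thesis using k by metis
  qed
  define \<Phi> :: "(vec \<Rightarrow> vec) \<Rightarrow> nat \<times> nat \<Rightarrow> real" where "\<Phi> f = (\<lambda>(k, i). f (t k) i)" for f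
  obtain T1 where T1: "countable T1" "T1 \<subseteq> \<Phi> ` ?M" "\<Phi> ` ?M \<subseteq> closure T1"
    by (rule separable)
  have T1ne: "T1 \<noteq> {}" using T1(3) ne by auto
  \<comment> \<open>Preimages are chosen inside the model class, so its envelope and measurability
    hypotheses apply to every \<open>g j\<close>.\<close>
  define g where "g j = inv_into ?M \<Phi> (from_nat_into T1 j)" for j
  have T1in: "from_nat_into T1 j \<in> \<Phi> ` ?M" for j using from_nat_into[OF T1ne] T1(2) by blast
  have gM: "g j \<in> ?M" for j unfolding g_def by (rule inv_into_into[OF T1in])
  have g\<Phi>: "\<Phi> (g j) = from_nat_into T1 j" for j unfolding g_def by (rule f_inv_into_f[OF T1in])
  have "\<exists>\<sigma>::nat \<Rightarrow> nat. \<forall>x\<in>Vsp (d 0). (\<lambda>k. vdist (d L) (g (\<sigma> k) x) (f x)) \<longlonglongrightarrow> 0" if f: "f \<in> ?M" for f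
  proof -
    obtain s where s: "\<And>k. s k \<in> T1" "s \<longlonglongrightarrow> \<Phi> f"
      using T1(3) f closure_sequential[of "\<Phi> f" T1] by blast
    have "\<forall>k. \<exists>j. from_nat_into T1 j = s k" using from_nat_into_surj[OF T1(1) s(1)] by blast
    then obtain \<sigma> where \<sigma>: "\<And>k. from_nat_into T1 (\<sigma> k) = s k" by metis
    have co: "(\<lambda>k. g (\<sigma> k) (t j) i) \<longlonglongrightarrow> f (t j) i" for i j
    proof -
      have "(\<lambda>k. s k (j, i)) \<longlonglongrightarrow> \<Phi> f (j, i)" by (rule tendsto_fun_apply[OF s(2)])
      moreover have "s k (j, i) = g (\<sigma> k) (t j) i" for k
        using fun_cong[OF g\<Phi>[of "\<sigma> k"], of "(j, i)"] by (simp add: \<sigma> \<Phi>_def)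
      ultimately show ?thesis by (simp add: \<Phi>_def)
    qed
    show ?thesis
    proof (intro exI[of _ \<sigma>] ballI)
      fix x assume x: "x \<in> Vsp (d 0)"
      show "(\<lambda>k. vdist (d L) (g (\<sigma> k) x) (f x)) \<longlonglongrightarrow> 0"
      proof (rule LIMSEQ_I)
        fix e :: real assume e: "e > 0"
        obtain j where j: "vdist (d 0) (t j) x < e / (3 * P)" using dense[OF x, of "e / (3 * P)"] e P by auto
        then have j': "P * vdist (d 0) (t j) x < e / 3" using P by (simp add: field_simps)
        have "(\<lambda>k. vdist (d L) (g (\<sigma> k) (t j)) (f (t j))) \<longlonglongrightarrow> 0"
          by (rule tendsto_vdist_coordinatewise[OF co])
        then have "eventually (\<lambda>k. vdist (d L) (g (\<sigma> k) (t j)) (f (t j)) < e / 3) sequentially"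
          using e by (intro order_tendstoD) auto
        then obtain N where N: "\<And>k. k \<ge> N \<Longrightarrow> vdist (d L) (g (\<sigma> k) (t j)) (f (t j)) < e / 3"
          by (auto simp: eventually_sequentially)
        show "\<exists>N. \<forall>k\<ge>N. norm (vdist (d L) (g (\<sigma> k) x) (f x) - 0) < e"
        proof (intro exI[of _ N] allI impI)
          fix k assume k: "N \<le> k"
          have "vdist (d L) (g (\<sigma> k) x) (g (\<sigma> k) (t j)) < e / 3"
            using lip[OF gM x t, of "\<sigma> k" j] j' by (simp add: vdist_commute)
          moreover have "vdist (d L) (f (t j)) (f x) < e / 3"
            using lip[OF f t x, of j] j' by simp
          ultimately have "vdist (d L) (g (\<sigma> k) x) (f x) < e"
            using N[OF k] vdist_triangle[of "d L" "g (\<sigma> k) x" "f x" "g (\<sigma> k) (t j)"]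
              vdist_triangle[of "d L" "g (\<sigma> k) (t j)" "f x" "f (t j)"] by linarith
          then show "norm (vdist (d L) (g (\<sigma> k) x) (f x) - 0) < e" by simp
        qed
      qed
    qed
  qed
  then show ?thesis using gM by blast
qed

text \<open>If \<open>K B \<le> 1\<close> the complexity is paid for by the summand \<open>1 / sqrt n\<close>; otherwise \<open>B\<close>
  is bounded below, and the last layer alone makes \<open>xi0\<close> at least of order \<open>B\<^sup>2 sqrt n\<close>.\<close>

lemma complexity_le_xi0:
  assumes L: "1 \<le> L" and d: "\<forall>i\<le>L. 1 \<le> d i"
    and pos: "\<forall>l\<in>{1..L}. 0 < r l \<and> 0 < R l \<and> 0 < \<rho> l" and Ct: "0 < Ct"
    and nu: "0 < \<nu>" "\<nu> < dmax d L" "dmax d L \<le> 2 * \<nu>"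
  shows "\<exists>Cp>0. \<forall>(n::nat) C2 s' \<tau>. 1 \<le> n \<longrightarrow> 0 < C2 \<longrightarrow> 0 < s' \<longrightarrow> 0 < \<tau> \<longrightarrow>
    K * (real n * C2 / \<tau>) powr (1 / s') / sqrt (real n)
    \<le> 6 * Cp * xi0 \<nu> d r R \<rho> Ct L n C2 s' \<tau> powr (\<nu> / dmax d L)
        / (real n powr ((\<nu> / dmax d L + 1) / 2) * (dmax d L / \<nu> - 1) powr (\<nu> / dmax d L))
      + 1 / sqrt (real n)"
proof -
  define u where "u = \<nu> / dmax d L"
  have u: "0 < u" "1 \<le> 2 * u" using nu by (auto simp: u_def field_simps)
  define w where "w = (dmax d L / \<nu> - 1) powr u"
  have w: "w > 0" using nu by (simp add: w_def)
  define K' where "K' = max K 1"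
  have K': "K' \<ge> 1" "K \<le> K'" by (auto simp: K'_def)
  define b where "b = (\<Sum>i\<in>{1..L}. Ct * R i * sqrt (r i))"
  have b: "b > 0" unfolding b_def using L pos Ct by (intro sum_pos) auto
  define q where "q = max (real (d (L - 1)) / \<nu>) 1"
  have q: "q \<ge> 1" by (simp add: q_def)
  \<comment> \<open>The lower bound of \<open>y = B\<^sup>2 * b * sqrt N\<close> in the case
    \<open>K' * B > 1\<close>.\<close>
  define y0 where "y0 = b / K'\<^sup>2"
  have y0: "y0 > 0" using b K' by (simp add: y0_def)
  \<comment> \<open>From \<open>y powr q \<ge> y * y0 powr (q - 1)\<close>, the last summand of
    \<open>xi0\<close>, whose product of later Lipschitz constants is empty, is at least
    \<open>c * (B\<^sup>2 * sqrt N)\<close>.\<close>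
  define c where "c = real (d L) * r L * b * y0 powr (q - 1)"
  have dr: "0 < real (d L) * r L" using d pos L by (auto intro!: mult_pos_pos)
  have c: "c > 0" using dr b y0 by (simp add: c_def)
  \<comment> \<open>Solves \<open>6 * Cp * c powr u / w = K' * K' powr (2 * u - 1)\<close>, the
    prefactor that the second case needs.\<close>
  define Cp where "Cp = K' * w * K' powr (2 * u - 1) / (6 * c powr u)"
  have Cp: "Cp > 0" using K' w c by (simp add: Cp_def)
  show ?thesis
  proof (intro exI[of _ Cp] conjI allI impI)
    fix n :: nat and C2 s' \<tau> :: real
    assume n: "1 \<le> n" and C2: "0 < C2" and s': "0 < s'" and \<tau>: "0 < \<tau>"
    let ?X = "xi0 \<nu> d r R \<rho> Ct L n C2 s' \<tau>"
    define N where "N = real n"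
    have N: "N \<ge> 1" using n by (simp add: N_def)
    define B where "B = (N * C2 / \<tau>) powr (1 / s')"
    have B: "B > 0" using N C2 \<tau> by (simp add: B_def)
    let ?r = "6 * Cp * ?X powr u / (N powr ((u + 1) / 2) * w)"
    have r0: "0 \<le> ?r" using Cp w by simp
    have "K * B / sqrt N \<le> ?r + 1 / sqrt N"
    proof (cases "K' * B \<le> 1")
      case True
      have "K * B \<le> 1" using True K' B mult_right_mono[of K K' B] by linarith
      then have "K * B / sqrt N \<le> 1 / sqrt N" using N by (intro divide_right_mono) auto
      then show ?thesis using r0 by linarith
    next
      case False
      then have BK: "1 / K' \<le> B" using K' by (simp add: field_simps)
      define y where "y = B\<^sup>2 * b * sqrt N"
      have y: "y > 0" using B b N by (simp add: y_def)
      have "(1 / K')\<^sup>2 * b * 1 \<le> B\<^sup>2 * b * sqrt N"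
        using BK K' b N B by (intro mult_mono power_mono) auto
      then have yy: "y0 \<le> y" by (simp add: y0_def y_def power_divide)
      have T: "(N * C2 / \<tau>) powr (2 / s') = B\<^sup>2"
        using N C2 \<tau> by (simp add: B_def powr_powr powr_powr flip: powr_realpow)
      have bt: "(\<Sum>i\<in>{1..L}. Ct * R i * sqrt (r i * real n)) = b * sqrt N"
        by (simp add: b_def N_def real_sqrt_mult sum_distrib_right mult.assoc)
      have "c * (B\<^sup>2 * sqrt N) = real (d L) * r L * (y * y0 powr (q - 1))"
        by (simp add: c_def y_def)
      also have "\<dots> \<le> real (d L) * r L * (y * y powr (q - 1))"
        using dr y yy y0 q by (intro mult_left_mono powr_mono2) (auto simp: less_imp_le)
      also have "y * y powr (q - 1) = y powr q" using y by (simp add: powr_mult_base)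
      also have "real (d L) * r L * y powr q \<le> ?X"
      proof -
        let ?f = "\<lambda>i. real (d i) * r i *
          ((B\<^sup>2 * (b * sqrt N) * (\<Prod>j\<in>{i+1..L}. \<rho> j)) powr (max (real (d (i - 1)) / \<nu>) 1))"
        have "?f L \<le> (\<Sum>i\<in>{1..L}. ?f i)"
        proof (rule member_le_sum)
          fix i assume "i \<in> {1..L} - {L}"
          then have "0 \<le> r i" using pos by (auto simp: less_imp_le)
          then show "0 \<le> ?f i" by simp
        qed (use L in auto)
        also have "\<dots> = ?X" unfolding xi0_def Let_def bt T[unfolded N_def] by simp
        finally show ?thesis by (simp add: y_def q_def mult.assoc)
      qed
      finally have X: "c * (B\<^sup>2 * sqrt N) \<le> ?X" .
      \<comment> \<open>Since \<open>2 * u \<ge> 1\<close> and \<open>K' * B > 1\<close>, this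
        factor of at least 1 lifts \<open>B\<close> to \<open>B powr (2 * u)\<close>, the power in
        the lower bound of \<open>xi0 powr u\<close>.\<close>
      have "K' powr (2 * u - 1) * B powr (2 * u - 1) = (K' * B) powr (2 * u - 1)"
        using K' B by (simp add: powr_mult)
      also have "\<dots> \<ge> 1" using False u by (intro ge_one_powr_ge_zero) auto
      finally have one: "1 \<le> K' powr (2 * u - 1) * B powr (2 * u - 1)" .
      have "K * B \<le> K' * B" using K' B by (simp add: mult_right_mono)
      also have "\<dots> \<le> K' * B * (K' powr (2 * u - 1) * B powr (2 * u - 1))"
        using mult_left_mono[OF one, of "K' * B"] K' B by simp
      also have "\<dots> = K' * K' powr (2 * u - 1) * B powr (2 * u)"
      proof -
        have "B * B powr (2 * u - 1) = B powr (2 * u)" using B by (subst powr_mult_base) auto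
        then show ?thesis by (simp add: mult_ac)
      qed
      finally have KB: "K * B \<le> K' * K' powr (2 * u - 1) * B powr (2 * u)" .
      have "c powr u * (B powr (2 * u) * N powr (u / 2)) = (c * (B\<^sup>2 * sqrt N)) powr u"
      proof -
        have "B\<^sup>2 = B powr 2" "sqrt N = N powr (1 / 2)"
          using B N by (simp_all add: powr_numeral powr_half_sqrt)
        then have "(B\<^sup>2) powr u = B powr (2 * u)" "sqrt N powr u = N powr (1 / 2 * u)"
          by (simp_all only: powr_powr)
        then show ?thesis using c B N by (simp add: powr_mult)
      qed
      also have "\<dots> \<le> ?X powr u"
        using X c B N u by (intro powr_mono2) auto
      finally have Xu: "c powr u * (B powr (2 * u) * N powr (u / 2)) \<le> ?X powr u" .
      have NN: "N powr ((u + 1) / 2) = N powr (u / 2) * sqrt N"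
        using N by (simp add: powr_half_sqrt[symmetric] add_divide_distrib powr_add)
      have "K * B / sqrt N \<le> K' * K' powr (2 * u - 1) * B powr (2 * u) / sqrt N"
        using KB N by (intro divide_right_mono) auto
      also have "\<dots> = 6 * Cp * (c powr u * (B powr (2 * u) * N powr (u / 2))) / (N powr ((u + 1) / 2) * w)"
        unfolding NN Cp_def using c w N by (simp add: field_simps)
      also have "\<dots> \<le> ?r"
        using Xu Cp w by (intro divide_right_mono mult_left_mono) auto
      finally show ?thesis using N by (simp add: add_increasing2)
    qed
    then show "K * (real n * C2 / \<tau>) powr (1 / s') / sqrt (real n)
      \<le> 6 * Cp * ?X powr (\<nu> / dmax d L)
        / (real n powr ((\<nu> / dmax d L + 1) / 2) * (dmax d L / \<nu> - 1) powr (\<nu> / dmax d L))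
      + 1 / sqrt (real n)" unfolding B_def N_def u_def w_def .
  qed (rule Cp)
qed

subsection \<open>Truncation\<close>

context prob_space
begin

section \<open>Moment and tail bounds for one observation\<close>

lemma prob_ge_le_integral:
  assumes u: "integrable M u" "\<And>x. x \<in> space M \<Longrightarrow> 0 \<le> u x" and c: "(0::real) < c"
  shows "prob {x \<in> space M. c \<le> u x} \<le> expectation u / c"
proof -
  have [measurable]: "u \<in> borel_measurable M" using u by auto
  have "c * prob {x \<in> space M. c \<le> u x} = expectation (\<lambda>x. c * indicator {x \<in> space M. c \<le> u x} x)"
    by simp
  also have "\<dots> \<le> expectation u"
    using u by (intro integral_mono) (auto simp: integrable_mult_right_iff split: split_indicator
        intro!: integrable_mult_right integrable_real_indicator simp: emeasure_eq_measure)
  finally show ?thesis using c by (simp add: field_simps)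
qed

text \<open>Finiteness of the nonnegative integral gives integrability. Strictness forces
  \<open>C > 0\<close>, since \<open>ennreal C\<close> is 0 otherwise.\<close>

lemma moment_integrable:
  fixes Y :: "'a \<Rightarrow> real"
  assumes Y: "Y \<in> borel_measurable M" and m: "(\<integral>\<^sup>+z. ennreal (Y z powr q) \<partial>M) < ennreal C"
  shows "integrable M (\<lambda>z. Y z powr q)" "expectation (\<lambda>z. Y z powr q) < C" "0 < C"
proof -
  note Y[measurable]
  show C: "0 < C" using m by (metis ennreal_neg not_less not_less_zero zero_less_iff_neq_zero)
  show i: "integrable M (\<lambda>z. Y z powr q)"
    by (rule integrableI_nonneg) (use m in \<open>auto simp: less_top[symmetric]\<close>)
  have e: "(\<integral>\<^sup>+z. ennreal (Y z powr q) \<partial>M) = ennreal (expectation (\<lambda>z. Y z powr q))"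
    by (rule nn_integral_eq_integral[OF i]) auto
  have "0 \<le> expectation (\<lambda>z. Y z powr q)" by (rule integral_nonneg_AE) auto
  with m show "expectation (\<lambda>z. Y z powr q) < C"
    unfolding e by (simp only: ennreal_less_iff)
qed

text \<open>Strict because the moment bound is strict. This survives the union bound over the sample
  and gives the strict probability bound of the theorem.\<close>

lemma moment_Markov:
  fixes Y :: "'a \<Rightarrow> real"
  assumes Y: "Y \<in> borel_measurable M" and m: "(\<integral>\<^sup>+z. ennreal (Y z powr q) \<partial>M) < ennreal C"
    and q: "0 < q" and b: "0 < b"
  shows "prob {z \<in> space M. b < Y z} < C / b powr q"
proof -
  note Y[measurable] and mi = moment_integrable[OF Y m]
  have "prob {z \<in> space M. b < Y z} \<le> prob {z \<in> space M. b powr q \<le> Y z powr q}"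
    using q b by (intro finite_measure_mono) (auto intro: powr_mono2)
  also have "\<dots> \<le> expectation (\<lambda>z. Y z powr q) / b powr q"
    by (rule prob_ge_le_integral) (use mi b in auto)
  also have "\<dots> < C / b powr q"
    using mi b by (intro divide_strict_right_mono) auto
  finally show ?thesis .
qed

text \<open>Where \<open>Y > b\<close>, the factor \<open>(Y / b) powr (s - 1)\<close> is at least 1
  and turns \<open>Y\<close> into \<open>Y powr s / b powr (s - 1)\<close>. Integrability follows
  from \<open>Y \<le> 1 + Y powr s\<close>.\<close>

lemma moment_tail:
  fixes Y :: "'a \<Rightarrow> real"
  assumes Y: "Y \<in> borel_measurable M" and Y0: "\<And>z. z \<in> space M \<Longrightarrow> 0 \<le> Y z"
    and m: "(\<integral>\<^sup>+z. ennreal (Y z powr s) \<partial>M) < ennreal C" and s: "1 < s" and b: "0 < b"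
  shows "integrable M Y"
    and "expectation (\<lambda>z. Y z * indicator {z \<in> space M. b < Y z} z) \<le> C / b powr (s - 1)"
proof -
  note Y[measurable] and mi = moment_integrable[OF Y m]
  have le: "norm (Y z) \<le> norm (1 + Y z powr s)" if "z \<in> space M" for z
  proof (cases "Y z \<le> 1")
    case False
    then have "Y z powr 1 \<le> Y z powr s" using s by (intro powr_mono) auto
    then show ?thesis using False by simp
  next
    case True
    have "0 \<le> Y z powr s" by simp
    then have "Y z \<le> 1 + Y z powr s" using True by linarith
    then show ?thesis using Y0[OF that] by simp
  qed
  show i: "integrable M Y"
    by (rule Bochner_Integration.integrable_bound[of M "\<lambda>z. 1 + Y z powr s"])
       (use mi le in auto)
  have "expectation (\<lambda>z. Y z * indicator {z \<in> space M. b < Y z} z) \<le> expectation (\<lambda>z. Y z powr s / b powr (s - 1))"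
  proof (rule integral_mono)
    fix z assume z: "z \<in> space M"
    show "Y z * indicator {z \<in> space M. b < Y z} z \<le> Y z powr s / b powr (s - 1)"
    proof (cases "b < Y z")
      case True
      have "Y z * b powr (s - 1) \<le> Y z * Y z powr (s - 1)"
        using True b s by (intro mult_left_mono powr_mono2) auto
      also have "\<dots> = Y z powr s" using True b by (subst powr_mult_base) auto
      finally show ?thesis using True b z by (simp add: field_simps)
    qed simp
  qed (use i mi in \<open>auto intro!: integrable_real_mult_indicator\<close>)
  also have "\<dots> = expectation (\<lambda>z. Y z powr s) / b powr (s - 1)" by simp
  also have "\<dots> \<le> C / b powr (s - 1)" using mi by (intro divide_right_mono) auto
  finally show "expectation (\<lambda>z. Y z * indicator {z \<in> space M. b < Y z} z) \<le> C / b powr (s - 1)" .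
qed

lemma prob_Int_ge:
  assumes "A \<in> events" "B \<in> events" "1 - a \<le> prob A" "1 - b \<le> prob B"
  shows "1 - (a + b) \<le> prob (A \<inter> B)"
proof -
  have "prob (A \<inter> B) = prob A - prob (A - B)"
    using finite_measure_Diff'[OF assms(1,2)] by simp
  moreover have "prob (A - B) \<le> prob (space M - B)"
    using assms sets.sets_into_space by (intro finite_measure_mono) auto
  ultimately show ?thesis using assms prob_compl[OF assms(2)] by linarith
qed

section \<open>Transfer to an independent sample\<close>

lemma integral_PiM_component:
  fixes u :: "'a \<Rightarrow> real"
  assumes "i \<in> I" and u: "integrable M u"
  shows "integrable (PiM I (\<lambda>_. M)) (\<lambda>w. u (w i))"
    and "integral\<^sup>L (PiM I (\<lambda>_. M)) (\<lambda>w. u (w i)) = expectation u"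
proof -
  have m: "(\<lambda>w. w i) \<in> measurable (PiM I (\<lambda>_. M)) M" using assms by measurable
  have d: "distr (PiM I (\<lambda>_. M)) M (\<lambda>w. w i) = M"
    by (rule distr_PiM_component) (use assms prob_space_axioms in auto)
  show "integrable (PiM I (\<lambda>_. M)) (\<lambda>w. u (w i))"
    using integrable_distr[OF m, of u] u by (simp add: d)
  have "expectation u = integral\<^sup>L (distr (PiM I (\<lambda>_. M)) M (\<lambda>w. w i)) u" by (simp add: d)
  also have "\<dots> = integral\<^sup>L (PiM I (\<lambda>_. M)) (\<lambda>w. u (w i))"
    by (rule integral_distr[OF m]) (use u in auto)
  finally show "integral\<^sup>L (PiM I (\<lambda>_. M)) (\<lambda>w. u (w i)) = expectation u" by simp
qed

lemma prob_PiM_component: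
  assumes "i \<in> I" and A: "A \<in> events"
  shows "measure (PiM I (\<lambda>_. M)) {w \<in> space (PiM I (\<lambda>_. M)). w i \<in> A} = prob A"
proof -
  have m: "(\<lambda>w. w i) \<in> measurable (PiM I (\<lambda>_. M)) M" using assms by measurable
  have d: "distr (PiM I (\<lambda>_. M)) M (\<lambda>w. w i) = M"
    by (rule distr_PiM_component) (use assms prob_space_axioms in auto)
  have "prob A = measure (distr (PiM I (\<lambda>_. M)) M (\<lambda>w. w i)) A" by (simp add: d)
  also have "\<dots> = measure (PiM I (\<lambda>_. M)) ((\<lambda>w. w i) -` A \<inter> space (PiM I (\<lambda>_. M)))"
    by (rule measure_distr[OF m A])
  also have "(\<lambda>w. w i) -` A \<inter> space (PiM I (\<lambda>_. M)) = {w \<in> space (PiM I (\<lambda>_. M)). w i \<in> A}" by auto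
  finally show ?thesis by simp
qed

lemma sample_all_le:
  fixes Y :: "'a \<Rightarrow> real" and n :: nat
  assumes Y: "Y \<in> borel_measurable M" and n: "1 \<le> n" and p: "prob {z \<in> space M. b < Y z} < \<tau> / real n"
  defines "E \<equiv> {w \<in> space (PiM {..<n} (\<lambda>_. M)). \<forall>i<n. Y (w i) \<le> b}"
  shows "E \<in> sets (PiM {..<n} (\<lambda>_. M))" "1 - \<tau> < measure (PiM {..<n} (\<lambda>_. M)) E"
proof -
  let ?I = "PiM {..<n} (\<lambda>_. M)"
  interpret I: prob_space ?I by (rule prob_space_PiM_const)
  note Y[measurable]
  define A where "A = {z \<in> space M. b < Y z}"
  have A: "A \<in> events" unfolding A_def by measurable
  define U where "U i = {w \<in> space ?I. w i \<in> A}" for i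
  have U: "U i \<in> sets ?I" if "i < n" for i
  proof -
    have "(\<lambda>w. w i) \<in> measurable ?I M"
      by (rule measurable_component_singleton) (use that in simp)
    from measurable_sets[OF this A] show ?thesis
      by (simp add: U_def vimage_def Int_def conj_commute)
  qed
  have UU: "(\<Union>i<n. U i) \<in> sets ?I" using U by auto
  have eq: "E = space ?I - (\<Union>i<n. U i)"
  proof -
    have "w i \<in> space M" if "w \<in> space ?I" "i < n" for w i
      using that by (auto simp: space_PiM PiE_iff)
    then show ?thesis by (auto simp: E_def U_def A_def not_less)
  qed
  show "E \<in> sets ?I" unfolding eq using UU by auto
  have "measure ?I (\<Union>i<n. U i) \<le> (\<Sum>i<n. measure ?I (U i))"
    by (rule I.finite_measure_subadditive_finite) (use U in auto)
  also have "\<dots> = (\<Sum>i<n. prob A)"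
    unfolding U_def by (intro sum.cong refl prob_PiM_component A) auto
  also have "\<dots> < \<tau>" using p n by (simp add: A_def field_simps)
  finally show "1 - \<tau> < measure ?I E" unfolding eq using I.prob_compl[OF UU] by linarith
qed

lemma sample_sum_Markov:
  fixes u :: "'a \<Rightarrow> real" and n :: nat
  assumes n: "1 \<le> n" and u: "integrable M u" "\<And>z. z \<in> space M \<Longrightarrow> 0 \<le> u z"
    and m: "expectation u \<le> c" and c: "0 < c" and \<eta>: "0 < \<eta>"
  defines "E \<equiv> {w \<in> space (PiM {..<n} (\<lambda>_. M)). (\<Sum>i<n. u (w i)) \<le> real n * c / \<eta>}"
  shows "E \<in> sets (PiM {..<n} (\<lambda>_. M))" "1 - \<eta> \<le> measure (PiM {..<n} (\<lambda>_. M)) E"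
proof -
  let ?I = "PiM {..<n} (\<lambda>_. M)"
  interpret I: prob_space ?I by (rule prob_space_PiM_const)
  have [measurable]: "u \<in> borel_measurable M" using u by auto
  let ?s = "\<lambda>w. \<Sum>i<n. u (w i)" and ?c = "real n * c / \<eta>"
  have cpos: "0 < ?c" using n c \<eta> by simp
  show "E \<in> sets ?I" unfolding E_def by measurable
  have si: "integrable ?I ?s" by (intro Bochner_Integration.integrable_sum integral_PiM_component(1) u)
  have comp: "integrable ?I (\<lambda>w. u (w i))" "integral\<^sup>L ?I (\<lambda>w. u (w i)) = expectation u"
    if "i \<in> {..<n}" for i
    by (rule integral_PiM_component[OF that u(1)])+
  have "integral\<^sup>L ?I ?s = (\<Sum>i<n. integral\<^sup>L ?I (\<lambda>w. u (w i)))"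
    by (rule Bochner_Integration.integral_sum) (rule comp(1))
  also have "\<dots> = (\<Sum>i<n. expectation u)" by (intro sum.cong refl comp(2))
  also have "\<dots> \<le> real n * c" using m n by (simp add: mult_left_mono)
  finally have mean: "integral\<^sup>L ?I ?s \<le> real n * c" .
  have "measure ?I {w \<in> space ?I. ?c \<le> ?s w} \<le> integral\<^sup>L ?I ?s / ?c"
  proof (rule I.prob_ge_le_integral[OF si _ cpos])
    fix w assume "w \<in> space ?I"
    then have "w i \<in> space M" if "i < n" for i using that by (auto simp: space_PiM PiE_iff)
    then show "0 \<le> ?s w" by (intro sum_nonneg u(2)) auto
  qed
  also have "\<dots> \<le> real n * c / ?c" using mean cpos by (intro divide_right_mono) auto
  also have "\<dots> = \<eta>" using n c \<eta> by simp
  finally have bad: "measure ?I {w \<in> space ?I. ?c \<le> ?s w} \<le> \<eta>" .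
  have bm: "{w \<in> space ?I. ?c \<le> ?s w} \<in> sets ?I" by measurable
  have "1 - \<eta> \<le> measure ?I (space ?I - {w \<in> space ?I. ?c \<le> ?s w})"
    using bad I.prob_compl[OF bm] by linarith
  also have "\<dots> \<le> measure ?I E"
    by (rule I.finite_measure_mono) (auto simp: E_def)
  finally show "1 - \<eta> \<le> measure ?I E" .
qed

text \<open>The truncation at level \<open>b\<close> of the Lipschitz weight \<open>Y\<close> is deterministic, which makes the
  Rademacher bound hold for every sample; its population error is at most \<open>k \<tau> / n\<close>.\<close>

lemma truncated_generalization:
  fixes l :: "nat \<Rightarrow> 'a \<Rightarrow> real" and n :: nat and Y H :: "'a \<Rightarrow> real"
  assumes n: "1 \<le> n" and lm: "\<And>j. l j \<in> borel_measurable M"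
    and lH: "\<And>j z. z \<in> space M \<Longrightarrow> \<bar>l j z\<bar> \<le> H z"
    and H: "H \<in> borel_measurable M" "(\<integral>\<^sup>+z. ennreal (H z powr s) \<partial>M) < ennreal C1" and s: "1 < s"
    and Y: "Y \<in> borel_measurable M" and k: "0 < k" and Yb: "prob {z \<in> space M. b < Y z} < \<tau> / real n"
    and rad: "\<And>w J. w \<in> space (PiM {..<n} (\<lambda>_. M)) \<Longrightarrow> finite J \<Longrightarrow> J \<noteq> {} \<Longrightarrow>
      sign_mean {..<n} (\<lambda>S. Max ((\<lambda>j. \<Sum>i<n. rsign S i *
        (l j (w i) * indicator {z \<in> space M. H z \<le> k \<and> Y z \<le> b} (w i))) ` J)) \<le> Rb"
    and \<epsilon>: "0 < \<epsilon>" "\<epsilon> < 1" and \<eta>: "0 < \<eta>" "\<eta> < 1"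
  shows "\<exists>E\<in>sets (PiM {..<n} (\<lambda>_. M)). 1 - \<epsilon> - \<tau> - \<eta> < measure (PiM {..<n} (\<lambda>_. M)) E \<and>
    (\<forall>w\<in>E. \<forall>j. expectation (l j) \<le> (1 / real n) * (\<Sum>i<n. l j (w i))
       + 2 * Rb / real n + k * sqrt (2 * ln (1 / \<epsilon>)) / sqrt (real n) + k * \<tau> / real n
       + 2 * C1 / (\<eta> * k powr (s - 1)))"
proof -
  let ?I = "PiM {..<n} (\<lambda>_. M)"
  interpret I: prob_space ?I by (rule prob_space_PiM_const)
  note [measurable] = lm H(1) Y
  have H0: "0 \<le> H z" if "z \<in> space M" for z using lH[OF that, of 0] by linarith
  define A where "A = {z \<in> space M. H z \<le> k \<and> Y z \<le> b}"
  define h where "h j z = l j z * indicator A z" for j z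
  \<comment> \<open>Pays for points whose envelope exceeds \<open>k\<close>, where truncation
    changes the loss by at most \<open>H z\<close>.\<close>
  define T where "T z = H z * indicator {z \<in> space M. k < H z} z" for z
  define c where "c = C1 / k powr (s - 1)"
  have A[measurable]: "A \<in> events" unfolding A_def by measurable
  have c: "0 < c" using moment_integrable(3)[OF H] k by (simp add: c_def)
  have Hi: "integrable M H" and ET: "expectation T \<le> c"
    unfolding T_def c_def using moment_tail[OF H(1) H0 H(2) s k] by auto
  have Ti: "integrable M T" unfolding T_def using Hi by (intro integrable_real_mult_indicator) auto
  have T0: "0 \<le> T z" if "z \<in> space M" for z using H0[OF that] by (simp add: T_def)
  have hm: "h j \<in> borel_measurable M" for j unfolding h_def by measurable
  have hb: "\<bar>h j z\<bar> \<le> k" if "z \<in> space M" for j z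
    using lH[OF that, of j] that k by (auto simp: h_def A_def split: split_indicator)
  have li: "integrable M (l j)" for j
    by (rule Bochner_Integration.integrable_bound[OF Hi]) (use lH H0 in auto)
  have hi: "integrable M (h j)" for j unfolding h_def using li by (intro integrable_real_mult_indicator) auto
  \<comment> \<open>Makes the failure bound of the uniform deviation equal to
    \<open>\<epsilon>\<close>.\<close>
  define t where "t = k * sqrt (2 * real n * ln (1 / \<epsilon>))"
  have ln: "ln (1 / \<epsilon>) > 0" using \<epsilon> by simp
  have t: "t > 0" using k n ln by (simp add: t_def)
  have "t\<^sup>2 = k\<^sup>2 * (2 * real n * ln (1 / \<epsilon>))" using ln n by (simp add: t_def power_mult_distrib)
  then have "- t\<^sup>2 / (2 * real n * k\<^sup>2) = - ln (1 / \<epsilon>)" using k n by simp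
  then have ex: "exp (- t\<^sup>2 / (2 * real n * k\<^sup>2)) = \<epsilon>" using \<epsilon> by (simp add: ln_div)
  have rad': "sign_mean {..<n} (\<lambda>S. Max ((\<lambda>j. \<Sum>i<n. rsign S i * h j (w i)) ` J)) \<le> Rb"
    if "w \<in> space ?I" "finite J" "J \<noteq> {}" for w J
    unfolding h_def using rad[OF that] unfolding A_def .
  obtain E1 where E1: "E1 \<in> sets ?I" "1 - \<epsilon> \<le> measure ?I E1"
    and dev: "\<And>w j. w \<in> E1 \<Longrightarrow> (\<Sum>i<n. expectation (h j) - h j (w i)) \<le> 2 * Rb + t"
    using uniform_deviation_countable[where h=h and b=Rb, OF n hm k hb rad' t] unfolding ex by blast
  define E2 where "E2 = {w \<in> space ?I. \<forall>i<n. Y (w i) \<le> b}"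
  define E3 where "E3 = {w \<in> space ?I. (\<Sum>i<n. T (w i)) \<le> real n * c / \<eta>}"
  have E2: "E2 \<in> sets ?I" "1 - \<tau> < measure ?I E2"
    unfolding E2_def by (rule sample_all_le[OF Y n Yb])+
  have E3: "E3 \<in> sets ?I" "1 - \<eta> \<le> measure ?I E3"
    unfolding E3_def by (rule sample_sum_Markov[OF n Ti T0 ET c \<eta>(1)]; simp)+
  show ?thesis
  proof (intro bexI[of _ "(E1 \<inter> E3) \<inter> E2"] conjI ballI allI)
    show "E1 \<inter> E3 \<inter> E2 \<in> sets ?I" using E1 E2 E3 by auto
    have "1 - (\<epsilon> + \<eta>) \<le> measure ?I (E1 \<inter> E3)"
      by (rule I.prob_Int_ge) (use E1 E3 in auto)
    \<comment> \<open>\<open>E2\<close> enters with its exact failure probability, so that its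
      strict bound can be used afterwards.\<close>
    then have "1 - ((\<epsilon> + \<eta>) + (1 - measure ?I E2)) \<le> measure ?I (E1 \<inter> E3 \<inter> E2)"
      by (intro I.prob_Int_ge) (use E1 E2 E3 in auto)
    then show "1 - \<epsilon> - \<tau> - \<eta> < measure ?I (E1 \<inter> E3 \<inter> E2)" using E2(2) by linarith
    fix w j assume w: "w \<in> E1 \<inter> E3 \<inter> E2"
    have ws: "w i \<in> space M" if "i < n" for i
      using w that by (auto simp: E2_def space_PiM PiE_iff)
    \<comment> \<open>Outside \<open>A\<close>, either \<open>H > k\<close>, paid for by
      \<open>T\<close>, or \<open>H \<le> k\<close> and \<open>Y > b\<close>, where the loss is at
      most \<open>k\<close>.\<close>
    have "expectation (l j) \<le> expectation (\<lambda>z. h j z + T z + k * indicator {z \<in> space M. b < Y z} z)"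
    proof (rule integral_mono)
      fix z assume z: "z \<in> space M"
      show "l j z \<le> h j z + T z + k * indicator {z \<in> space M. b < Y z} z"
        using lH[OF z, of j] H0[OF z] k z
        by (auto simp: h_def T_def A_def not_le not_less split: split_indicator)
    qed (use li hi Ti in \<open>auto intro!: Bochner_Integration.integrable_add integrable_mult_right integrable_real_indicator simp: emeasure_eq_measure\<close>)
    also have "\<dots> = expectation (h j) + expectation T + k * prob {z \<in> space M. b < Y z}"
      using hi Ti by (subst Bochner_Integration.integral_add) (auto simp: emeasure_eq_measure intro!: integrable_mult_right integrable_real_indicator)
    also have "\<dots> \<le> expectation (h j) + c + k * (\<tau> / real n)"
      using ET Yb k by (intro add_mono mult_left_mono) auto
    finally have 1: "expectation (l j) \<le> expectation (h j) + c + k * (\<tau> / real n)" .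
    have "real n * expectation (h j) \<le> (\<Sum>i<n. h j (w i)) + 2 * Rb + t"
      using dev[of w j] w by (simp add: sum_subtractf)
    \<comment> \<open>\<open>E2\<close> excludes \<open>Y > b\<close> on the sample, so
      \<open>T\<close> alone covers the truncation error there.\<close>
    also have "(\<Sum>i<n. h j (w i)) \<le> (\<Sum>i<n. l j (w i) + T (w i))"
    proof (rule sum_mono)
      fix i assume "i \<in> {..<n}"
      then have z: "w i \<in> space M" and y: "Y (w i) \<le> b" using ws w by (auto simp: E2_def)
      show "h j (w i) \<le> l j (w i) + T (w i)"
        using lH[OF z, of j] H0[OF z] z y
        by (auto simp: h_def T_def A_def not_le not_less split: split_indicator)
    qed
    also have "\<dots> = (\<Sum>i<n. l j (w i)) + (\<Sum>i<n. T (w i))" by (rule sum.distrib)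
    also have "(\<Sum>i<n. T (w i)) \<le> real n * c / \<eta>" using w by (simp add: E3_def)
    finally have "real n * expectation (h j) \<le> (\<Sum>i<n. l j (w i)) + real n * c / \<eta> + 2 * Rb + t" by simp
    then have "real n * expectation (h j) / real n \<le> ((\<Sum>i<n. l j (w i)) + real n * c / \<eta> + 2 * Rb + t) / real n"
      by (rule divide_right_mono) simp
    then have 2: "expectation (h j) \<le> (1 / real n) * (\<Sum>i<n. l j (w i)) + c / \<eta> + 2 * Rb / real n + t / real n"
      using n by (simp add: add_divide_distrib)
    have "t / real n = k * sqrt (2 * ln (1 / \<epsilon>)) * (sqrt (real n) / real n)"
      by (simp add: t_def real_sqrt_mult)
    also have "sqrt (real n) / real n = 1 / sqrt (real n)" using n by (simp add: field_simps)
    finally have 3: "t / real n = k * sqrt (2 * ln (1 / \<epsilon>)) / sqrt (real n)" by simp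
    \<comment> \<open>One \<open>c / \<eta>\<close> is the envelope tail on the sample, the other
      dominates the population tail \<open>c\<close>; together they give the factor 2.\<close>
    have "c * \<eta> \<le> c * 1" using c \<eta> by (intro mult_left_mono) auto
    then have "c \<le> c / \<eta>" using \<eta> by (simp add: field_simps)
    moreover have "2 * C1 / (\<eta> * k powr (s - 1)) = c / \<eta> + c / \<eta>" by (simp add: c_def field_simps)
    ultimately show "expectation (l j) \<le> (1 / real n) * (\<Sum>i<n. l j (w i))
       + 2 * Rb / real n + k * sqrt (2 * ln (1 / \<epsilon>)) / sqrt (real n) + k * \<tau> / real n
       + 2 * C1 / (\<eta> * k powr (s - 1))"
      using 1 2 3 by simp
  qed
qed

end

subsection \<open>The generalization bound\<close>

text \<open>The square of the left side is at most \<open>4 * x + 2\<close>, because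
  \<open>2 * sqrt (2 * x) \<le> 2 * x + 1\<close>, and \<open>ln 2 \<ge> 1 / 2\<close> finishes. The
  1 on the left is the room for the extra \<open>1 / sqrt n\<close>.\<close>

lemma one_add_sqrt_le:
  fixes x :: real
  assumes "0 \<le> x"
  shows "1 + sqrt (2 * x) \<le> 2 * sqrt (x + ln 2)"
proof (rule power2_le_imp_le)
  have "0 \<le> (sqrt (2 * x) - 1)\<^sup>2" by simp
  then have "2 * sqrt (2 * x) \<le> 2 * x + 1" using assms by (simp add: power2_diff)
  moreover have "2 / 3 \<le> ln (2::real)" by (rule ln2_ge_two_thirds)
  ultimately have "1 + 2 * sqrt (2 * x) + 2 * x \<le> 4 * (x + ln 2)" by argo
  then show "(1 + sqrt (2 * x))\<^sup>2 \<le> (2 * sqrt (x + ln 2))\<^sup>2"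
    using assms by (simp add: power2_sum power_mult_distrib add_nonneg_nonneg)
qed (use assms in auto)

text \<open>The level \<open>k\<close> balances two rates: \<open>k / sqrt n\<close> from the
  deviation and \<open>1 / k powr (s - 1)\<close> from the envelope tail are equal. The term with
  32/3 absorbs \<open>k * \<tau> / n\<close>, by \<open>\<tau> < 1\<close> and
  \<open>ln 2 \<ge> 2 / 3\<close>.\<close>

lemma deviation_terms_le:
  fixes n s \<epsilon> \<tau> :: real
  assumes n: "1 \<le> n" and s: "1 < s" and \<epsilon>: "0 < \<epsilon>" "\<epsilon> < 1" and \<tau>: "\<tau> < 1"
  defines "k \<equiv> n powr (1 / (2 * s))"
  shows "1 / sqrt n + k * sqrt (2 * ln (1 / \<epsilon>)) / sqrt n \<le> 2 * sqrt (ln (2 / \<epsilon>)) / n powr ((s - 1) / (2 * s))"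
    and "k * \<tau> / n \<le> 32 * ln (2 / \<epsilon>) / (3 * n powr ((2 * s - 1) / (2 * s)))"
    and "k powr (s - 1) = n powr ((s - 1) / (2 * s))"
proof -
  have k: "1 \<le> k" unfolding k_def using n s by (intro ge_one_powr_ge_zero) auto
  show "k powr (s - 1) = n powr ((s - 1) / (2 * s))" by (simp add: k_def powr_powr)
  have "- ((s - 1) / (2 * s)) = 1 / (2 * s) - 1 / 2" using s by (simp add: field_simps)
  then have "1 / n powr ((s - 1) / (2 * s)) = n powr (1 / (2 * s) - 1 / 2)"
    by (simp only: powr_minus_divide[symmetric])
  also have "\<dots> = k / sqrt n" using n by (simp add: k_def powr_diff powr_half_sqrt)
  finally have e1: "k / sqrt n = 1 / n powr ((s - 1) / (2 * s))" by simp
  have "- ((2 * s - 1) / (2 * s)) = 1 / (2 * s) - 1" using s by (simp add: field_simps)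
  then have "1 / n powr ((2 * s - 1) / (2 * s)) = n powr (1 / (2 * s) - 1)"
    by (simp only: powr_minus_divide[symmetric])
  also have "\<dots> = k / n" using n by (simp add: k_def powr_diff)
  finally have e2: "k / n = 1 / n powr ((2 * s - 1) / (2 * s))" by simp
  have l: "ln (2 / \<epsilon>) = ln (1 / \<epsilon>) + ln 2" "0 \<le> ln (1 / \<epsilon>)" using \<epsilon> by (simp_all add: ln_div)
  have "1 / sqrt n + k * sqrt (2 * ln (1 / \<epsilon>)) / sqrt n \<le> k / sqrt n + k / sqrt n * sqrt (2 * ln (1 / \<epsilon>))"
    using k n by (simp add: divide_right_mono)
  also have "\<dots> = k / sqrt n * (1 + sqrt (2 * ln (1 / \<epsilon>)))" by (simp add: algebra_simps)
  also have "\<dots> \<le> k / sqrt n * (2 * sqrt (ln (2 / \<epsilon>)))"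
    unfolding l(1) using k n one_add_sqrt_le[OF l(2)] by (intro mult_left_mono) auto
  finally show "1 / sqrt n + k * sqrt (2 * ln (1 / \<epsilon>)) / sqrt n \<le> 2 * sqrt (ln (2 / \<epsilon>)) / n powr ((s - 1) / (2 * s))"
    unfolding e1 by simp
  have "\<tau> \<le> 32 * ln (2 / \<epsilon>) / 3" using \<tau> l ln2_ge_two_thirds by linarith
  then have "k / n * \<tau> \<le> k / n * (32 * ln (2 / \<epsilon>) / 3)" using k n by (intro mult_left_mono) auto
  also have "\<dots> = 32 * ln (2 / \<epsilon>) / (3 * n powr ((2 * s - 1) / (2 * s)))" unfolding e2 by simp
  finally show "k * \<tau> / n \<le> 32 * ln (2 / \<epsilon>) / (3 * n powr ((2 * s - 1) / (2 * s)))" by simp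
qed

text \<open>Dominated convergence with the envelope handles the risks, and the empirical sum is
  finite. As \<open>D\<close> is free of \<open>j\<close>, the bound passes to the limit
  unchanged.\<close>

lemma risk_le_of_dense:
  fixes l :: "nat \<Rightarrow> 'a \<Rightarrow> real"
  assumes M: "\<And>j. l j \<in> borel_measurable M" "f \<in> borel_measurable M"
    and lH: "\<And>j z. z \<in> space M \<Longrightarrow> \<bar>l j z\<bar> \<le> H z" and H: "integrable M H"
    and lim: "\<And>z. z \<in> space M \<Longrightarrow> (\<lambda>j. l j z) \<longlonglongrightarrow> f z"
    and le: "\<And>j. integral\<^sup>L M (l j) \<le> c * (\<Sum>i<n. l j (w i)) + D" and w: "\<And>i. i < n \<Longrightarrow> w i \<in> space M"
  shows "integral\<^sup>L M f \<le> c * (\<Sum>i<n. f (w i)) + D"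
proof (rule LIMSEQ_le)
  show "(\<lambda>j. integral\<^sup>L M (l j)) \<longlonglongrightarrow> integral\<^sup>L M f"
    by (rule integral_dominated_convergence[where w=H]) (use M H lH lim in auto)
  show "(\<lambda>j. c * (\<Sum>i<n. l j (w i)) + D) \<longlonglongrightarrow> c * (\<Sum>i<n. f (w i)) + D"
    by (intro tendsto_intros lim w) auto
qed (use le in auto)

theorem theorem5:
  fixes \<nu> :: real and L :: nat and d :: "nat \<Rightarrow> nat" and r R \<rho> :: "nat \<Rightarrow> real" and Ct :: real
  assumes "1 \<le> L"
    and "\<forall>i\<le>L. 1 \<le> d i"
    and "\<forall>i\<le>L. real (d i) / 2 < \<nu>"
    and "\<forall>l\<in>{1..L}. 0 < r l \<and> 0 < R l \<and> 0 < \<rho> l"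
    and "0 < Ct"
    and "\<nu> < dmax d L"
  shows "\<exists>Cp>0. \<forall>(n::nat) (P :: (vec \<times> vec) measure) (Xs :: vec set) (Ys :: vec set)
            (loss :: vec \<Rightarrow> vec \<Rightarrow> real) (B :: vec \<Rightarrow> real) (G :: vec \<times> vec \<Rightarrow> real)
            (s::real) (s'::real) (C1::real) (C2::real).
     (1 \<le> n \<and> prob_space P \<and> space P = Xs \<times> Ys \<and> Xs \<subseteq> Vsp (d 0) \<and> Ys \<subseteq> Vsp (d L)
      \<and> (\<forall>l\<in>{1..L}. \<forall>Z. (\<forall>k<n. Z k \<in> Vsp (d (l - 1))) \<longrightarrow> (\<forall>e>0.
            covering_number ((\<lambda>\<Psi>. rows_image n \<Psi> Z) ` low_rank_class \<nu> (d (l - 1)) (d l) (r l) (R l))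
               (frob_dist n (d l)) e \<noteq> \<infinity>
          \<and> ln (real (the_enat (covering_number
               ((\<lambda>\<Psi>. rows_image n \<Psi> Z) ` low_rank_class \<nu> (d (l - 1)) (d l) (r l) (R l))
               (frob_dist n (d l)) e)))
            \<le> real (d l) * r l * ln (1 + Ct * R l * sqrt (r l * real n) / e)
              + r l * (Ct * R l * sqrt (r l * real n) / e) powr (real (d (l - 1)) / \<nu>)))
      \<and> (\<forall>v\<in>Ys. 0 < B v)
      \<and> (\<forall>u u' v. u \<in> Vsp (d L) \<longrightarrow> u' \<in> Vsp (d L) \<longrightarrow> v \<in> Ys \<longrightarrow>
            \<bar>loss u v - loss u' v\<bar> \<le> B v * vdist (d L) u u')
      \<and> (\<forall>f\<in>model_class \<nu> d r R \<rho> L. \<forall>z\<in>Xs \<times> Ys. \<bar>loss (f (fst z)) (snd z)\<bar> \<le> G z)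
      \<and> 1 < s \<and> G \<in> borel_measurable P
      \<and> (\<integral>\<^sup>+z. ennreal (G z powr s) \<partial>P) < ennreal C1
      \<and> 0 < s' \<and> (\<lambda>z. B (snd z)) \<in> borel_measurable P
      \<and> (\<integral>\<^sup>+z. ennreal (B (snd z) powr s') \<partial>P) < ennreal C2
      \<and> (\<forall>f\<in>model_class \<nu> d r R \<rho> L. (\<lambda>z. loss (f (fst z)) (snd z)) \<in> borel_measurable P))
     \<longrightarrow> (\<forall>\<epsilon> \<tau> \<eta>. 0 < \<epsilon> \<and> \<epsilon> < 1 \<and> 0 < \<tau> \<and> \<tau> < 1 \<and> 0 < \<eta> \<and> \<eta> < 1 \<longrightarrow>
          (\<exists>E \<in> sets (PiM {..<n} (\<lambda>_. P)).
             1 - \<epsilon> - \<tau> - \<eta> < measure (PiM {..<n} (\<lambda>_. P)) E \<and>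
             (\<forall>\<omega>\<in>E. \<forall>f\<in>model_class \<nu> d r R \<rho> L.
                (\<integral>z. loss (f (fst z)) (snd z) \<partial>P)
                \<le> (1 / real n) * (\<Sum>i<n. loss (f (fst (\<omega> i))) (snd (\<omega> i)))
                  + 6 * Cp * xi0 \<nu> d r R \<rho> Ct L n C2 s' \<tau> powr (\<nu> / dmax d L)
                    / (real n powr ((\<nu> / dmax d L + 1) / 2) * (dmax d L / \<nu> - 1) powr (\<nu> / dmax d L))
                  + 2 * sqrt (ln (2 / \<epsilon>)) / real n powr ((s - 1) / (2 * s))
                  + 32 * ln (2 / \<epsilon>) / (3 * real n powr ((2 * s - 1) / (2 * s)))
                  + 2 * C1 / (\<eta> * real n powr ((s - 1) / (2 * s))))))"
proof -
  have d0: "1 \<le> d 0" "real (d 0) / 2 < \<nu>" using assms(2,3) by auto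
  then have nu: "0 < \<nu>" by linarith
  \<comment> \<open>The maximum is attained, so the strict bounds \<open>d i < 2 * \<nu>\<close>
    give a strict bound for \<open>dmax d L\<close>.\<close>
  have "Max (d ` {..L}) \<in> d ` {..L}" by (rule Max_in) auto
  then obtain i where "Max (d ` {..L}) = d i" "i \<in> {..L}" by (rule imageE)
  then have "i \<le> L" "dmax d L = real (d i)" by (simp_all add: dmax_def)
  then have nu2: "dmax d L < 2 * \<nu>" using assms(3) by auto
  obtain K where K: "0 < K"
    and rad: "\<And>n X B q F. 1 \<le> n \<Longrightarrow> entropy_bound \<nu> d r R Ct L n \<Longrightarrow>
      \<forall>k<n. X k \<in> Vsp (d 0) \<Longrightarrow> 0 < B \<Longrightarrow>
      \<forall>k<n. \<forall>u\<in>Vsp (d L). \<forall>u'\<in>Vsp (d L). \<bar>q k u - q k u'\<bar> \<le> B * vdist (d L) u u' \<Longrightarrow>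
      finite F \<Longrightarrow> F \<noteq> {} \<Longrightarrow> F \<subseteq> model_class \<nu> d r R \<rho> L \<Longrightarrow>
      sign_mean {..<n} (\<lambda>S. Max ((\<lambda>f. \<Sum>k<n. rsign S k * q k (f (X k))) ` F)) \<le> K * B * sqrt (real n)"
    using empirical_Rademacher_bound[OF assms(1,2,4,5) nu less_imp_le[OF assms(6)] nu2] by blast
  \<comment> \<open>\<open>2 * K\<close> because symmetrization doubles the Rademacher
    average.\<close>
  obtain Cp where Cp: "0 < Cp"
    and xi: "\<And>(n::nat) C2 s' \<tau>. 1 \<le> n \<Longrightarrow> 0 < C2 \<Longrightarrow> 0 < s' \<Longrightarrow> 0 < \<tau> \<Longrightarrow>
      2 * K * (real n * C2 / \<tau>) powr (1 / s') / sqrt (real n)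
      \<le> 6 * Cp * xi0 \<nu> d r R \<rho> Ct L n C2 s' \<tau> powr (\<nu> / dmax d L)
        / (real n powr ((\<nu> / dmax d L + 1) / 2) * (dmax d L / \<nu> - 1) powr (\<nu> / dmax d L))
      + 1 / sqrt (real n)"
    using complexity_le_xi0[OF assms(1,2,4,5) nu assms(6) less_imp_le[OF nu2], of "2 * K"] by blast
  show ?thesis
  proof (intro exI[of _ Cp] conjI allI impI, rule Cp, elim conjE, fold entropy_bound_def)
    fix n :: nat and P :: "(vec \<times> vec) measure" and Xs Ys :: "vec set"
      and loss :: "vec \<Rightarrow> vec \<Rightarrow> real" and B :: "vec \<Rightarrow> real" and G :: "vec \<times> vec \<Rightarrow> real"
      and s s' C1 C2 \<epsilon> \<tau> \<eta> :: real
    let ?M = "model_class \<nu> d r R \<rho> L" and ?I = "PiM {..<n} (\<lambda>_. P)"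
    assume n: "1 \<le> n" and P: "prob_space P" and sp: "space P = Xs \<times> Ys" and Xs: "Xs \<subseteq> Vsp (d 0)"
      and ent: "entropy_bound \<nu> d r R Ct L n"
      and B0: "\<forall>v\<in>Ys. 0 < B v"
      and lip: "\<forall>u u' v. u \<in> Vsp (d L) \<longrightarrow> u' \<in> Vsp (d L) \<longrightarrow> v \<in> Ys \<longrightarrow>
            \<bar>loss u v - loss u' v\<bar> \<le> B v * vdist (d L) u u'"
      and lG: "\<forall>f\<in>?M. \<forall>z\<in>Xs \<times> Ys. \<bar>loss (f (fst z)) (snd z)\<bar> \<le> G z"
      and s: "1 < s" and G: "G \<in> borel_measurable P" "(\<integral>\<^sup>+z. ennreal (G z powr s) \<partial>P) < ennreal C1"
      and s': "0 < s'" and B: "(\<lambda>z. B (snd z)) \<in> borel_measurable P"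
        "(\<integral>\<^sup>+z. ennreal (B (snd z) powr s') \<partial>P) < ennreal C2"
      and lm: "\<forall>f\<in>?M. (\<lambda>z. loss (f (fst z)) (snd z)) \<in> borel_measurable P"
      and \<epsilon>: "0 < \<epsilon>" "\<epsilon> < 1" and \<tau>: "0 < \<tau>" "\<tau> < 1" and \<eta>: "0 < \<eta>" "\<eta> < 1"
    let ?bound = "6 * Cp * xi0 \<nu> d r R \<rho> Ct L n C2 s' \<tau> powr (\<nu> / dmax d L)
                    / (real n powr ((\<nu> / dmax d L + 1) / 2) * (dmax d L / \<nu> - 1) powr (\<nu> / dmax d L))"
    interpret P: prob_space P by (rule P)
    interpret I: prob_space ?I by (rule P.prob_space_PiM_const)
    show "\<exists>E\<in>sets ?I. 1 - \<epsilon> - \<tau> - \<eta> < measure ?I E \<and>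
             (\<forall>w\<in>E. \<forall>f\<in>?M.
                (\<integral>z. loss (f (fst z)) (snd z) \<partial>P)
                \<le> (1 / real n) * (\<Sum>i<n. loss (f (fst (w i))) (snd (w i)))
                  + ?bound
                  + 2 * sqrt (ln (2 / \<epsilon>)) / real n powr ((s - 1) / (2 * s))
                  + 32 * ln (2 / \<epsilon>) / (3 * real n powr ((2 * s - 1) / (2 * s)))
                  + 2 * C1 / (\<eta> * real n powr ((s - 1) / (2 * s))))"
    proof (cases "?M = {}")
      \<comment> \<open>Without networks the uniform claim is vacuous, and the whole sample space
        has probability 1.\<close>
      case True
      then show ?thesis
        using \<epsilon> \<tau> \<eta> by (intro bexI[of _ "space ?I"]) (auto simp: I.prob_space)
    next
      case False
      obtain g :: "nat \<Rightarrow> vec \<Rightarrow> vec" where gM: "\<And>j. g j \<in> ?M"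
        and dense: "\<And>f. f \<in> ?M \<Longrightarrow> \<exists>\<sigma>::nat \<Rightarrow> nat. \<forall>x\<in>Vsp (d 0).
          (\<lambda>k. vdist (d L) (g (\<sigma> k) x) (f x)) \<longlonglongrightarrow> 0"
        using model_class_separable[OF _ False] assms(4) by (metis rangeI subsetD)
      define k where "k = real n powr (1 / (2 * s))"
      \<comment> \<open>Solves \<open>C2 / b powr s' = \<tau> / n\<close>, the failure probability
        allotted to each sample point.\<close>
      define b where "b = (real n * C2 / \<tau>) powr (1 / s')"
      have k: "0 < k" using n by (simp add: k_def)
      have C2: "0 < C2" by (rule P.moment_integrable(3)[OF B])
      have b: "0 < b" using n C2 \<tau> by (simp add: b_def)
      have bs: "b powr s' = real n * C2 / \<tau>" using s' n C2 \<tau> by (simp add: b_def powr_powr)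
      have Bb: "P.prob {z \<in> space P. b < B (snd z)} < \<tau> / real n"
        using P.moment_Markov[OF B s' b] unfolding bs using C2 \<tau> n by (simp add: field_simps)
      let ?l = "\<lambda>j z. loss (g j (fst z)) (snd z)"
      let ?A = "{z \<in> space P. G z \<le> k \<and> B (snd z) \<le> b}"
      have lH: "\<bar>?l j z\<bar> \<le> G z" if "z \<in> space P" for j z
        using lG gM that unfolding sp by blast
      have emp: "sign_mean {..<n} (\<lambda>S. Max ((\<lambda>j. \<Sum>i<n. rsign S i * (?l j (w i) * indicator ?A (w i))) ` J))
          \<le> K * b * sqrt (real n)"
        if w: "w \<in> space ?I" and J: "finite J" "J \<noteq> {}" for w J
      proof -
        have ws: "w i \<in> Xs \<times> Ys" if "i < n" for i
          using w that by (auto simp: space_PiM PiE_iff sp)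
        \<comment> \<open>The indicator does not involve the output \<open>u\<close>: off the event
          the product vanishes, on it \<open>B \<le> b\<close>. So \<open>b\<close> is a Lipschitz
          constant for every sample.\<close>
        have "sign_mean {..<n} (\<lambda>S. Max ((\<lambda>f. \<Sum>i<n. rsign S i *
            ((\<lambda>i u. loss u (snd (w i)) * indicator ?A (w i)) i (f (fst (w i))))) ` g ` J)) \<le> K * b * sqrt (real n)"
        proof (rule rad[OF n ent _ b])
          show "\<forall>i<n. fst (w i) \<in> Vsp (d 0)" using ws Xs by (auto simp: mem_Times_iff)
          show "\<forall>i<n. \<forall>u\<in>Vsp (d L). \<forall>u'\<in>Vsp (d L).
              \<bar>loss u (snd (w i)) * indicator ?A (w i) - loss u' (snd (w i)) * indicator ?A (w i)\<bar> \<le> b * vdist (d L) u u'"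
          proof (intro allI impI ballI)
            fix i u u' assume i: "i < n" and u: "u \<in> Vsp (d L)" "u' \<in> Vsp (d L)"
            show "\<bar>loss u (snd (w i)) * indicator ?A (w i) - loss u' (snd (w i)) * indicator ?A (w i)\<bar> \<le> b * vdist (d L) u u'"
            proof (cases "w i \<in> ?A")
              case True
              have "\<bar>loss u (snd (w i)) - loss u' (snd (w i))\<bar> \<le> B (snd (w i)) * vdist (d L) u u'"
                using lip u ws[OF i] by (simp add: mem_Times_iff)
              also have "\<dots> \<le> b * vdist (d L) u u'" using True by (intro mult_right_mono) auto
              finally show ?thesis using True by simp
            next
              case False
              then show ?thesis using b by simp
            qed
          qed
        qed (use J gM in auto)
        then show ?thesis by (simp add: image_image)
      qed
      have lmj: "?l j \<in> borel_measurable P" for j using lm gM by blast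
      obtain E where E: "E \<in> sets ?I" "1 - \<epsilon> - \<tau> - \<eta> < measure ?I E"
        and gen: "\<And>w j. w \<in> E \<Longrightarrow> P.expectation (?l j) \<le> (1 / real n) * (\<Sum>i<n. ?l j (w i))
          + 2 * (K * b * sqrt (real n)) / real n + k * sqrt (2 * ln (1 / \<epsilon>)) / sqrt (real n) + k * \<tau> / real n
          + 2 * C1 / (\<eta> * k powr (s - 1))"
        using P.truncated_generalization[where l="?l", OF n lmj lH G s B(1) k Bb emp \<epsilon> \<eta>] by blast
      \<comment> \<open>The part of the bound that is the same for every network, as the passage to
        the limit requires.\<close>
      define D where "D = 2 * (K * b * sqrt (real n)) / real n + k * sqrt (2 * ln (1 / \<epsilon>)) / sqrt (real n)
        + k * \<tau> / real n + 2 * C1 / (\<eta> * k powr (s - 1))"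
      have n': "1 \<le> real n" using n by simp
      note terms = deviation_terms_le[OF n' s \<epsilon> \<tau>(2), folded k_def]
      have "2 * (K * b * sqrt (real n)) / real n = 2 * K * b / sqrt (real n)"
        using n by (simp add: field_simps)
      then have DD: "D \<le> ?bound + 2 * sqrt (ln (2 / \<epsilon>)) / real n powr ((s - 1) / (2 * s))
          + 32 * ln (2 / \<epsilon>) / (3 * real n powr ((2 * s - 1) / (2 * s)))
          + 2 * C1 / (\<eta> * real n powr ((s - 1) / (2 * s)))"
        using xi[OF n C2 s' \<tau>(1)] terms(1,2) unfolding D_def b_def[symmetric] terms(3) by linarith
      have G0: "0 \<le> G z" if "z \<in> space P" for z using lH[OF that, of 0] by linarith
      show ?thesis
      proof (intro bexI[of _ E] conjI ballI)
        fix w f assume w: "w \<in> E" and f: "f \<in> ?M"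
        have ws: "w i \<in> space P" if "i < n" for i
          using sets.sets_into_space[OF E(1)] w that by (auto simp: space_PiM PiE_iff)
        obtain \<sigma> where \<sigma>: "\<And>x. x \<in> Vsp (d 0) \<Longrightarrow> (\<lambda>k. vdist (d L) (g (\<sigma> k) x) (f x)) \<longlonglongrightarrow> 0"
          using dense[OF f] by blast
        have V: "h x \<in> Vsp (d L)" if "h \<in> ?M" "x \<in> Vsp (d 0)" for h x
          using that(1) by (rule model_class_cases) (use that(2) compose_layers_Vsp in blast)
        have "(\<integral>z. loss (f (fst z)) (snd z) \<partial>P)
            \<le> (1 / real n) * (\<Sum>i<n. loss (f (fst (w i))) (snd (w i))) + D"
        proof (rule risk_le_of_dense[where l="\<lambda>j. ?l (\<sigma> j)" and H=G])
          show "integrable P G" by (rule P.moment_tail(1)[OF G(1) G0 G(2) s k])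
          fix z assume z: "z \<in> space P"
          then have x: "fst z \<in> Vsp (d 0)" and y: "snd z \<in> Ys" using Xs by (auto simp: sp)
          have "(\<lambda>j. B (snd z) * vdist (d L) (g (\<sigma> j) (fst z)) (f (fst z))) \<longlonglongrightarrow> 0"
            using tendsto_mult_right_zero[OF \<sigma>[OF x]] .
          then have "(\<lambda>j. ?l (\<sigma> j) z - loss (f (fst z)) (snd z)) \<longlonglongrightarrow> 0"
            by (rule Lim_null_comparison[rotated])
               (use lip V[OF gM x] V[OF f x] y in \<open>auto intro!: always_eventually\<close>)
          then show "(\<lambda>j. ?l (\<sigma> j) z) \<longlonglongrightarrow> loss (f (fst z)) (snd z)"
            by (rule LIM_zero_cancel)
        next
          fix j
          show "integral\<^sup>L P (?l (\<sigma> j)) \<le> (1 / real n) * (\<Sum>i<n. ?l (\<sigma> j) (w i)) + D"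
            using gen[OF w, of "\<sigma> j"] unfolding D_def by linarith
        qed (use lmj lm f lH ws in auto)
        then show "(\<integral>z. loss (f (fst z)) (snd z) \<partial>P)
                \<le> (1 / real n) * (\<Sum>i<n. loss (f (fst (w i))) (snd (w i)))
                  + ?bound
                  + 2 * sqrt (ln (2 / \<epsilon>)) / real n powr ((s - 1) / (2 * s))
                  + 32 * ln (2 / \<epsilon>) / (3 * real n powr ((2 * s - 1) / (2 * s)))
                  + 2 * C1 / (\<eta> * real n powr ((s - 1) / (2 * s)))"
          using DD by linarith
      qed (rule E)+
    qed
  qed
qed

end
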